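(* Assume the following three hypotheses on Borel measurable functions $f:\mathbb{R}^d\times\mathbb{R}^d\to\mathbb{R}^d$ and $g:\mathbb{R}^d\times\mathbb{R}^d\to\mathbb{R}^{d\times m}$. (i) For every $R>0$ there is $\ell_R>0$ such that $|f(x,y)-f(\bar x,\bar y)|\vee|g(x,y)-g(\bar x,\bar y)|\le \ell_R(|x-\bar x|+|y-\bar y|)$ for all $x,\bar x,y,\bar y\in\mathbb{R}^d$ with $|x|\vee|\bar x|\vee|y|\vee|\bar y|\le R$. (ii) There exist constants $\alpha\ge 2$ and $a_1,a_2,a_3\ge 0$ with $a_2>a_3$ such that $2\langle x,f(x,y)\rangle+|g(x,y)|^2\le a_1-a_2|x|^\alpha+a_3|y|^\alpha$ for all $x,y\in\mathbb{R}^d$. (iii) There exist constants $b_1,b_2,b_3,b_4\ge0$ with $b_1>b_2$, $b_3>b_4$, and a continuous function $V:\mathbb{R}^d\times\mathbb{R}^d\to\mathbb{R}_+$ with $V(x,x)=0$ for all $x$, such that for all $x,\bar x,y,\bar y\in\mathbb{R}^d$ $$2\langle x-\bar x,f(x,y)-f(\bar x,\bar y)\rangle+|g(x,y)-g(\bar x,\bar y)|^2\le -b_1|x-\bar x|^2+b_2|y-\bar y|^2-b_3V(x,\bar x)+b_4V(y,\bar y).$$ Let $\hat\Delta=\hat\Delta_1\wedge\hat\Delta_2$. Then for any $\xi\in\mathcal{C}^{\alpha}_{\mathcal{F}_0}$ and any step size $\Delta\in(0,\hat\Delta]$, the truncated EM segment process $\{Y^{\xi,\Delta}_{t_k}\}_{k\ge0}$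 is asymptotically stable in distribution and admits a unique numerical invariant measure $\pi^{\Delta}\in\mathcal{P}(C)$ (not depending on $\xi$), and $$\lim_{t_k\to\infty}d_{\Xi}\big(\mu^{\xi,\Delta}_{t_k},\pi^{\Delta}\big)=0\quad\text{uniformly in }\Delta\in(0,\hat\Delta],$$ that is, for every $\xi\in\mathcal{C}^{\alpha}_{\mathcal{F}_0}$ and $\varepsilon>0$ there is $T>0$ such that $d_\Xi(\mu^{\xi,\Delta}_{t_k},\pi^\Delta)<\varepsilon$ for all step sizes $\Delta\in(0,\hat\Delta]$ and all $k$ with $k\Delta\ge T$. Moreover, for any $M>0$, this convergence is also uniform for $\xi\in\mathbb{B}(M,\alpha)$.
   Context: Notation. $|\cdot|$ is the Euclidean norm on $\mathbb{R}^d$ and the trace (Frobenius) norm on $\mathbb{R}^{d\times m}$; $a\vee b=\max\{a,b\}$, $a\wedge b=\min\{a,b\}$; $\mathbb{R}_+=[0,\infty)$. $\tau>0$ is fixed; $C=C([-\tau,0];\mathbb{R}^d)$ with supremum norm $\|\cdot\|$. $W$ is an $m$-dimensional Brownian motion on a probability space $(\Omega,\mathcal{F},\mathbb{P})$ with a right-continuous complete filtration $\{\mathcal{F}_t\}_{t\ge0}$. $\mathcal{C}^{\alpha}_{\mathcal{F}_0}$ is the family of $\mathcal{F}_0$-measurable $C$-valued random variables $\eta$ with $\sup_{-\tau\le\theta\le0}\mathbb{E}|\eta(\theta)|^\alpha<\infty$ (elements of $C$ are regarded as deterministic members), and $\mathbb{B}(M,\alpha)=\{\xi\in\mathcal{C}^{\alpha}_{\mathcal{F}_0}:\mathbb{E}\|\xi\|\le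 M\}$. The underlying SDDE is $\mathrm{d}x(t)=f(x(t),x(t-\tau))\mathrm{d}t+g(x(t),x(t-\tau))\mathrm{d}W(t)$, $t>0$, with initial data $x=\xi$ on $[-\tau,0]$. $\mathcal{P}(C)$ is the set of Borel probability measures on $C$, with the Fortet-Mourier distance $d_\Xi(P_1,P_2)=\sup_{\Psi\in\Xi}\big|\int_C\Psi\,\mathrm{d}P_1-\int_C\Psi\,\mathrm{d}P_2\big|$, where $\Xi$ is the set of $\Psi:C\to\mathbb{R}$ with $|\Psi(X_1)-\Psi(X_2)|\le\|X_1-X_2\|$ for all $X_1,X_2\in C$ and $\sup_{X\in C}|\Psi(X)|\le1$. Truncation. Fix a strictly increasing continuous function $\Phi:[1,\infty)\to\mathbb{R}_+$ with $\Phi(R)\to\infty$ as $R\to\infty$ such that for all $R\ge1$ $$\sup_{|x|\vee|\bar x|\vee|y|\vee|\bar y|\le R}\Big[\frac{|f(x,y)-f(\bar x,\bar y)|}{|x-\bar x|+1\wedge|y-\bar y|}+\frac{|g(x,y)-g(\bar x,\bar y)|^2}{(|x-\bar x|+1\wedge|y-\bar y|)^2}\Big]\le\Phi(R)$$ (supremum over points with nonzero denominators; such $\Phi$ exists by the local Lipschitz hypothesis (i)). Fix $\nu\in(0,1/3]$, and let $K=1\vee\Phi(1)\vee|f(\mathbf{0},\mathbf{0})|\vee|g(\mathbf{0},\mathbf{0})|^2$. Define $\Gamma^{\Delta}(x)=\big(|x|\wedge\Phi^{-1}(K\Delta^{-\nu})\big)\frac{x}{|x|}$, with $x/|x|=\mathbf{0}$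 if $x=\mathbf{0}$. Scheme. Step sizes $\Delta$ are always of the form $\Delta=\tau/N\in(0,1)$ with an integer $N>\tau$; $t_k=k\Delta$ for $k\ge-N$. For $\xi\in\mathcal{C}^{\alpha}_{\mathcal{F}_0}$ let $\breve u^{\xi,\Delta}(t_k)=\xi(t_k)$ for $k=-N,\dots,0$; $u^{\xi,\Delta}(t_k)=\Gamma^{\Delta}(\breve u^{\xi,\Delta}(t_k))$ for $k\ge-N$; and for $k\ge0$ $$\breve u^{\xi,\Delta}(t_{k+1})=u^{\xi,\Delta}(t_k)+f(u^{\xi,\Delta}(t_k),u^{\xi,\Delta}(t_{k-N}))\Delta+g(u^{\xi,\Delta}(t_k),u^{\xi,\Delta}(t_{k-N}))(W(t_{k+1})-W(t_k)).$$ Let $y^{\xi,\Delta}(t)=\Gamma^\Delta(\xi(t))$ for $t\in[-\tau,0]$ and $y^{\xi,\Delta}(t)=\frac{t_{k+1}-t}{\Delta}u^{\xi,\Delta}(t_k)+\frac{t-t_k}{\Delta}u^{\xi,\Delta}(t_{k+1})$ for $t\in[t_k,t_{k+1}]$, $k\ge0$. The truncated EM segment process is the $C$-valued process $Y^{\xi,\Delta}_{t_k}(\theta)=y^{\xi,\Delta}(t_k+\theta)$, $\theta\in[-\tau,0]$, $k\ge0$; $\mu^{\xi,\Delta}_{t_k}$ denotes the law of $Y^{\xi,\Delta}_{t_k}$ on $C$. A measure $\pi^\Delta\in\mathcal{P}(C)$ is a (numerical) invariant measure if $\int_C\mathbb{P}(Y^{X,\Delta}_{t_k}\in A)\,\pi^\Delta(\mathrm{d}X)=\pi^\Delta(A)$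 for all $k\ge0$ and Borel $A\subset C$. Asymptotic stability in distribution means that there is a single probability measure in $\mathcal{P}(C)$ to which $\mu^{\xi,\Delta}_{t_k}$ converges in $d_\Xi$ as $k\to\infty$, for every initial data $\xi$. Constants. $\hat\Delta_1\in(0,1)$ is a fixed number with $a_2-6K^2\hat\Delta_1^{1-2\nu}>a_3$, and $\hat\Delta_2\in(0,1)$ is a fixed number with $b_1-4K^2\hat\Delta_2^{1-2\nu}>b_2$, with $a_i,b_i$ from the hypotheses. *)

theory Defs
  imports "HOL-Probability.Probability"
begin

section \<open>The segment space and the Fortet-Mourier distance\<close>

text \<open>The elements of \<^term>\<open>mspace (segment_space \<tau>)\<close> are the continuous functions on
  \<^term>\<open>{-\<tau>..0::real}\<close>, extended by \<^const>\<open>undefined\<close> outside this interval; the metric is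
  the supremum distance. Since the interval is compact, the boundedness built into
  \<^const>\<open>cfunspace\<close> is no restriction.\<close>

definition segment_space :: "real \<Rightarrow> (real \<Rightarrow> 'b::real_normed_vector) metric" where
  "segment_space \<tau> = cfunspace (top_of_set {-\<tau>..0}) euclidean_metric"

definition segment_norm :: "real \<Rightarrow> (real \<Rightarrow> 'b::real_normed_vector) \<Rightarrow> real" where
  "segment_norm \<tau> X = (SUP \<theta>\<in>{-\<tau>..0}. norm (X \<theta>))"

definition borel_segment :: "real \<Rightarrow> (real \<Rightarrow> 'b::real_normed_vector) measure" where
  "borel_segment \<tau> =
     sigma (mspace (segment_space \<tau>)) {U. openin (mtopology_of (segment_space \<tau>)) U}"

definition segment_prob :: "real \<Rightarrow> (real \<Rightarrow> 'b::real_normed_vector) measure set" where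
  "segment_prob \<tau> = {P. prob_space P \<and> sets P = sets (borel_segment \<tau>)}"

definition FM_functions :: "real \<Rightarrow> ((real \<Rightarrow> 'b::real_normed_vector) \<Rightarrow> real) set" where
  "FM_functions \<tau> = {\<Psi>.
     (\<forall>X\<in>mspace (segment_space \<tau>). \<forall>Y\<in>mspace (segment_space \<tau>).
        \<bar>\<Psi> X - \<Psi> Y\<bar> \<le> mdist (segment_space \<tau>) X Y) \<and>
     (\<forall>X\<in>mspace (segment_space \<tau>). \<bar>\<Psi> X\<bar> \<le> 1)}"

definition FM_dist ::
  "real \<Rightarrow> (real \<Rightarrow> 'b::real_normed_vector) measure \<Rightarrow> (real \<Rightarrow> 'b) measure \<Rightarrow> real" where
  "FM_dist \<tau> P Q = (SUP \<Psi>\<in>FM_functions \<tau>. \<bar>(\<integral>X. \<Psi> X \<partial>P) - (\<integral>X. \<Psi> X \<partial>Q)\<bar>)"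


section \<open>Filtration, Brownian motion, initial data\<close>

text \<open>Only the time indices \<open>t \<ge> 0\<close> of \<open>F\<close> and \<open>W\<close> matter. The last
  clause also makes the underlying probability space complete.\<close>

definition usual_filtration :: "'w measure \<Rightarrow> (real \<Rightarrow> 'w measure) \<Rightarrow> bool" where
  "usual_filtration M F \<longleftrightarrow>
     (\<forall>t\<ge>0. subalgebra M (F t)) \<and>
     (\<forall>s t. 0 \<le> s \<and> s \<le> t \<longrightarrow> sets (F s) \<subseteq> sets (F t)) \<and>
     (\<forall>t\<ge>0. sets (F t) = (\<Inter>s\<in>{t<..}. sets (F s))) \<and>
     (\<forall>N\<in>null_sets M. \<forall>A\<subseteq>N. A \<in> sets (F 0))"

definition brownian_motion ::
  "'w measure \<Rightarrow> (real \<Rightarrow> 'w measure) \<Rightarrow> (real \<Rightarrow> 'w \<Rightarrow> real^'m) \<Rightarrow> bool" where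
  "brownian_motion M F W \<longleftrightarrow>
     (\<forall>t\<ge>0. W t \<in> borel_measurable (F t)) \<and>
     (AE \<omega> in M. W 0 \<omega> = 0) \<and>
     (AE \<omega> in M. continuous_on {0..} (\<lambda>t. W t \<omega>)) \<and>
     (\<forall>s t. 0 \<le> s \<and> s < t \<longrightarrow>
        prob_space.indep_set M (sets (F s))
          (sets (vimage_algebra (space M) (\<lambda>\<omega>. W t \<omega> - W s \<omega>) borel)) \<and>
        prob_space.indep_vars M (\<lambda>_. borel) (\<lambda>i \<omega>. (W t \<omega> - W s \<omega>) $ i) UNIV \<and>
        (\<forall>i. distributed M lborel (\<lambda>\<omega>. (W t \<omega> - W s \<omega>) $ i)
               (\<lambda>x. ennreal (normal_density 0 (sqrt (t - s)) x))))"

text \<open>Moments are taken as nonnegative integrals, so that the bounds below really assert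
  finiteness (a Bochner integral of a non-integrable function would be \<open>0\<close>).\<close>

definition initial_data ::
  "'w measure \<Rightarrow> (real \<Rightarrow> 'w measure) \<Rightarrow> real \<Rightarrow> real \<Rightarrow>
     ('w \<Rightarrow> real \<Rightarrow> 'b::real_normed_vector) set" where
  "initial_data M F \<tau> \<alpha> =
     {\<xi> \<in> F 0 \<rightarrow>\<^sub>M borel_segment \<tau>.
        (SUP \<theta>\<in>{-\<tau>..0}. \<integral>\<^sup>+\<omega>. ennreal (norm (\<xi> \<omega> \<theta>) powr \<alpha>) \<partial>M) < \<infinity>}"

definition initial_ball ::
  "'w measure \<Rightarrow> (real \<Rightarrow> 'w measure) \<Rightarrow> real \<Rightarrow> real \<Rightarrow> real \<Rightarrow>
     ('w \<Rightarrow> real \<Rightarrow> 'b::real_normed_vector) set" where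
  "initial_ball M F \<tau> B \<alpha> =
     {\<xi> \<in> initial_data M F \<tau> \<alpha>. (\<integral>\<^sup>+\<omega>. ennreal (segment_norm \<tau> (\<xi> \<omega>)) \<partial>M) \<le> ennreal B}"


section \<open>Truncation\<close>

text \<open>The bound on the supremum is written pointwise, because \<^const>\<open>Sup\<close> on the reals carries no
  information for sets that are not bounded above.\<close>

definition truncation_function ::
  "((real^'d) \<times> (real^'d) \<Rightarrow> real^'d) \<Rightarrow> ((real^'d) \<times> (real^'d) \<Rightarrow> real^'m^'d) \<Rightarrow>
     (real \<Rightarrow> real) \<Rightarrow> bool" where
  "truncation_function f g \<Phi> \<longleftrightarrow>
     (\<forall>R\<ge>1. 0 \<le> \<Phi> R) \<and> continuous_on {1..} \<Phi> \<and> strict_mono_on {1..} \<Phi> \<and>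
     filterlim \<Phi> at_top at_top \<and>
     (\<forall>R\<ge>1. \<forall>x x' y y'.
        norm x \<le> R \<and> norm x' \<le> R \<and> norm y \<le> R \<and> norm y' \<le> R \<and>
        norm (x - x') + min 1 (norm (y - y')) \<noteq> 0 \<longrightarrow>
        norm (f (x, y) - f (x', y')) / (norm (x - x') + min 1 (norm (y - y'))) +
        (norm (g (x, y) - g (x', y')))\<^sup>2 / (norm (x - x') + min 1 (norm (y - y')))\<^sup>2
        \<le> \<Phi> R)"

definition trunc_const ::
  "((real^'d) \<times> (real^'d) \<Rightarrow> real^'d) \<Rightarrow> ((real^'d) \<times> (real^'d) \<Rightarrow> real^'m^'d) \<Rightarrow>
     (real \<Rightarrow> real) \<Rightarrow> real" where
  "trunc_const f g \<Phi> = max 1 (max (\<Phi> 1) (max (norm (f (0, 0))) ((norm (g (0, 0)))\<^sup>2)))"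

text \<open>For \<open>0 < \<Delta> < 1\<close> and \<open>0 < \<nu>\<close> the argument is at least \<open>\<Phi> 1\<close>, hence in the range
  of a truncation function on \<open>{1..}\<close>.\<close>

definition trunc_radius ::
  "((real^'d) \<times> (real^'d) \<Rightarrow> real^'d) \<Rightarrow> ((real^'d) \<times> (real^'d) \<Rightarrow> real^'m^'d) \<Rightarrow>
     (real \<Rightarrow> real) \<Rightarrow> real \<Rightarrow> real \<Rightarrow> real" where
  "trunc_radius f g \<Phi> \<nu> \<Delta> = the_inv_into {1..} \<Phi> (trunc_const f g \<Phi> * \<Delta> powr (-\<nu>))"

text \<open>\<^term>\<open>sgn x\<close> is \<open>x / |x|\<close>, and \<open>0\<close> for \<open>x = 0\<close>.\<close>

definition trunc :: "real \<Rightarrow> 'b::real_normed_vector \<Rightarrow> 'b" where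
  "trunc r x = min (norm x) r *\<^sub>R sgn x"


section \<open>The truncated Euler-Maruyama scheme\<close>

text \<open>The scheme is defined pathwise, for a noise path \<open>w\<close> and an initial segment \<open>x\<close>, with
  truncation radius \<open>r\<close>. The index \<open>k\<close> stands for the grid point \<open>k \<Delta>\<close>;
  \<open>em_pre\<close> is the iterate before truncation.\<close>

function em_pre ::
  "((real^'d) \<times> (real^'d) \<Rightarrow> real^'d) \<Rightarrow> ((real^'d) \<times> (real^'d) \<Rightarrow> real^'m^'d) \<Rightarrow>
     real \<Rightarrow> nat \<Rightarrow> real \<Rightarrow> (real \<Rightarrow> real^'m) \<Rightarrow> (real \<Rightarrow> real^'d) \<Rightarrow> int \<Rightarrow> real^'d" where
  "em_pre f g r N \<Delta> w x k =
     (if k \<le> 0 then x (of_int k * \<Delta>)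
      else trunc r (em_pre f g r N \<Delta> w x (k - 1))
         + \<Delta> *\<^sub>R f (trunc r (em_pre f g r N \<Delta> w x (k - 1)),
                  trunc r (em_pre f g r N \<Delta> w x (k - 1 - int N)))
         + g (trunc r (em_pre f g r N \<Delta> w x (k - 1)),
              trunc r (em_pre f g r N \<Delta> w x (k - 1 - int N)))
           *v (w (of_int k * \<Delta>) - w (of_int (k - 1) * \<Delta>)))"
  by pat_completeness auto
termination
  by (relation "Wellfounded.measure (\<lambda>(f, g, r, N, \<Delta>, w, x, k). nat k)") auto

declare em_pre.simps [simp del]

definition em_node ::
  "((real^'d) \<times> (real^'d) \<Rightarrow> real^'d) \<Rightarrow> ((real^'d) \<times> (real^'d) \<Rightarrow> real^'m^'d) \<Rightarrow>
     real \<Rightarrow> nat \<Rightarrow> real \<Rightarrow> (real \<Rightarrow> real^'m) \<Rightarrow> (real \<Rightarrow> real^'d) \<Rightarrow> int \<Rightarrow> real^'d" where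
  "em_node f g r N \<Delta> w x k = trunc r (em_pre f g r N \<Delta> w x k)"

definition em_path ::
  "((real^'d) \<times> (real^'d) \<Rightarrow> real^'d) \<Rightarrow> ((real^'d) \<times> (real^'d) \<Rightarrow> real^'m^'d) \<Rightarrow>
     real \<Rightarrow> nat \<Rightarrow> real \<Rightarrow> (real \<Rightarrow> real^'m) \<Rightarrow> (real \<Rightarrow> real^'d) \<Rightarrow> real \<Rightarrow> real^'d" where
  "em_path f g r N \<Delta> w x t =
     (if t \<le> 0 then trunc r (x t)
      else let k = \<lfloor>t / \<Delta>\<rfloor> in
        ((of_int (k + 1) * \<Delta> - t) / \<Delta>) *\<^sub>R em_node f g r N \<Delta> w x k
        + ((t - of_int k * \<Delta>) / \<Delta>) *\<^sub>R em_node f g r N \<Delta> w x (k + 1))"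

text \<open>From here on the step size is \<open>\<Delta> = \<tau> / N\<close>, and \<open>N\<close> is used to refer to it.\<close>

definition em_segment ::
  "((real^'d) \<times> (real^'d) \<Rightarrow> real^'d) \<Rightarrow> ((real^'d) \<times> (real^'d) \<Rightarrow> real^'m^'d) \<Rightarrow>
     (real \<Rightarrow> real) \<Rightarrow> real \<Rightarrow> real \<Rightarrow> nat \<Rightarrow> (real \<Rightarrow> real^'m) \<Rightarrow> (real \<Rightarrow> real^'d) \<Rightarrow> nat \<Rightarrow>
     real \<Rightarrow> real^'d" where
  "em_segment f g \<Phi> \<nu> \<tau> N w x k =
     (let \<Delta> = \<tau> / real N; r = trunc_radius f g \<Phi> \<nu> \<Delta>
      in (\<lambda>\<theta>\<in>{-\<tau>..0}. em_path f g r N \<Delta> w x (real k * \<Delta> + \<theta>)))"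

definition em_law ::
  "'w measure \<Rightarrow> (real \<Rightarrow> 'w \<Rightarrow> real^'m) \<Rightarrow>
     ((real^'d) \<times> (real^'d) \<Rightarrow> real^'d) \<Rightarrow> ((real^'d) \<times> (real^'d) \<Rightarrow> real^'m^'d) \<Rightarrow>
     (real \<Rightarrow> real) \<Rightarrow> real \<Rightarrow> real \<Rightarrow> nat \<Rightarrow> ('w \<Rightarrow> real \<Rightarrow> real^'d) \<Rightarrow> nat \<Rightarrow>
     (real \<Rightarrow> real^'d) measure" where
  "em_law M W f g \<Phi> \<nu> \<tau> N \<xi> k =
     distr M (borel_segment \<tau>) (\<lambda>\<omega>. em_segment f g \<Phi> \<nu> \<tau> N (\<lambda>t. W t \<omega>) (\<xi> \<omega>) k)"

definition em_invariant ::
  "'w measure \<Rightarrow> (real \<Rightarrow> 'w \<Rightarrow> real^'m) \<Rightarrow>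
     ((real^'d) \<times> (real^'d) \<Rightarrow> real^'d) \<Rightarrow> ((real^'d) \<times> (real^'d) \<Rightarrow> real^'m^'d) \<Rightarrow>
     (real \<Rightarrow> real) \<Rightarrow> real \<Rightarrow> real \<Rightarrow> nat \<Rightarrow> (real \<Rightarrow> real^'d) measure \<Rightarrow> bool" where
  "em_invariant M W f g \<Phi> \<nu> \<tau> N P \<longleftrightarrow>
     P \<in> segment_prob \<tau> \<and>
     (\<forall>k. \<forall>A\<in>sets (borel_segment \<tau>).
        (\<integral>\<^sup>+X. emeasure (em_law M W f g \<Phi> \<nu> \<tau> N (\<lambda>_. X) k) A \<partial>P) = emeasure P A)"

definition em_asymp_stable ::
  "'w measure \<Rightarrow> (real \<Rightarrow> 'w measure) \<Rightarrow> (real \<Rightarrow> 'w \<Rightarrow> real^'m) \<Rightarrow>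
     ((real^'d) \<times> (real^'d) \<Rightarrow> real^'d) \<Rightarrow> ((real^'d) \<times> (real^'d) \<Rightarrow> real^'m^'d) \<Rightarrow>
     (real \<Rightarrow> real) \<Rightarrow> real \<Rightarrow> real \<Rightarrow> real \<Rightarrow> nat \<Rightarrow> bool" where
  "em_asymp_stable M F W f g \<Phi> \<nu> \<tau> \<alpha> N \<longleftrightarrow>
     (\<exists>P\<in>segment_prob \<tau>. \<forall>\<xi>\<in>initial_data M F \<tau> \<alpha>.
        (\<lambda>k. FM_dist \<tau> (em_law M W f g \<Phi> \<nu> \<tau> N \<xi> k) P) \<longlonglongrightarrow> 0)"

end

theory Submission
  imports Defs
begin

text \<open>The truncated scheme is a random map \<open>S\<close> on segments, iterated with independent Gaussian
  increments. For two copies driven by the same noise, with difference \<open>D\<close>, the functional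
  \<open>|D(0)|\<^sup>2 + \<Delta> \<Sum> h(X(-i \<Delta>), X'(-i \<Delta>))\<close>, where \<open>h = (b\<^sub>2 + 2 q) |D|\<^sup>2 + b\<^sub>4 V\<close>, \<open>q\<close> is of
  order \<open>K\<^sup>2 \<Delta>^(1 - 2\<nu>)\<close> and the sum runs over the delay window, is a supermartingale whose
  dissipation \<open>\<Delta> \<kappa> (|D(0)|\<^sup>2 + V)\<close> controls the functional itself one delay later. It therefore
  decays at least like the reciprocal of the elapsed time, uniformly in \<open>\<Delta>\<close> and for starting
  segments in a fixed ball; the maximal inequality turns this into closeness in probability of whole
  segments, and no Burkholder-Davis-Gundy estimate is needed.

  For fixed \<open>\<Delta>\<close> the truncated states are bounded, so the coalescence is uniform over all states:
  composing the random maps backwards in time gives a Cauchy sequence in probability, whose limit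
  has the invariant law. Stationarity and the Khasminskii condition bound the \<open>\<alpha>\<close>-th moment of the
  invariant laws, and the maximal inequality over one delay makes them tight uniformly in \<open>\<Delta>\<close>;
  together with coalescence on balls this gives the uniform convergence.\<close>

section \<open>Iterated random maps\<close>

text \<open>Truncation does no harm to the one-step estimates: it is the metric projection onto a
  ball and increases neither norms nor distances. What the discretisation costs is the squared drift
  \<Delta>^2 |F|^2, with F the increment of f, which the continuous-time hypotheses do not contain.
  On the ball of radius r the function \<Phi> bounds |F| by P = K \<Delta>^(-\<nu>) times the
  distance, so the cost is at most \<Delta> q (2 |D(0)|^2 + 2 |D(-\<tau>)|^2) whenever P^2 \<Delta>
  \<le> q: a loss of 2q on each side of b1 > b2, which explains the 4 K^2 in the choice of the
  second step bound.

  The obstacle to uniformity is that r tends to infinity as \<Delta> tends to 0, and the Lipschitz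
  constants and the size of V on the r-ball may grow with it. Such r-dependent quantities enter only
  where \<Delta> is fixed: existence and uniqueness of the invariant law, and finiteness of its
  energy. The uniform rates use a radius R chosen independently of \<Delta>, and the mass outside
  the R-ball is estimated separately for the initial law and for the invariant law.\<close>

locale random_map = prob_space \<gamma> for \<gamma> :: "'z measure" +
  fixes \<S> :: "'s measure" and S :: "'s \<Rightarrow> 'z \<Rightarrow> 's"
  assumes measurable_map [measurable]: "case_prod S \<in> \<S> \<Otimes>\<^sub>M \<gamma> \<rightarrow>\<^sub>M \<S>"
begin

sublocale stream: prob_space "stream_space \<gamma>"
  by (rule prob_space_stream_space)

section \<open>Forward iteration and its Markov operators\<close>

primrec iter :: "nat \<Rightarrow> 's \<Rightarrow> 'z stream \<Rightarrow> 's" where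
  "iter 0 x \<omega> = x"
| "iter (Suc n) x \<omega> = iter n (S x (shd \<omega>)) (stl \<omega>)"

lemma measurable_map2 [measurable (raw)]:
  assumes "f \<in> L \<rightarrow>\<^sub>M \<S>" "g \<in> L \<rightarrow>\<^sub>M \<gamma>"
  shows "(\<lambda>x. S (f x) (g x)) \<in> L \<rightarrow>\<^sub>M \<S>"
  using measurable_compose[OF measurable_Pair[OF assms] measurable_map] by simp

lemma measurable_iter [measurable (raw)]:
  assumes "f \<in> L \<rightarrow>\<^sub>M \<S>" "g \<in> L \<rightarrow>\<^sub>M stream_space \<gamma>"
  shows "(\<lambda>x. iter n (f x) (g x)) \<in> L \<rightarrow>\<^sub>M \<S>"
  using assms
proof (induction n arbitrary: f g)
  case (Suc n)
  note Suc.prems [measurable]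
  show ?case
    by (simp, rule Suc.IH) measurable
qed auto

lemma iter_add: "iter (m + n) x \<omega> = iter n (iter m x \<omega>) (sdrop m \<omega>)"
  by (induction m arbitrary: x \<omega>) auto

lemma iter_Suc_last: "iter (Suc n) x \<omega> = S (iter n x \<omega>) (\<omega> !! n)"
  using iter_add[of n 1 x \<omega>] by (simp add: sdrop_simps)

lemma iter_invariant:
  assumes "x \<in> A" "\<And>x z. x \<in> A \<Longrightarrow> z \<in> space \<gamma> \<Longrightarrow> S x z \<in> A" "\<omega> \<in> space (stream_space \<gamma>)"
  shows "iter n x \<omega> \<in> A"
  using assms(1,3)
proof (induction n arbitrary: x \<omega>)
  case (Suc n)
  then show ?case
    using assms(2) by (cases \<omega>) (auto simp: stream_space_Stream)
qed auto

lemma map_in_space: "x \<in> space \<S> \<Longrightarrow> z \<in> space \<gamma> \<Longrightarrow> S x z \<in> space \<S>"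
  using measurable_space[OF measurable_map, of "(x, z)"] by (simp add: space_pair_measure)

lemma iter_in_space:
  "x \<in> space \<S> \<Longrightarrow> \<omega> \<in> space (stream_space \<gamma>) \<Longrightarrow> iter n x \<omega> \<in> space \<S>"
  by (rule iter_invariant) (auto intro: map_in_space)

text \<open>The n-step Markov operator. With values in \<open>ennreal\<close>, drift inequalities
  can be iterated without integrability assumptions.\<close>

definition expect :: "nat \<Rightarrow> ('s \<Rightarrow> ennreal) \<Rightarrow> 's \<Rightarrow> ennreal" where
  "expect n \<phi> x = (\<integral>\<^sup>+\<omega>. \<phi> (iter n x \<omega>) \<partial>stream_space \<gamma>)"

lemma measurable_expect [measurable (raw)]:
  assumes [measurable]: "\<phi> \<in> borel_measurable \<S>"
  shows "expect n \<phi> \<in> borel_measurable \<S>"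
  unfolding expect_def by measurable

lemma expect_0 [simp]: "expect 0 \<phi> x = \<phi> x"
  by (simp add: expect_def stream.emeasure_space_1)

lemma expect_Suc:
  assumes [measurable]: "\<phi> \<in> borel_measurable \<S>" and x: "x \<in> space \<S>"
  shows "expect (Suc n) \<phi> x = (\<integral>\<^sup>+z. expect n \<phi> (S x z) \<partial>\<gamma>)"
proof -
  have [measurable]: "(\<lambda>_. x) \<in> L \<rightarrow>\<^sub>M \<S>" for L :: "'a measure"
    using x by simp
  have [measurable]: "(\<lambda>_. x) \<in> stream_space \<gamma> \<rightarrow>\<^sub>M \<S>"
    using x by simp
  show ?thesis
    unfolding expect_def by (subst nn_integral_stream_space) simp_all
qed

lemma expect_add:
  assumes [measurable]: "\<phi> \<in> borel_measurable \<S>" and "x \<in> space \<S>"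
  shows "expect (m + n) \<phi> x = expect m (expect n \<phi>) x"
  using assms(2)
proof (induction m arbitrary: x)
  case (Suc m)
  then show ?case
    by (simp add: expect_Suc map_in_space cong: nn_integral_cong)
qed simp

lemma expect_1:
  "\<phi> \<in> borel_measurable \<S> \<Longrightarrow> x \<in> space \<S> \<Longrightarrow> expect (Suc 0) \<phi> x = (\<integral>\<^sup>+z. \<phi> (S x z) \<partial>\<gamma>)"
  by (simp add: expect_Suc)

lemma expect_mono:
  assumes "\<And>\<omega>. \<omega> \<in> space (stream_space \<gamma>) \<Longrightarrow> \<phi> (iter n x \<omega>) \<le> \<psi> (iter n x \<omega>)"
  shows "expect n \<phi> x \<le> expect n \<psi> x"
  unfolding expect_def by (rule nn_integral_mono) (rule assms)

lemma nn_integral_map_add_const: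
  fixes G :: "'s \<Rightarrow> ennreal"
  assumes [measurable]: "G \<in> borel_measurable \<S>" and [simp]: "x \<in> space \<S>"
  shows "(\<integral>\<^sup>+z. G (S x z) + k \<partial>\<gamma>) = (\<integral>\<^sup>+z. G (S x z) \<partial>\<gamma>) + k"
  by (simp add: nn_integral_add emeasure_space_1)

text \<open>Doob's maximal inequality for a nonnegative process whose conditional mean rises by at
  most \<delta> per step, in the form c P(max \<ge> c) so that nothing is divided. No stopping time
  is needed: if G x reaches c the bound is trivial, otherwise the event is decided after the first
  step and the induction hypothesis applies there.\<close>

lemma maximal_inequality:
  fixes G :: "'s \<Rightarrow> ennreal"
  assumes G [measurable]: "G \<in> borel_measurable \<S>"
    and A: "A \<subseteq> space \<S>" "\<And>x z. x \<in> A \<Longrightarrow> z \<in> space \<gamma> \<Longrightarrow> S x z \<in> A"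
    and drift: "\<And>x. x \<in> A \<Longrightarrow> (\<integral>\<^sup>+z. G (S x z) \<partial>\<gamma>) \<le> G x + \<delta>"
    and "x \<in> A"
  shows "(\<integral>\<^sup>+\<omega>. (if \<exists>j\<le>n. c \<le> G (iter j x \<omega>) then c else 0) \<partial>stream_space \<gamma>) \<le> G x + of_nat n * \<delta>"
  using \<open>x \<in> A\<close>
proof (induction n arbitrary: x)
  case (0 x)
  then show ?case
    by (cases "c \<le> G x") (auto simp: stream.emeasure_space_1)
next
  case (Suc n x)
  have x: "x \<in> space \<S>" using Suc A by auto
  note x [simp]
  let ?P = "\<lambda>n x. \<integral>\<^sup>+\<omega>. (if \<exists>j\<le>n. c \<le> G (iter j x \<omega>) then c else 0) \<partial>stream_space \<gamma>"
  show ?case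
  proof (cases "c \<le> G x")
    case True
    have "?P (Suc n) x \<le> (\<integral>\<^sup>+\<omega>. c \<partial>stream_space \<gamma>)"
      by (intro nn_integral_mono) simp
    also have "\<dots> \<le> G x + of_nat (Suc n) * \<delta>"
      using True by (simp add: add_increasing2 stream.emeasure_space_1)
    finally show ?thesis .
  next
    case False
    \<comment> \<open>Since G x < c, index 0 cannot be the one that reaches c; the remaining indices
      shift by one.\<close>
    have ex: "(\<exists>j\<le>Suc n. c \<le> G (iter j x (z ## \<omega>))) \<longleftrightarrow> (\<exists>j\<le>n. c \<le> G (iter j (S x z) \<omega>))" for z \<omega>
    proof
      assume "\<exists>j\<le>Suc n. c \<le> G (iter j x (z ## \<omega>))"
      then obtain j where "j \<le> Suc n" "c \<le> G (iter j x (z ## \<omega>))" by blast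
      with False show "\<exists>j\<le>n. c \<le> G (iter j (S x z) \<omega>)"
        by (cases j) auto
    next
      assume "\<exists>j\<le>n. c \<le> G (iter j (S x z) \<omega>)"
      then obtain j where "j \<le> n" "c \<le> G (iter j (S x z) \<omega>)" by blast
      then show "\<exists>j\<le>Suc n. c \<le> G (iter j x (z ## \<omega>))"
        by (intro exI[of _ "Suc j"]) auto
    qed
    have "?P (Suc n) x = (\<integral>\<^sup>+z. ?P n (S x z) \<partial>\<gamma>)"
      by (subst nn_integral_stream_space) (simp_all only: ex, measurable)
    moreover have "(\<integral>\<^sup>+z. ?P n (S x z) \<partial>\<gamma>) \<le> (\<integral>\<^sup>+z. G (S x z) + of_nat n * \<delta> \<partial>\<gamma>)"
      by (intro nn_integral_mono Suc.IH A(2) Suc.prems)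
    moreover have "(\<integral>\<^sup>+z. G (S x z) + of_nat n * \<delta> \<partial>\<gamma>) = (\<integral>\<^sup>+z. G (S x z) \<partial>\<gamma>) + of_nat n * \<delta>"
      by (rule nn_integral_map_add_const[OF G x])
    moreover have "(\<integral>\<^sup>+z. G (S x z) \<partial>\<gamma>) + of_nat n * \<delta> \<le> G x + \<delta> + of_nat n * \<delta>"
      by (intro add_right_mono drift Suc.prems)
    moreover have "G x + \<delta> + of_nat n * \<delta> = G x + of_nat (Suc n) * \<delta>"
      by (simp add: distrib_right add.assoc)
    ultimately show ?thesis
      by (simp only:)
  qed
qed

text \<open>The drift inequality telescopes: all dissipation expected before time n is paid for by
  the initial value of G. This sum is what the decay estimate later averages over time.\<close>

lemma expect_dissipation:
  fixes G s :: "'s \<Rightarrow> ennreal"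
  assumes [measurable]: "G \<in> borel_measurable \<S>" "s \<in> borel_measurable \<S>"
    and A: "A \<subseteq> space \<S>" "\<And>x z. x \<in> A \<Longrightarrow> z \<in> space \<gamma> \<Longrightarrow> S x z \<in> A"
    and drift: "\<And>x. x \<in> A \<Longrightarrow> (\<integral>\<^sup>+z. G (S x z) \<partial>\<gamma>) + s x \<le> G x"
    and "x \<in> A"
  shows "(\<Sum>m<n. expect m s x) + expect n G x \<le> G x"
proof (induction n)
  case (Suc n)
  have x: "x \<in> space \<S>" using \<open>x \<in> A\<close> A by auto
  define G' where "G' x = (\<integral>\<^sup>+z. G (S x z) \<partial>\<gamma>)" for x
  have [measurable]: "G' \<in> borel_measurable \<S>"
    unfolding G'_def by measurable
  have "expect (Suc n) G x = expect n G' x"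
    using expect_add[of G x n "Suc 0"] x
    by (simp add: expect_1 iter_in_space expect_def[of n] G'_def cong: nn_integral_cong)
  then have "expect n s x + expect (Suc n) G x = expect n (\<lambda>x. G' x + s x) x"
    unfolding expect_def[of n] by (subst nn_integral_add) (simp_all add: x add.commute)
  moreover have "expect n (\<lambda>x. G' x + s x) x \<le> expect n G x"
    unfolding G'_def using \<open>x \<in> A\<close> A by (intro expect_mono drift iter_invariant) auto
  ultimately have "(\<Sum>m<n. expect m s x) + (expect n s x + expect (Suc n) G x)
      \<le> (\<Sum>m<n. expect m s x) + expect n G x"
    by (intro add_left_mono) simp
  with Suc.IH show ?case
    by (simp only: sum.lessThan_Suc add.assoc)
qed simp

text \<open>Backward composition: the head of the stream drives the last step. \<open>pull n\<close>
  and \<open>pull (n + m)\<close> then end with the same n maps, so on one and the same stream they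
  can converge as random variables, whereas forward iterates in general converge only in
  law.\<close>

primrec pull :: "nat \<Rightarrow> 's \<Rightarrow> 'z stream \<Rightarrow> 's" where
  "pull 0 x \<omega> = x"
| "pull (Suc n) x \<omega> = S (pull n x (stl \<omega>)) (shd \<omega>)"

lemma measurable_pull [measurable (raw)]:
  assumes "f \<in> L \<rightarrow>\<^sub>M \<S>" "g \<in> L \<rightarrow>\<^sub>M stream_space \<gamma>"
  shows "(\<lambda>x. pull n (f x) (g x)) \<in> L \<rightarrow>\<^sub>M \<S>"
  using assms
proof (induction n arbitrary: f g)
  case (Suc n)
  note Suc.prems [measurable]
  have [measurable]: "(\<lambda>x. pull n (f x) (stl (g x))) \<in> L \<rightarrow>\<^sub>M \<S>"
    by (rule Suc.IH) measurable
  show ?case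
    by simp
qed auto

lemma pull_add: "pull (m + n) x \<omega> = pull m (pull n x (sdrop m \<omega>)) \<omega>"
  by (induction m arbitrary: \<omega>) auto

text \<open>The start depends only on the noise after position m, which is independent of the m maps
  applied to it. The result therefore has the law of m forward steps from a random start, and
  statements on \<open>pull\<close> become bounds on \<open>expect\<close>.\<close>

lemma nn_integral_pull:
  assumes "\<phi> \<in> borel_measurable \<S>" and a [measurable]: "a \<in> stream_space \<gamma> \<rightarrow>\<^sub>M \<S>"
  shows "(\<integral>\<^sup>+\<omega>. \<phi> (pull m (a (sdrop m \<omega>)) \<omega>) \<partial>stream_space \<gamma>)
       = (\<integral>\<^sup>+\<omega>. expect m \<phi> (a \<omega>) \<partial>stream_space \<gamma>)"
  using assms(1)
proof (induction m arbitrary: \<phi>)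
  case 0
  then show ?case by simp
next
  case (Suc m)
  note [measurable] = Suc.prems
  interpret pair_sigma_finite \<gamma> "stream_space \<gamma>" ..
  have "(\<integral>\<^sup>+\<omega>. \<phi> (pull (Suc m) (a (sdrop (Suc m) \<omega>)) \<omega>) \<partial>stream_space \<gamma>)
     = (\<integral>\<^sup>+z. \<integral>\<^sup>+\<omega>. \<phi> (S (pull m (a (sdrop m \<omega>)) \<omega>) z) \<partial>stream_space \<gamma> \<partial>\<gamma>)"
    by (subst nn_integral_stream_space) simp_all
  also have "\<dots> = (\<integral>\<^sup>+\<omega>. \<integral>\<^sup>+z. \<phi> (S (pull m (a (sdrop m \<omega>)) \<omega>) z) \<partial>\<gamma> \<partial>stream_space \<gamma>)"
    by (rule Fubini'[symmetric]) simp
  also have "\<dots> = (\<integral>\<^sup>+\<omega>. expect (Suc 0) \<phi> (pull m (a (sdrop m \<omega>)) \<omega>) \<partial>stream_space \<gamma>)"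
  proof (intro nn_integral_cong)
    fix \<omega> assume \<omega>: "\<omega> \<in> space (stream_space \<gamma>)"
    have "(\<lambda>\<omega>. pull m (a (sdrop m \<omega>)) \<omega>) \<in> stream_space \<gamma> \<rightarrow>\<^sub>M \<S>"
      by measurable
    from measurable_space[OF this \<omega>]
    show "(\<integral>\<^sup>+z. \<phi> (S (pull m (a (sdrop m \<omega>)) \<omega>) z) \<partial>\<gamma>)
        = expect (Suc 0) \<phi> (pull m (a (sdrop m \<omega>)) \<omega>)"
      by (simp add: expect_1)
  qed
  also have "\<dots> = (\<integral>\<^sup>+\<omega>. expect m (expect (Suc 0) \<phi>) (a \<omega>) \<partial>stream_space \<gamma>)"
    by (rule Suc.IH) measurable
  also have "\<dots> = (\<integral>\<^sup>+\<omega>. expect (Suc m) \<phi> (a \<omega>) \<partial>stream_space \<gamma>)"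
    using measurable_space[OF a]
    by (intro nn_integral_cong) (simp add: expect_add[of \<phi> _ m "Suc 0", symmetric])
  finally show ?case .
qed

end

section \<open>The segment space\<close>

lemma sets_Collect_countable_Ball':
  assumes "countable I" "\<And>i. i \<in> I \<Longrightarrow> {x \<in> space L. P i x} \<in> sets L"
  shows "{x \<in> space L. \<forall>i\<in>I. P i x} \<in> sets L"
proof (cases "I = {}")
  case False
  then have "{x \<in> space L. \<forall>i\<in>I. P i x} = (\<Inter>i\<in>I. {x \<in> space L. P i x})"
    by auto
  then show ?thesis
    using assms False by (auto intro!: sets.countable_INT')
qed simp

locale segment_interval =
  fixes \<tau> :: real
  assumes tau_pos: "0 < \<tau>"
begin

section \<open>The supremum metric on segments and its separability\<close>

lemma mspace_segment_iff:
  "X \<in> mspace (segment_space \<tau>) \<longleftrightarrow> X \<in> extensional {-\<tau>..0} \<and> continuous_on {-\<tau>..0} X"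
  unfolding segment_space_def
  by (subst compactin_mspace_cfunspace) (auto simp: compactin_subtopology)

lemma restrict_mem_mspace_iff:
  "restrict f {-\<tau>..0} \<in> mspace (segment_space \<tau>) \<longleftrightarrow> continuous_on {-\<tau>..0} f"
  using continuous_on_cong[of "{-\<tau>..0}" "{-\<tau>..0}" "restrict f {-\<tau>..0}" f]
  by (simp add: mspace_segment_iff)

lemma mdist_segment_le_iff:
  assumes "X \<in> mspace (segment_space \<tau>)" "Y \<in> mspace (segment_space \<tau>)"
  shows "mdist (segment_space \<tau>) X Y \<le> a \<longleftrightarrow> (\<forall>\<theta>\<in>{-\<tau>..0}. norm (X \<theta> - Y \<theta>) \<le> a)"
  using cfunspace_mdist_le[of X "top_of_set {-\<tau>..0}" euclidean_metric Y a] assms tau_pos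
  by (simp add: segment_space_def dist_norm del: mspace_cfunspace)

lemma norm_diff_le_mdist:
  assumes "X \<in> mspace (segment_space \<tau>)" "Y \<in> mspace (segment_space \<tau>)" "\<theta> \<in> {-\<tau>..0}"
  shows "norm (X \<theta> - Y \<theta>) \<le> mdist (segment_space \<tau>) X Y"
  using mdist_segment_le_iff[OF assms(1,2)] assms(3) by blast

text \<open>By continuity, the supremum distance is seen on countably many times, the same for all
  segments. Closed balls become countable intersections of conditions on single values, which
  reduces measurability to evaluations.\<close>

lemma countable_dense_times:
  obtains T where "countable T" "T \<subseteq> {-\<tau>..0}"
    "\<And>X Y :: real \<Rightarrow> 'b::real_normed_vector. \<And>a. X \<in> mspace (segment_space \<tau>) \<Longrightarrow> Y \<in> mspace (segment_space \<tau>) \<Longrightarrow>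
       mdist (segment_space \<tau>) X Y \<le> a \<longleftrightarrow> (\<forall>\<theta>\<in>T. norm (X \<theta> - Y \<theta>) \<le> a)"
proof -
  obtain T where T: "countable T" "T \<subseteq> {-\<tau>..0}" "{-\<tau>..0} \<subseteq> closure T"
    using separable by blast
  have cl: "closure T = {-\<tau>..0}"
    using T by (metis closed_atLeastAtMost closure_minimal subset_antisym)
  show thesis
  proof (rule that[OF T(1,2)])
    fix X Y :: "real \<Rightarrow> 'b" and a
    assume XY: "X \<in> mspace (segment_space \<tau>)" "Y \<in> mspace (segment_space \<tau>)"
    have "continuous_on (closure T) (\<lambda>\<theta>. norm (X \<theta> - Y \<theta>))"
      using XY unfolding cl mspace_segment_iff by (intro continuous_intros) auto
    then have "norm (X \<theta> - Y \<theta>) \<le> a" if "\<forall>\<theta>\<in>T. norm (X \<theta> - Y \<theta>) \<le> a" "\<theta> \<in> {-\<tau>..0}" for \<theta>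
      using continuous_le_on_closure[of T "\<lambda>\<theta>. norm (X \<theta> - Y \<theta>)" \<theta> a] that cl by auto
    then show "mdist (segment_space \<tau>) X Y \<le> a \<longleftrightarrow> (\<forall>\<theta>\<in>T. norm (X \<theta> - Y \<theta>) \<le> a)"
      using T(2) unfolding mdist_segment_le_iff[OF XY] by blast
  qed
qed

text \<open>Bernstein polynomials with coefficients in a countable dense set \<open>Q\<close> are
  dense. One error e/4 comes from approximating the segment by its Bernstein polynomial, another e/4
  from moving the coefficients into \<open>Q\<close>.\<close>

lemma segment_space_separable:
  obtains D :: "(real \<Rightarrow> 'b::euclidean_space) set"
  where "countable D" "D \<subseteq> mspace (segment_space \<tau>)"
    "\<And>X e. X \<in> mspace (segment_space \<tau>) \<Longrightarrow> 0 < e \<Longrightarrow> \<exists>Y\<in>D. mdist (segment_space \<tau>) X Y < e"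
proof -
  obtain Q :: "'b set" where Q: "countable Q" "UNIV \<subseteq> closure Q"
    using separable[of UNIV] by metis
  define P where "P n q = (\<lambda>\<theta>\<in>{-\<tau>..0}. \<Sum>k\<le>n. Bernstein n k ((\<theta> + \<tau>) / \<tau>) *\<^sub>R (q ! k :: 'b))" for n q
  have P: "P n q \<in> mspace (segment_space \<tau>)" for n q
  proof -
    have "continuous_on {-\<tau>..0} (\<lambda>\<theta>. \<Sum>k\<le>n. Bernstein n k ((\<theta> + \<tau>) / \<tau>) *\<^sub>R (q ! k :: 'b))"
      unfolding Bernstein_def using tau_pos by (intro continuous_intros) auto
    then show ?thesis
      unfolding restrict_mem_mspace_iff P_def .
  qed
  show thesis
  proof (rule that)
    show "countable ((\<lambda>(n, q). P n q) ` (UNIV \<times> lists Q))"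
      using Q by auto
    show "(\<lambda>(n, q). P n q) ` (UNIV \<times> lists Q) \<subseteq> mspace (segment_space \<tau>)"
      using P by auto
    fix X :: "real \<Rightarrow> 'b" and e :: real
    assume X: "X \<in> mspace (segment_space \<tau>)" and e: "0 < e"
    let ?t = "\<lambda>s. \<tau> * s - \<tau>"
    have t: "?t s \<in> {-\<tau>..0}" if "s \<in> {0..1}" for s
      using that tau_pos by (auto simp: mult_left_le)
    \<comment> \<open>The errors of the coordinates are added over the basis, so this choice gives e
      / 4 in total.\<close>
    define d where "d = e / (4 * real DIM('b))"
    have d: "0 < d" using e by (simp add: d_def)
    have "\<exists>N. \<forall>n s. N \<le> n \<and> s \<in> {0..1} \<longrightarrow>
        \<bar>X (?t s) \<bullet> i - (\<Sum>k\<le>n. (X (?t (real k / real n)) \<bullet> i) * Bernstein n k s)\<bar> < d" for i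
    proof -
      have "continuous_on {0..1} (\<lambda>s. X (?t s))"
      proof (rule continuous_on_compose2[of "{-\<tau>..0}" X])
        show "continuous_on {-\<tau>..0} X" using X by (simp add: mspace_segment_iff)
        show "continuous_on {0..1} ?t" by (intro continuous_intros)
        show "?t ` {0..1} \<subseteq> {-\<tau>..0}" using t by blast
      qed
      then show ?thesis
        using d by (intro Bernstein_Weierstrass[of "\<lambda>s. X (?t s) \<bullet> i"]) (auto intro!: continuous_intros)
    qed
    then have "\<exists>N. \<forall>i n s. N i \<le> n \<and> s \<in> {0..1} \<longrightarrow>
        \<bar>X (?t s) \<bullet> i - (\<Sum>k\<le>n. (X (?t (real k / real n)) \<bullet> i) * Bernstein n k s)\<bar> < d"
      by (intro choice allI)
    then obtain N where "\<forall>i n s. N i \<le> n \<and> s \<in> {0..1} \<longrightarrow>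
        \<bar>X (?t s) \<bullet> i - (\<Sum>k\<le>n. (X (?t (real k / real n)) \<bullet> i) * Bernstein n k s)\<bar> < d" ..
    then have N: "\<bar>X (?t s) \<bullet> i - (\<Sum>k\<le>n. (X (?t (real k / real n)) \<bullet> i) * Bernstein n k s)\<bar> < d"
      if "N i \<le> n" "s \<in> {0..1}" for i n s
      using that by blast
    define n where "n = Max (N ` Basis)"
    have n: "N i \<le> n" if "i \<in> Basis" for i
      using that by (auto simp: n_def)
    have "\<exists>q\<in>Q. dist q x < e / 4" for x :: 'b
      using Q(2) e closure_approachable[of x Q] by (auto simp del: less_divide_eq_numeral1)
    then have "\<exists>q. \<forall>x::'b. q x \<in> Q \<and> dist (q x) x < e / 4"
      by (intro choice) blast
    then obtain q where q: "\<And>x::'b. q x \<in> Q" "\<And>x. dist (q x) x < e / 4"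
      by blast
    define qs where "qs = map (\<lambda>k. q (X (?t (real k / real n)))) [0..<Suc n]"
    have qs: "qs ! k = q (X (?t (real k / real n)))" if "k \<le> n" for k
      using that unfolding qs_def by (subst nth_map) (auto simp del: upt_Suc)
    have "norm (X \<theta> - P n qs \<theta>) \<le> e / 2" if \<theta>: "\<theta> \<in> {-\<tau>..0}" for \<theta>
    proof -
      define s where "s = (\<theta> + \<tau>) / \<tau>"
      have s: "s \<in> {0..1}" "?t s = \<theta>"
        using \<theta> tau_pos by (auto simp: s_def field_simps)
      let ?S = "\<Sum>k\<le>n. Bernstein n k s *\<^sub>R X (?t (real k / real n))"
      have "norm (X \<theta> - ?S) \<le> (\<Sum>i\<in>Basis. \<bar>(X \<theta> - ?S) \<bullet> i\<bar>)"
        by (rule norm_le_l1)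
      also have "\<dots> \<le> (\<Sum>i\<in>(Basis::'b set). d)"
        using N[OF n s(1)] s(2)
        by (intro sum_mono) (auto simp: inner_diff_left inner_sum_left mult.commute intro!: less_imp_le)
      also have "\<dots> = e / 4"
        by (simp add: d_def)
      finally have 1: "norm (X \<theta> - ?S) \<le> e / 4" .
      have eq: "?S - P n qs \<theta> = (\<Sum>k\<le>n. Bernstein n k s *\<^sub>R (X (?t (real k / real n)) - qs ! k))"
        using \<theta> by (simp add: P_def s_def scaleR_diff_right sum_subtractf)
      \<comment> \<open>Bernstein weights are nonnegative and sum to 1: coefficient errors are
        averaged, not accumulated.\<close>
      have "norm (?S - P n qs \<theta>) \<le> (\<Sum>k\<le>n. Bernstein n k s * (e / 4))"
        unfolding eq
      proof (rule sum_norm_le)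
        fix k assume "k \<in> {..n}"
        then have le: "norm (X (?t (real k / real n)) - qs ! k) \<le> e / 4"
          using q(2)[of "X (?t (real k / real n))"] qs[of k] by (simp add: dist_norm norm_minus_commute[of "q _"] less_imp_le)
        have nn: "0 \<le> Bernstein n k s"
          using s by (intro Bernstein_nonneg) auto
        show "norm (Bernstein n k s *\<^sub>R (X (?t (real k / real n)) - qs ! k)) \<le> Bernstein n k s * (e / 4)"
          unfolding norm_scaleR abs_of_nonneg[OF nn] by (rule mult_left_mono[OF le nn])
      qed
      moreover have "(\<Sum>k\<le>n. Bernstein n k s * (e / 4)) = e / 4"
        by (simp only: sum_distrib_right[symmetric] sum_Bernstein mult_1)
      ultimately have 2: "norm (?S - P n qs \<theta>) \<le> e / 4"
        by (simp only:)
      show ?thesis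
        using norm_triangle_ineq[of "X \<theta> - ?S" "?S - P n qs \<theta>"] 1 2 by simp
    qed
    then have "mdist (segment_space \<tau>) X (P n qs) \<le> e / 2"
      by (subst mdist_segment_le_iff[OF X P]) blast
    moreover have "qs \<in> lists Q"
      using q(1) by (auto simp: qs_def)
    then have "P n qs \<in> (\<lambda>(n, q). P n q) ` (UNIV \<times> lists Q)"
      by (intro image_eqI[of _ _ "(n, qs)"]) auto
    ultimately show "\<exists>Y\<in>(\<lambda>(n, q). P n q) ` (UNIV \<times> lists Q). mdist (segment_space \<tau>) X Y < e"
      using e by (intro bexI[of _ "P n qs"]) linarith
  qed
qed

section \<open>Measurability of maps to and from the segment space\<close>

lemma space_borel_segment [simp]: "space (borel_segment \<tau>) = mspace (segment_space \<tau>)"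
  by (simp add: borel_segment_def space_measure_of_conv)

lemma openin_segment_iff:
  "openin (mtopology_of (segment_space \<tau>)) U \<longleftrightarrow> U \<subseteq> mspace (segment_space \<tau>) \<and>
     (\<forall>X\<in>U. \<exists>e>0. \<forall>Y\<in>mspace (segment_space \<tau>). mdist (segment_space \<tau>) X Y < e \<longrightarrow> Y \<in> U)"
proof -
  interpret M: Metric_space "mspace (segment_space \<tau>)" "mdist (segment_space \<tau>)"
    by simp
  show ?thesis
  proof
    assume "openin (mtopology_of (segment_space \<tau>)) U"
    then have U: "U \<subseteq> mspace (segment_space \<tau>)" "\<And>X. X \<in> U \<Longrightarrow> \<exists>r>0. M.mball X r \<subseteq> U"
      by (auto simp: mtopology_of_def M.openin_mtopology)
    have "\<exists>e>0. \<forall>Y\<in>mspace (segment_space \<tau>). mdist (segment_space \<tau>) X Y < e \<longrightarrow> Y \<in> U" if X: "X \<in> U" for X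
    proof -
      obtain r where "0 < r" "M.mball X r \<subseteq> U" using U(2)[OF X] by blast
      moreover have "X \<in> mspace (segment_space \<tau>)" using U(1) X by blast
      ultimately show ?thesis
        unfolding M.mball_def by blast
    qed
    with U(1) show "U \<subseteq> mspace (segment_space \<tau>) \<and>
      (\<forall>X\<in>U. \<exists>e>0. \<forall>Y\<in>mspace (segment_space \<tau>). mdist (segment_space \<tau>) X Y < e \<longrightarrow> Y \<in> U)"
      by blast
  next
    assume R: "U \<subseteq> mspace (segment_space \<tau>) \<and>
      (\<forall>X\<in>U. \<exists>e>0. \<forall>Y\<in>mspace (segment_space \<tau>). mdist (segment_space \<tau>) X Y < e \<longrightarrow> Y \<in> U)"
    have "\<exists>r>0. M.mball X r \<subseteq> U" if X: "X \<in> U" for X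
    proof -
      obtain e where e: "0 < e" "\<And>Y. Y \<in> mspace (segment_space \<tau>) \<Longrightarrow> mdist (segment_space \<tau>) X Y < e \<Longrightarrow> Y \<in> U"
        using R X by blast
      then have "M.mball X e \<subseteq> U"
        unfolding M.mball_def by blast
      with e(1) show ?thesis by blast
    qed
    with R show "openin (mtopology_of (segment_space \<tau>)) U"
      unfolding mtopology_of_def M.openin_mtopology by blast
  qed
qed

lemma openin_segment_subset:
  "openin (mtopology_of (segment_space \<tau>)) U \<Longrightarrow> U \<subseteq> mspace (segment_space \<tau>)"
  by (simp add: openin_segment_iff)

lemma openin_sets_borel_segment:
  "openin (mtopology_of (segment_space \<tau>)) U \<Longrightarrow> U \<in> sets (borel_segment \<tau>)"
  unfolding borel_segment_def by (subst sets_measure_of) (auto dest: openin_segment_subset)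

text \<open>The Borel sets are generated by the evaluations: by separability an open set is a
  countable union of closed balls with centres in \<open>D\<close> and rational radii, and
  membership in such a ball is tested at the countably many times in \<open>T\<close>.\<close>

lemma measurable_borel_segmentI:
  fixes h :: "'a \<Rightarrow> real \<Rightarrow> 'b::euclidean_space"
  assumes h: "\<And>\<omega>. \<omega> \<in> space L \<Longrightarrow> h \<omega> \<in> mspace (segment_space \<tau>)"
    and [measurable]: "\<And>\<theta>. \<theta> \<in> {-\<tau>..0} \<Longrightarrow> (\<lambda>\<omega>. h \<omega> \<theta>) \<in> borel_measurable L"
  shows "h \<in> L \<rightarrow>\<^sub>M borel_segment \<tau>"
  unfolding borel_segment_def
proof (rule measurable_measure_of)
  show "{U. openin (mtopology_of (segment_space \<tau>)) U} \<subseteq> Pow (mspace (segment_space \<tau>))"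
    by (auto dest: openin_segment_subset)
  show "h \<in> space L \<rightarrow> mspace (segment_space \<tau>)"
    using h by auto
next
  fix U :: "(real \<Rightarrow> 'b) set" assume "U \<in> {U. openin (mtopology_of (segment_space \<tau>)) U}"
  then have U: "openin (mtopology_of (segment_space \<tau>)) U" by simp
  obtain D :: "(real \<Rightarrow> 'b) set" where D: "countable D" "D \<subseteq> mspace (segment_space \<tau>)"
    "\<And>X e. X \<in> mspace (segment_space \<tau>) \<Longrightarrow> 0 < e \<Longrightarrow> \<exists>Y\<in>D. mdist (segment_space \<tau>) X Y < e"
    by (rule segment_space_separable) blast
  obtain T where T: "countable T" "T \<subseteq> {-\<tau>..0}"
    "\<And>X Y :: real \<Rightarrow> 'b. \<And>a. X \<in> mspace (segment_space \<tau>) \<Longrightarrow> Y \<in> mspace (segment_space \<tau>) \<Longrightarrow>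
       mdist (segment_space \<tau>) X Y \<le> a \<longleftrightarrow> (\<forall>\<theta>\<in>T. norm (X \<theta> - Y \<theta>) \<le> a)"
    by (rule countable_dense_times) blast
  define I where "I = {(d, q) | d q. d \<in> D \<and> q \<in> \<rat> \<and>
     (\<forall>Y\<in>mspace (segment_space \<tau>). mdist (segment_space \<tau>) Y d \<le> q \<longrightarrow> Y \<in> U)}"
  have I: "countable I"
    by (rule countable_subset[of _ "D \<times> \<rat>"]) (auto simp: I_def D countable_rat)
  have U_eq: "U = (\<Union>(d, q)\<in>I. {Y \<in> mspace (segment_space \<tau>). mdist (segment_space \<tau>) Y d \<le> q})"
  proof (intro equalityI subsetI)
    fix X assume "X \<in> U"
    then obtain e where X: "X \<in> mspace (segment_space \<tau>)" and e: "0 < e"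
      "\<And>Y. Y \<in> mspace (segment_space \<tau>) \<Longrightarrow> mdist (segment_space \<tau>) X Y < e \<Longrightarrow> Y \<in> U"
      using U unfolding openin_segment_iff by blast
    obtain d where d: "d \<in> D" "mdist (segment_space \<tau>) X d < e / 2"
      using D(3)[OF X, of "e / 2"] e by auto
    obtain q where q: "q \<in> \<rat>" "mdist (segment_space \<tau>) X d < q" "q < e / 2"
      using Rats_dense_in_real[OF d(2)] by auto
    have "(d, q) \<in> I"
      unfolding I_def
    proof (clarsimp simp: d q, rule e(2))
      fix Y assume Y: "Y \<in> mspace (segment_space \<tau>)" "mdist (segment_space \<tau>) Y d \<le> q"
      have "d \<in> mspace (segment_space \<tau>)" using d D by auto
      then have "mdist (segment_space \<tau>) X Y \<le> mdist (segment_space \<tau>) X d + mdist (segment_space \<tau>) d Y"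
        using X Y by (simp add: mdist_triangle)
      then show "mdist (segment_space \<tau>) X Y < e"
        using q d Y by (simp add: mdist_commute)
    qed
    then show "X \<in> (\<Union>(d, q)\<in>I. {Y \<in> mspace (segment_space \<tau>). mdist (segment_space \<tau>) Y d \<le> q})"
      using X q by (intro UN_I[of "(d, q)"]) auto
  qed (auto simp: I_def)
  have "h -` U \<inter> space L = (\<Union>(d, q)\<in>I. {\<omega> \<in> space L. mdist (segment_space \<tau>) (h \<omega>) d \<le> q})"
    unfolding U_eq using h by auto
  also have "\<dots> = (\<Union>(d, q)\<in>I. {\<omega> \<in> space L. \<forall>\<theta>\<in>T. norm (h \<omega> \<theta> - d \<theta>) \<le> q})"
  proof (intro SUP_cong refl)
    fix p assume "p \<in> I"
    then obtain d q where p: "p = (d, q)" and d: "d \<in> mspace (segment_space \<tau>)"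
      using D(2) by (auto simp: I_def)
    show "(case p of (d, q) \<Rightarrow> {\<omega> \<in> space L. mdist (segment_space \<tau>) (h \<omega>) d \<le> q})
       = (case p of (d, q) \<Rightarrow> {\<omega> \<in> space L. \<forall>\<theta>\<in>T. norm (h \<omega> \<theta> - d \<theta>) \<le> q})"
      using T(3)[OF h d] by (auto simp: p)
  qed
  also have "\<dots> \<in> sets L"
  proof (intro sets.countable_UN'' I)
    fix p assume "p \<in> I"
    have "{\<omega> \<in> space L. \<forall>\<theta>\<in>T. norm (h \<omega> \<theta> - d \<theta>) \<le> q} \<in> sets L" for d q
      using T(1,2) by (intro sets_Collect_countable_Ball') (auto simp: subset_eq)
    then show "(case p of (d, q) \<Rightarrow> {\<omega> \<in> space L. \<forall>\<theta>\<in>T. norm (h \<omega> \<theta> - d \<theta>) \<le> q}) \<in> sets L"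
      by (simp split: prod.splits)
  qed
  finally show "h -` U \<inter> space L \<in> sets L" .
qed

lemma measurable_eval:
  fixes h :: "'a \<Rightarrow> real \<Rightarrow> 'b::real_normed_vector"
  assumes "h \<in> L \<rightarrow>\<^sub>M borel_segment \<tau>" "\<theta> \<in> {-\<tau>..0}"
  shows "(\<lambda>\<omega>. h \<omega> \<theta>) \<in> borel_measurable L"
proof (rule measurable_compose[OF assms(1)], rule borel_measurableI)
  fix V :: "'b set" assume "open V"
  have "openin (mtopology_of (segment_space \<tau>)) {X \<in> mspace (segment_space \<tau>). X \<theta> \<in> V}"
    unfolding openin_segment_iff
  proof safe
    fix X :: "real \<Rightarrow> 'b" assume X: "X \<in> mspace (segment_space \<tau>)" "X \<theta> \<in> V"
    then obtain e where e: "0 < e" "\<And>y. dist y (X \<theta>) < e \<Longrightarrow> y \<in> V"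
      using \<open>open V\<close> unfolding open_dist by blast
    then show "\<exists>e>0. \<forall>Y\<in>mspace (segment_space \<tau>). mdist (segment_space \<tau>) X Y < e \<longrightarrow>
        Y \<in> {X \<in> mspace (segment_space \<tau>). X \<theta> \<in> V}"
      using norm_diff_le_mdist[OF X(1) _ assms(2)]
      by (intro exI[of _ e]) (force simp: dist_norm norm_minus_commute)
  qed
  then show "(\<lambda>x. x \<theta>) -` V \<inter> space (borel_segment \<tau>) \<in> sets (borel_segment \<tau>)"
    using openin_sets_borel_segment by (simp add: vimage_def Int_def conj_commute)
qed

text \<open>\<open>FM_functions\<close> does not ask for measurability; the Lipschitz condition
  supplies it.\<close>

lemma borel_measurable_lipschitz_segment:
  fixes \<Psi> :: "(real \<Rightarrow> 'b::real_normed_vector) \<Rightarrow> real"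
  assumes "\<And>X Y. X \<in> mspace (segment_space \<tau>) \<Longrightarrow> Y \<in> mspace (segment_space \<tau>) \<Longrightarrow>
    \<bar>\<Psi> X - \<Psi> Y\<bar> \<le> mdist (segment_space \<tau>) X Y"
  shows "\<Psi> \<in> borel_measurable (borel_segment \<tau>)"
proof (rule borel_measurableI_less)
  fix a
  have "openin (mtopology_of (segment_space \<tau>)) {X \<in> mspace (segment_space \<tau>). \<Psi> X < a}"
    unfolding openin_segment_iff
  proof safe
    fix X :: "real \<Rightarrow> 'b" assume X: "X \<in> mspace (segment_space \<tau>)" "\<Psi> X < a"
    then show "\<exists>e>0. \<forall>Y\<in>mspace (segment_space \<tau>). mdist (segment_space \<tau>) X Y < e \<longrightarrow>
        Y \<in> {X \<in> mspace (segment_space \<tau>). \<Psi> X < a}"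
      using assms[OF X(1)] by (intro exI[of _ "a - \<Psi> X"]) force
  qed
  then show "{X \<in> space (borel_segment \<tau>). \<Psi> X < a} \<in> sets (borel_segment \<tau>)"
    using openin_sets_borel_segment by simp
qed

lemma measurable_mdist_segment [measurable (raw)]:
  fixes h k :: "'a \<Rightarrow> real \<Rightarrow> 'b::euclidean_space"
  assumes [measurable]: "h \<in> L \<rightarrow>\<^sub>M borel_segment \<tau>" "k \<in> L \<rightarrow>\<^sub>M borel_segment \<tau>"
  shows "(\<lambda>\<omega>. mdist (segment_space \<tau>) (h \<omega>) (k \<omega>)) \<in> borel_measurable L"
proof (rule borel_measurableI_le)
  fix a
  obtain T where T: "countable T" "T \<subseteq> {-\<tau>..0}"
    "\<And>X Y :: real \<Rightarrow> 'b. \<And>a. X \<in> mspace (segment_space \<tau>) \<Longrightarrow> Y \<in> mspace (segment_space \<tau>) \<Longrightarrow>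
       mdist (segment_space \<tau>) X Y \<le> a \<longleftrightarrow> (\<forall>\<theta>\<in>T. norm (X \<theta> - Y \<theta>) \<le> a)"
    by (rule countable_dense_times) blast
  have "{\<omega> \<in> space L. mdist (segment_space \<tau>) (h \<omega>) (k \<omega>) \<le> a}
      = {\<omega> \<in> space L. \<forall>\<theta>\<in>T. norm (h \<omega> \<theta> - k \<omega> \<theta>) \<le> a}"
    using assms[THEN measurable_space] by (auto simp: T(3))
  also have "\<dots> \<in> sets L"
  proof (intro sets_Collect_countable_Ball' T(1))
    fix \<theta> assume "\<theta> \<in> T"
    then have "\<theta> \<in> {-\<tau>..0}" using T by auto
    note assms[THEN measurable_eval, OF this, measurable]
    show "{\<omega> \<in> space L. norm (h \<omega> \<theta> - k \<omega> \<theta>) \<le> a} \<in> sets L"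
      by measurable
  qed
  finally show "{\<omega> \<in> space L. mdist (segment_space \<tau>) (h \<omega>) (k \<omega>) \<le> a} \<in> sets L" .
qed

lemma segment_space_complete:
  fixes \<sigma> :: "nat \<Rightarrow> real \<Rightarrow> 'b::banach"
  assumes \<sigma>: "\<And>n. \<sigma> n \<in> mspace (segment_space \<tau>)"
    and Cauchy: "\<And>e. 0 < e \<Longrightarrow> \<exists>N. \<forall>m\<ge>N. \<forall>n\<ge>N. mdist (segment_space \<tau>) (\<sigma> m) (\<sigma> n) < e"
  shows "\<exists>X\<in>mspace (segment_space \<tau>). (\<lambda>n. mdist (segment_space \<tau>) (\<sigma> n) X) \<longlonglongrightarrow> 0"
proof -
  interpret M: Metric_space "mspace (segment_space \<tau> :: (real \<Rightarrow> 'b) metric)" "mdist (segment_space \<tau>)"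
    by simp
  have "mcomplete_of (segment_space \<tau> :: (real \<Rightarrow> 'b) metric)"
    using Met_TC.mcomplete_cfunspace[where 'a='b, of "top_of_set {-\<tau>..0}"]
    by (simp add: segment_space_def Met_TC.Self_def euclidean_metric_def complete_UNIV)
  moreover have "M.MCauchy \<sigma>"
    unfolding M.MCauchy_def using \<sigma> Cauchy by blast
  ultimately obtain X where X: "limitin M.mtopology \<sigma> X sequentially"
    unfolding mcomplete_of_def M.mcomplete_def by blast
  then show ?thesis
    using M.limit_metric_sequentially[of \<sigma> X]
    by (intro bexI[of _ X]) (auto simp: LIMSEQ_iff, meson)
qed

text \<open>For open U, the functions min(1/(n+1), dist(X, complement of U)) are admissible test
  functions, and multiplied by n+1 they converge boundedly to the indicator of U. The open sets form
  an intersection-stable generator, so agreement on them suffices.\<close>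

lemma FM_functions_eqI:
  fixes P Q :: "(real \<Rightarrow> 'b::real_normed_vector) measure"
  assumes P: "P \<in> segment_prob \<tau>" and Q: "Q \<in> segment_prob \<tau>"
    and eq: "\<And>\<Psi>. \<Psi> \<in> FM_functions \<tau> \<Longrightarrow> (\<integral>X. \<Psi> X \<partial>P) = (\<integral>X. \<Psi> X \<partial>Q)"
  shows "P = Q"
proof (rule measure_eqI_generator_eq[where A="\<lambda>_. mspace (segment_space \<tau>)" and \<Omega>="mspace (segment_space \<tau>)"
      and E="{U. openin (mtopology_of (segment_space \<tau>)) U}"])
  interpret P: prob_space P using P by (simp add: segment_prob_def)
  interpret Q: prob_space Q using Q by (simp add: segment_prob_def)
  have setsP [measurable_cong]: "sets P = sets (borel_segment \<tau>)" and setsQ [measurable_cong]: "sets Q = sets (borel_segment \<tau>)"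
    using P Q by (auto simp: segment_prob_def)
  have spP: "space P = mspace (segment_space \<tau>)" and spQ: "space Q = mspace (segment_space \<tau>)"
    using setsP[THEN sets_eq_imp_space_eq] setsQ[THEN sets_eq_imp_space_eq] by auto
  let ?C = "mspace (segment_space \<tau>) :: (real \<Rightarrow> 'b) set"
  let ?d = "mdist (segment_space \<tau>) :: (real \<Rightarrow> 'b) \<Rightarrow> _"
  show "Int_stable {U :: (real \<Rightarrow> 'b) set. openin (mtopology_of (segment_space \<tau>)) U}"
    by (auto simp: Int_stable_def)
  show "{U :: (real \<Rightarrow> 'b) set. openin (mtopology_of (segment_space \<tau>)) U} \<subseteq> Pow ?C"
    by (auto dest: openin_segment_subset)
  show "sets P = sigma_sets ?C {U. openin (mtopology_of (segment_space \<tau>)) U}"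
    "sets Q = sigma_sets ?C {U. openin (mtopology_of (segment_space \<tau>)) U}"
    unfolding setsP setsQ borel_segment_def by (subst sets_measure_of; auto dest: openin_segment_subset)+
  show "range (\<lambda>_::nat. ?C) \<subseteq> {U. openin (mtopology_of (segment_space \<tau>)) U}"
    by (auto simp: openin_segment_iff intro!: exI[of _ "1::real"])
  show "emeasure P ?C \<noteq> \<infinity>" by simp
  show "(\<Union>i::nat. ?C) = ?C" by simp
  fix U :: "(real \<Rightarrow> 'b) set" assume "U \<in> {U. openin (mtopology_of (segment_space \<tau>)) U}"
  then have U: "openin (mtopology_of (segment_space \<tau>)) U" by simp
  then have [measurable]: "U \<in> sets (borel_segment \<tau>)" by (rule openin_sets_borel_segment)
  have UC: "U \<subseteq> ?C" using U by (simp add: openin_segment_iff)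
  show "emeasure P U = emeasure Q U"
  \<comment> \<open>The distance to an empty complement carries no information, so the whole space
    is treated separately.\<close>
  proof (cases "U = ?C")
    case True
    then show ?thesis
      using P.emeasure_space_1 Q.emeasure_space_1 by (simp add: spP spQ)
  next
    case False
    define \<delta> where "\<delta> X = (INF Y\<in>?C - U. ?d X Y)" for X
    have ne: "?C - U \<noteq> {}" using False UC by auto
    have bdd: "bdd_below (?d X ` (?C - U))" for X
      by (auto intro!: bdd_belowI[of _ 0])
    have \<delta>0: "0 \<le> \<delta> X" for X
      unfolding \<delta>_def using ne by (auto intro!: cINF_greatest)
    have \<delta>_lip: "\<delta> X \<le> \<delta> Y + ?d X Y" if "X \<in> ?C" "Y \<in> ?C" for X Y
    proof -
      have "\<delta> X - ?d X Y \<le> \<delta> Y"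
        unfolding \<delta>_def[of Y]
      proof (rule cINF_greatest[OF ne])
        fix Z assume Z: "Z \<in> ?C - U"
        have "\<delta> X \<le> ?d X Z"
          unfolding \<delta>_def using Z bdd by (intro cINF_lower)
        also have "\<dots> \<le> ?d X Y + ?d Y Z"
          using that Z by (intro mdist_triangle) auto
        finally show "\<delta> X - ?d X Y \<le> ?d Y Z" by simp
      qed
      then show ?thesis by simp
    qed
    have \<delta>_out: "\<delta> X = 0" if "X \<in> ?C" "X \<notin> U" for X
    proof -
      have "\<delta> X \<le> ?d X X"
        unfolding \<delta>_def using that by (intro cINF_lower bdd) auto
      moreover have "?d X X = 0" using that by simp
      ultimately show ?thesis
        using \<delta>0[of X] by linarith
    qed
    have \<delta>_in: "0 < \<delta> X" if X: "X \<in> U" for X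
    proof -
      obtain e where e: "0 < e" "\<And>Y. Y \<in> ?C \<Longrightarrow> ?d X Y < e \<Longrightarrow> Y \<in> U"
        using U X unfolding openin_segment_iff by blast
      then have "e \<le> \<delta> X"
        unfolding \<delta>_def by (intro cINF_greatest[OF ne]) (auto simp: not_less[symmetric])
      with e show ?thesis by simp
    qed
    define \<Psi> where "\<Psi> n X = min (1 / real (Suc n)) (\<delta> X)" for n X
    have \<Psi>0: "0 \<le> \<Psi> n X" and \<Psi>1: "\<Psi> n X \<le> 1 / real (Suc n)" for n X
      using \<delta>0[of X] by (auto simp: \<Psi>_def)
    have \<Psi>: "\<Psi> n \<in> FM_functions \<tau>" for n
    proof -
      have "\<bar>\<Psi> n X - \<Psi> n Y\<bar> \<le> ?d X Y" if "X \<in> ?C" "Y \<in> ?C" for X Y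
        using \<delta>_lip[OF that] \<delta>_lip[OF that(2,1)] mdist_commute[of "segment_space \<tau>" X Y]
        unfolding \<Psi>_def by linarith
      moreover have "\<bar>\<Psi> n X\<bar> \<le> 1" for X
      proof -
        have "1 / real (Suc n) \<le> 1" by simp
        then show ?thesis using \<Psi>0[of n X] \<Psi>1[of n X] by linarith
      qed
      ultimately show ?thesis
        by (simp add: FM_functions_def)
    qed
    have meas [measurable]: "\<Psi> n \<in> borel_measurable (borel_segment \<tau>)" for n
      using \<Psi>[of n] by (intro borel_measurable_lipschitz_segment) (simp add: FM_functions_def)
    have conv: "(\<lambda>n. real (Suc n) * \<Psi> n X) \<longlonglongrightarrow> indicator U X" if "X \<in> ?C" for X
    proof (cases "X \<in> U")
      case True
      obtain n0 where n0: "1 / \<delta> X < real n0"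
        using reals_Archimedean2 by blast
      have "real (Suc n) * \<Psi> n X = 1" if "n \<ge> n0" for n
      proof -
        have "1 / real (Suc n) \<le> \<delta> X"
        proof -
          have "1 / \<delta> X \<le> real (Suc n)" using n0 that by linarith
          then show ?thesis using \<delta>_in[OF True] by (simp add: field_simps)
        qed
        then show ?thesis by (simp add: \<Psi>_def)
      qed
      then show ?thesis
        using True by (intro tendsto_eventually) (auto simp: eventually_sequentially)
    qed (use that \<delta>_out in \<open>simp add: \<Psi>_def\<close>)
    have bound: "norm (real (Suc n) * \<Psi> n X) \<le> 1" for n X
      using \<Psi>0[of n X] \<Psi>1[of n X] by (simp add: abs_mult field_simps)
    have "(\<lambda>n. \<integral>X. real (Suc n) * \<Psi> n X \<partial>P) \<longlonglongrightarrow> (\<integral>X. indicator U X \<partial>P)"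
      using conv bound by (intro integral_dominated_convergence[where w="\<lambda>_. 1"]) (auto simp: spP)
    moreover have "(\<lambda>n. \<integral>X. real (Suc n) * \<Psi> n X \<partial>Q) \<longlonglongrightarrow> (\<integral>X. indicator U X \<partial>Q)"
      using conv bound by (intro integral_dominated_convergence[where w="\<lambda>_. 1"]) (auto simp: spQ)
    moreover have "(\<integral>X. real (Suc n) * \<Psi> n X \<partial>P) = (\<integral>X. real (Suc n) * \<Psi> n X \<partial>Q)" for n
      using eq[OF \<Psi>] by simp
    ultimately have "(\<integral>X. indicator U X \<partial>P) = (\<integral>X. indicator U X \<partial>Q :: real)"
      using LIMSEQ_unique by (simp only:)
    then show ?thesis
      using UC by (simp add: spP spQ P.emeasure_eq_measure Q.emeasure_eq_measure Int_absorb2)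
  qed
qed

end

section \<open>Coalescing random maps have an invariant measure\<close>

text \<open>The synchronous coupling: both copies receive the same noise. It is again a random map,
  so the operators and the maximal inequality apply to pairs.\<close>

definition pair_map :: "('s \<Rightarrow> 'z \<Rightarrow> 's) \<Rightarrow> 's \<times> 's \<Rightarrow> 'z \<Rightarrow> 's \<times> 's" where
  "pair_map S p z = (S (fst p) z, S (snd p) z)"

context random_map begin

lemma random_map_pair: "random_map \<gamma> (\<S> \<Otimes>\<^sub>M \<S>) (pair_map S)"
proof
  show "case_prod (pair_map S) \<in> (\<S> \<Otimes>\<^sub>M \<S>) \<Otimes>\<^sub>M \<gamma> \<rightarrow>\<^sub>M \<S> \<Otimes>\<^sub>M \<S>"
    unfolding pair_map_def by measurable
qed

lemma iter_pair: "random_map.iter (pair_map S) n (x, y) \<omega> = (iter n x \<omega>, iter n y \<omega>)"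
proof -
  interpret P: random_map \<gamma> "\<S> \<Otimes>\<^sub>M \<S>" "pair_map S" by (rule random_map_pair)
  show ?thesis
    by (induction n arbitrary: x y \<omega>) (auto simp: pair_map_def)
qed

lemma pull_pair: "random_map.pull (pair_map S) n (x, y) \<omega> = (pull n x \<omega>, pull n y \<omega>)"
proof -
  interpret P: random_map \<gamma> "\<S> \<Otimes>\<^sub>M \<S>" "pair_map S" by (rule random_map_pair)
  show ?thesis
    by (induction n arbitrary: x y \<omega>) (auto simp: pair_map_def)
qed

lemma pull_invariant:
  assumes "x \<in> A" "\<And>x z. x \<in> A \<Longrightarrow> z \<in> space \<gamma> \<Longrightarrow> S x z \<in> A" "\<omega> \<in> space (stream_space \<gamma>)"
  shows "pull n x \<omega> \<in> A"
  using assms(3)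
proof (induction n arbitrary: \<omega>)
  case (Suc n)
  then show ?case
    using assms(2) by (cases \<omega>) (auto simp: stream_space_Stream)
qed (simp add: assms(1))

end

lemma min_1_triangle:
  fixes a b c :: real
  assumes "0 \<le> b" "0 \<le> c" "a \<le> b + c"
  shows "ennreal (min 1 a) \<le> ennreal (min 1 b) + ennreal (min 1 c)"
proof -
  have "min 1 a \<le> min 1 b + min 1 c"
    using assms by (auto simp: min_def)
  then have "ennreal (min 1 a) \<le> ennreal (min 1 b + min 1 c)"
    by (rule ennreal_leI)
  with assms show ?thesis by simp
qed

lemma mdist_self: "x \<in> mspace m \<Longrightarrow> mdist m x x = 0"
  by simp

text \<open>\<open>A\<close> will be the set of segments in the truncation ball. The rate e is
  uniform over \<open>A\<close>, while the Lipschitz constant may depend on the noise: it serves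
  only to pass to the limit along a fixed noise.\<close>

locale coalescing_segments = segment_interval \<tau> + random_map \<gamma> "borel_segment \<tau>" S
  for \<tau> :: real and \<gamma> :: "'z measure" and S :: "(real \<Rightarrow> 'b::euclidean_space) \<Rightarrow> 'z \<Rightarrow> real \<Rightarrow> 'b" +
  fixes A :: "(real \<Rightarrow> 'b) set" and e :: "nat \<Rightarrow> real" and L :: "'z \<Rightarrow> real" and x0 :: "real \<Rightarrow> 'b"
  assumes A_sets: "A \<in> sets (borel_segment \<tau>)"
    and A_invariant: "\<And>X z. X \<in> A \<Longrightarrow> z \<in> space \<gamma> \<Longrightarrow> S X z \<in> A"
    and A_closed: "\<And>\<sigma> X. (\<And>n::nat. \<sigma> n \<in> A) \<Longrightarrow> X \<in> mspace (segment_space \<tau>) \<Longrightarrow>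
        (\<lambda>n. mdist (segment_space \<tau>) (\<sigma> n) X) \<longlonglongrightarrow> 0 \<Longrightarrow> X \<in> A"
    and x0: "x0 \<in> A"
    and Lipschitz: "\<And>X Y z. X \<in> A \<Longrightarrow> Y \<in> A \<Longrightarrow>
        mdist (segment_space \<tau>) (S X z) (S Y z) \<le> L z * mdist (segment_space \<tau>) X Y"
    and coalescence: "\<And>n X Y. X \<in> A \<Longrightarrow> Y \<in> A \<Longrightarrow>
        (\<integral>\<^sup>+\<omega>. ennreal (min 1 (mdist (segment_space \<tau>) (iter n X \<omega>) (iter n Y \<omega>))) \<partial>stream_space \<gamma>) \<le> ennreal (e n)"
    and e_tendsto_0: "e \<longlonglongrightarrow> 0"
begin

abbreviation "d \<equiv> mdist (segment_space \<tau> :: (real \<Rightarrow> 'b) metric)"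

lemma A_subset: "A \<subseteq> mspace (segment_space \<tau>)"
  using sets.sets_into_space[OF A_sets] by simp

lemma measurable_x0 [measurable]: "(\<lambda>_. x0) \<in> Q \<rightarrow>\<^sub>M borel_segment \<tau>"
  using x0 A_subset by (intro measurable_const) auto

lemma pull_in_A: "\<omega> \<in> space (stream_space \<gamma>) \<Longrightarrow> pull n x0 \<omega> \<in> A"
  using x0 A_invariant by (rule pull_invariant)

text \<open>\<open>pull (n + m)\<close> applies to a state built from later noise the same n maps
  that \<open>pull n\<close> applies to \<open>x0\<close>. These are coupled copies started in
  \<open>A\<close>, so the bound does not depend on m.\<close>

lemma pull_Cauchy:
  "(\<integral>\<^sup>+\<omega>. ennreal (min 1 (d (pull n x0 \<omega>) (pull (n + m) x0 \<omega>))) \<partial>stream_space \<gamma>) \<le> ennreal (e n)"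
proof -
  interpret P: random_map \<gamma> "borel_segment \<tau> \<Otimes>\<^sub>M borel_segment \<tau>" "pair_map S" by (rule random_map_pair)
  let ?\<phi> = "\<lambda>p. ennreal (min 1 (d (fst p) (snd p)))"
  let ?a = "\<lambda>\<omega>. (x0, pull m x0 \<omega>)"
  have \<phi>: "?\<phi> \<in> borel_measurable (borel_segment \<tau> \<Otimes>\<^sub>M borel_segment \<tau>)"
    by measurable
  have a: "?a \<in> stream_space \<gamma> \<rightarrow>\<^sub>M borel_segment \<tau> \<Otimes>\<^sub>M borel_segment \<tau>"
    by measurable
  have "(\<integral>\<^sup>+\<omega>. ennreal (min 1 (d (pull n x0 \<omega>) (pull (n + m) x0 \<omega>))) \<partial>stream_space \<gamma>)
      = (\<integral>\<^sup>+\<omega>. P.expect n ?\<phi> (?a \<omega>) \<partial>stream_space \<gamma>)"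
    using P.nn_integral_pull[OF \<phi> a, of n] by (simp add: pull_pair pull_add)
  moreover have "(\<integral>\<^sup>+\<omega>. P.expect n ?\<phi> (?a \<omega>) \<partial>stream_space \<gamma>) \<le> (\<integral>\<^sup>+\<omega>. ennreal (e n) \<partial>stream_space \<gamma>)"
    using coalescence[OF x0 pull_in_A] by (intro nn_integral_mono) (simp add: P.expect_def iter_pair)
  ultimately show ?thesis
    by (simp add: stream.emeasure_space_1)
qed

theorem invariant_measure_exists:
  "\<exists>\<pi>. prob_space \<pi> \<and> sets \<pi> = sets (borel_segment \<tau>) \<and> (AE X in \<pi>. X \<in> A) \<and>
     (\<forall>\<phi>\<in>borel_measurable (borel_segment \<tau>). (\<integral>\<^sup>+X. expect (Suc 0) \<phi> X \<partial>\<pi>) = (\<integral>\<^sup>+X. \<phi> X \<partial>\<pi>))"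
proof -
  have "\<exists>n. \<forall>m\<ge>n. e m \<le> (1/2) ^ k" for k :: nat
    using order_tendstoD(2)[OF e_tendsto_0, of "(1/2) ^ k"]
    by (auto simp: eventually_sequentially intro: less_imp_le)
  then have "\<exists>N. \<forall>k. \<forall>m\<ge>N k. e m \<le> (1/2) ^ k"
    by (intro choice allI)
  then obtain N where N: "\<And>k m. N k \<le> m \<Longrightarrow> e m \<le> (1/2) ^ k" by blast
  \<comment> \<open>A nondecreasing sequence of times at which the rate is at most 2^(-k); the
    summand k forces it to infinity.\<close>
  define n where "n k = (\<Sum>i\<le>k. N i) + k" for k
  have n_N: "N k \<le> n k" for k
    using member_le_sum[of k "{..k}" N] by (simp add: n_def)
  have n_mono: "n k \<le> n (Suc k)" for k by (simp add: n_def)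
  have n_ge: "k \<le> n k" for k by (simp add: n_def)
  define Z where "Z k = pull (n k) x0" for k
  have Z_meas [measurable]: "Z k \<in> stream_space \<gamma> \<rightarrow>\<^sub>M borel_segment \<tau>" for k
    unfolding Z_def by measurable
  have Z_A: "Z k \<omega> \<in> A" if "\<omega> \<in> space (stream_space \<gamma>)" for k \<omega>
    using pull_in_A[OF that] by (simp add: Z_def)
  have Z_C: "Z k \<omega> \<in> mspace (segment_space \<tau>)" if "\<omega> \<in> space (stream_space \<gamma>)" for k \<omega>
    using Z_A[OF that] A_subset by blast
  \<comment> \<open>Borel-Cantelli in summed form: the mean of \<open>T\<close> is at most a
    geometric series, so almost surely the gaps, truncated at 1, are summable.\<close>
  define T where "T \<omega> = (\<Sum>k. ennreal (min 1 (d (Z k \<omega>) (Z (Suc k) \<omega>))))" for \<omega>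
  have [measurable]: "T \<in> borel_measurable (stream_space \<gamma>)"
    unfolding T_def by measurable
  have "(\<integral>\<^sup>+\<omega>. T \<omega> \<partial>stream_space \<gamma>) = (\<Sum>k. \<integral>\<^sup>+\<omega>. ennreal (min 1 (d (Z k \<omega>) (Z (Suc k) \<omega>))) \<partial>stream_space \<gamma>)"
    unfolding T_def by (rule nn_integral_suminf) measurable
  moreover have "(\<Sum>k. \<integral>\<^sup>+\<omega>. ennreal (min 1 (d (Z k \<omega>) (Z (Suc k) \<omega>))) \<partial>stream_space \<gamma>) \<le> (\<Sum>k. ennreal ((1/2) ^ k))"
  proof (intro suminf_le)
    fix k
    have "n (Suc k) = n k + (n (Suc k) - n k)" using n_mono[of k] by simp
    then have "(\<integral>\<^sup>+\<omega>. ennreal (min 1 (d (Z k \<omega>) (Z (Suc k) \<omega>))) \<partial>stream_space \<gamma>) \<le> ennreal (e (n k))"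
      unfolding Z_def by (metis pull_Cauchy)
    also have "\<dots> \<le> ennreal ((1/2) ^ k)"
      using N[OF n_N] by (rule ennreal_leI)
    finally show "(\<integral>\<^sup>+\<omega>. ennreal (min 1 (d (Z k \<omega>) (Z (Suc k) \<omega>))) \<partial>stream_space \<gamma>) \<le> ennreal ((1/2) ^ k)" .
  qed auto
  moreover have "(\<Sum>k. ennreal ((1/2) ^ k)) = ennreal 2"
    using geometric_sums[of "1/2 :: real"] by (intro sums_unique[symmetric] sums_ennreal[THEN iffD2]) auto
  ultimately have "(\<integral>\<^sup>+\<omega>. T \<omega> \<partial>stream_space \<gamma>) \<noteq> \<infinity>"
    by (metis ennreal_less_top infinity_ennreal_def leD)
  then have T_fin: "AE \<omega> in stream_space \<gamma>. T \<omega> \<noteq> \<infinity>"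
    by (intro nn_integral_PInf_AE) auto
  define G where "G = {\<omega> \<in> space (stream_space \<gamma>). T \<omega> \<noteq> \<infinity>}"
  have G [measurable]: "G \<in> sets (stream_space \<gamma>)" unfolding G_def by measurable
  have AE_G: "AE \<omega> in stream_space \<gamma>. \<omega> \<in> G"
    using T_fin AE_space by eventually_elim (simp add: G_def)
  have conv: "\<exists>X\<in>mspace (segment_space \<tau>). (\<lambda>k. d (Z k \<omega>) X) \<longlonglongrightarrow> 0" if \<omega>: "\<omega> \<in> G" for \<omega>
  proof (rule segment_space_complete)
    have sp: "\<omega> \<in> space (stream_space \<gamma>)" using \<omega> by (simp add: G_def)
    show "Z k \<omega> \<in> mspace (segment_space \<tau>)" for k using Z_C[OF sp] .
    let ?a = "\<lambda>k. d (Z k \<omega>) (Z (Suc k) \<omega>)"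
    have s1: "summable (\<lambda>k. min 1 (?a k))"
      using \<omega> by (intro summable_suminf_not_top) (auto simp: G_def T_def)
    \<comment> \<open>The truncated gaps tend to 0, so from some index on the truncation at 1 is
      inactive and the gaps themselves are summable.\<close>
    have s2: "eventually (\<lambda>k. norm (?a k) \<le> min 1 (?a k)) sequentially"
      using order_tendstoD(2)[OF summable_LIMSEQ_zero[OF s1] zero_less_one]
      by eventually_elim auto
    have sa: "summable ?a"
      by (rule summable_comparison_test_ev[OF s2 s1])
    have tri: "d (Z m \<omega>) (Z (m + j) \<omega>) \<le> (\<Sum>k=m..<m+j. ?a k)" for m j
    proof (induction j)
      case 0 then show ?case using mdist_self[OF Z_C[OF sp]] by simp
    next
      case (Suc j)
      have "d (Z m \<omega>) (Z (m + Suc j) \<omega>) \<le> d (Z m \<omega>) (Z (m + j) \<omega>) + d (Z (m + j) \<omega>) (Z (m + Suc j) \<omega>)"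
        using Z_C[OF sp] by (intro mdist_triangle)
      with Suc show ?case by simp
    qed
    fix \<epsilon> :: real assume "0 < \<epsilon>"
    then obtain K where K: "\<And>m n. K \<le> m \<Longrightarrow> norm (sum ?a {m..<n}) < \<epsilon>"
      using sa unfolding summable_Cauchy by blast
    have "d (Z m \<omega>) (Z l \<omega>) < \<epsilon>" if "K \<le> m" "m \<le> l" for m l
      using tri[of m "l - m"] K[of m l] that by simp
    then show "\<exists>N. \<forall>m\<ge>N. \<forall>n\<ge>N. d (Z m \<omega>) (Z n \<omega>) < \<epsilon>"
      by (metis linear mdist_commute)
  qed
  \<comment> \<open>Defining the limit time by time lets its measurability be checked at single
    times; off the full set \<open>G\<close> the value \<open>x0\<close> keeps it in
    \<open>A\<close>.\<close>
  define X where "X \<omega> = (\<lambda>\<theta>\<in>{-\<tau>..0}. if \<omega> \<in> G then lim (\<lambda>k. Z k \<omega> \<theta>) else x0 \<theta>)" for \<omega>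
  have X_lim: "X \<omega> \<in> mspace (segment_space \<tau>)" "(\<lambda>k. d (Z k \<omega>) (X \<omega>)) \<longlonglongrightarrow> 0" if \<omega>: "\<omega> \<in> G" for \<omega>
  proof -
    obtain Y where Y: "Y \<in> mspace (segment_space \<tau>)" "(\<lambda>k. d (Z k \<omega>) Y) \<longlonglongrightarrow> 0"
      using conv[OF \<omega>] by blast
    have sp: "\<omega> \<in> space (stream_space \<gamma>)" using \<omega> by (simp add: G_def)
    have "lim (\<lambda>k. Z k \<omega> \<theta>) = Y \<theta>" if "\<theta> \<in> {-\<tau>..0}" for \<theta>
    proof (rule limI)
      show "(\<lambda>k. Z k \<omega> \<theta>) \<longlonglongrightarrow> Y \<theta>"
        using norm_diff_le_mdist[OF Z_C[OF sp] Y(1) that] Y(2)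
        by (intro Lim_transform_bound[of "\<lambda>k. Z k \<omega> \<theta> - Y \<theta>" "\<lambda>k. d (Z k \<omega>) Y", THEN LIM_zero_cancel]) auto
    qed
    then have "X \<omega> = Y"
      using \<omega> Y(1) unfolding X_def mspace_segment_iff extensional_def by (auto simp: fun_eq_iff)
    with Y show "X \<omega> \<in> mspace (segment_space \<tau>)" "(\<lambda>k. d (Z k \<omega>) (X \<omega>)) \<longlonglongrightarrow> 0"
      by auto
  qed
  have X_out: "X \<omega> = x0" if "\<omega> \<notin> G" for \<omega>
    using that x0 A_subset by (force simp: X_def mspace_segment_iff extensional_def fun_eq_iff)
  have X_A: "X \<omega> \<in> A" for \<omega>
  proof (cases "\<omega> \<in> G")
    case True
    then show ?thesis
      using A_closed[of "\<lambda>k. Z k \<omega>" "X \<omega>"] X_lim[OF True] Z_A by (auto simp: G_def)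
  qed (use x0 X_out in auto)
  have X_C: "X \<omega> \<in> mspace (segment_space \<tau>)" for \<omega>
    using X_A A_subset by blast
  have X_meas [measurable]: "X \<in> stream_space \<gamma> \<rightarrow>\<^sub>M borel_segment \<tau>"
  proof (rule measurable_borel_segmentI)
    fix \<theta> assume \<theta>: "\<theta> \<in> {-\<tau>..0}"
    have [measurable]: "(\<lambda>\<omega>. Z k \<omega> \<theta>) \<in> borel_measurable (stream_space \<gamma>)" for k
      using \<theta> by (intro measurable_eval) auto
    have "(\<lambda>\<omega>. X \<omega> \<theta>) = (\<lambda>\<omega>. if \<omega> \<in> G then lim (\<lambda>k. Z k \<omega> \<theta>) else x0 \<theta>)"
      using \<theta> by (auto simp: X_def)
    then show "(\<lambda>\<omega>. X \<omega> \<theta>) \<in> borel_measurable (stream_space \<gamma>)"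
      by simp
  qed (rule X_C)
  \<comment> \<open>\<open>Z\<close> is only a subsequence. The limit inherits the rate at every m,
    because \<open>pull m\<close> is close to all later members of \<open>Z\<close>; the rate is
    used below at the times n k + 1.\<close>
  have rate: "(\<integral>\<^sup>+\<omega>. ennreal (min 1 (d (pull m x0 \<omega>) (X \<omega>))) \<partial>stream_space \<gamma>) \<le> ennreal (e m)" for m
  proof (rule LIMSEQ_le_const2)
    show "(\<lambda>k. \<integral>\<^sup>+\<omega>. ennreal (min 1 (d (pull m x0 \<omega>) (Z k \<omega>))) \<partial>stream_space \<gamma>)
       \<longlonglongrightarrow> (\<integral>\<^sup>+\<omega>. ennreal (min 1 (d (pull m x0 \<omega>) (X \<omega>))) \<partial>stream_space \<gamma>)"
    proof (rule nn_integral_dominated_convergence[where w="\<lambda>_. 1"])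
      show "AE \<omega> in stream_space \<gamma>. (\<lambda>k. ennreal (min 1 (d (pull m x0 \<omega>) (Z k \<omega>)))) \<longlonglongrightarrow> ennreal (min 1 (d (pull m x0 \<omega>) (X \<omega>)))"
        using AE_G
      proof eventually_elim
        fix \<omega> assume \<omega>: "\<omega> \<in> G"
        then have sp: "\<omega> \<in> space (stream_space \<gamma>)" by (simp add: G_def)
        have C: "pull m x0 \<omega> \<in> mspace (segment_space \<tau>)"
          using pull_in_A[OF sp] A_subset by blast
        have "(\<lambda>k. d (pull m x0 \<omega>) (Z k \<omega>)) \<longlonglongrightarrow> d (pull m x0 \<omega>) (X \<omega>)"
        proof (rule LIM_zero_cancel, rule Lim_transform_bound[OF _ X_lim(2)[OF \<omega>]], intro always_eventually allI)
          fix k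
          show "norm (d (pull m x0 \<omega>) (Z k \<omega>) - d (pull m x0 \<omega>) (X \<omega>)) \<le> norm (d (Z k \<omega>) (X \<omega>))"
            using mdist_triangle[OF C Z_C[OF sp, of k] X_C[of \<omega>]] mdist_triangle[OF C X_C[of \<omega>] Z_C[OF sp, of k]]
              mdist_commute[of "segment_space \<tau>" "X \<omega>" "Z k \<omega>"] by simp
        qed
        then show "(\<lambda>k. ennreal (min 1 (d (pull m x0 \<omega>) (Z k \<omega>)))) \<longlonglongrightarrow> ennreal (min 1 (d (pull m x0 \<omega>) (X \<omega>)))"
          by (intro tendsto_ennrealI tendsto_min tendsto_const)
      qed
    qed (auto simp: stream.emeasure_space_1)
    show "\<exists>K. \<forall>k\<ge>K. (\<integral>\<^sup>+\<omega>. ennreal (min 1 (d (pull m x0 \<omega>) (Z k \<omega>))) \<partial>stream_space \<gamma>) \<le> ennreal (e m)"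
    proof (intro exI[of _ m] allI impI)
      fix k assume "m \<le> k"
      then have "n k = m + (n k - m)" using n_ge[of k] by simp
      then show "(\<integral>\<^sup>+\<omega>. ennreal (min 1 (d (pull m x0 \<omega>) (Z k \<omega>))) \<partial>stream_space \<gamma>) \<le> ennreal (e m)"
        unfolding Z_def by (metis pull_Cauchy)
    qed
  qed
  have AE_tl: "AE \<omega> in stream_space \<gamma>. stl \<omega> \<in> G"
    using AE_G by (subst AE_stream_space) auto
  let ?SX = "\<lambda>\<omega>. S (X (stl \<omega>)) (shd \<omega>)"
  have SX_C: "?SX \<omega> \<in> mspace (segment_space \<tau>)" if "\<omega> \<in> space (stream_space \<gamma>)" for \<omega>
    using that map_in_space X_C by (cases \<omega>) (auto simp: stream_space_Stream)
  \<comment> \<open>On the whole stream, \<open>pull\<close> at time n k + 1 is one further map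
    applied to \<open>Z k\<close> of the tail. The Lipschitz constant of that map belongs to the
    head noise and stays fixed as k grows.\<close>
  have step: "(\<lambda>k. \<integral>\<^sup>+\<omega>. ennreal (min 1 (d (pull (Suc (n k)) x0 \<omega>) (?SX \<omega>))) \<partial>stream_space \<gamma>) \<longlonglongrightarrow> (\<integral>\<^sup>+\<omega>. 0 \<partial>stream_space \<gamma>)"
  proof (rule nn_integral_dominated_convergence[where w="\<lambda>_. 1"])
    show "AE \<omega> in stream_space \<gamma>. (\<lambda>k. ennreal (min 1 (d (pull (Suc (n k)) x0 \<omega>) (?SX \<omega>)))) \<longlonglongrightarrow> 0"
      using AE_tl AE_space
    proof eventually_elim
      fix \<omega> assume \<omega>: "stl \<omega> \<in> G" and sp: "\<omega> \<in> space (stream_space \<gamma>)"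
      have sp': "stl \<omega> \<in> space (stream_space \<gamma>)" using \<omega> by (simp add: G_def)
      have "(\<lambda>k. L (shd \<omega>) * d (Z k (stl \<omega>)) (X (stl \<omega>))) \<longlonglongrightarrow> L (shd \<omega>) * 0"
        by (intro tendsto_mult tendsto_const X_lim(2) \<omega>)
      then have c1: "(\<lambda>k. L (shd \<omega>) * d (Z k (stl \<omega>)) (X (stl \<omega>))) \<longlonglongrightarrow> 0" by simp
      have c2: "norm (d (pull (Suc (n k)) x0 \<omega>) (?SX \<omega>)) \<le> L (shd \<omega>) * d (Z k (stl \<omega>)) (X (stl \<omega>))" for k
        using Lipschitz[OF Z_A[OF sp'] X_A, of k "shd \<omega>" "stl \<omega>"] by (simp add: Z_def)
      have lim0: "(\<lambda>k. d (pull (Suc (n k)) x0 \<omega>) (?SX \<omega>)) \<longlonglongrightarrow> 0"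
        using c2 by (intro Lim_null_comparison[OF _ c1] always_eventually) auto
      have "(\<lambda>k. ennreal (min 1 (d (pull (Suc (n k)) x0 \<omega>) (?SX \<omega>)))) \<longlonglongrightarrow> ennreal (min 1 0)"
        by (rule tendsto_ennrealI[OF tendsto_min[OF tendsto_const lim0]])
      then show "(\<lambda>k. ennreal (min 1 (d (pull (Suc (n k)) x0 \<omega>) (?SX \<omega>)))) \<longlonglongrightarrow> 0"
        by simp
    qed
  qed (auto simp: stream.emeasure_space_1)
  \<comment> \<open>\<open>pull\<close> at time n k + 1 is close both to \<open>X\<close> and to
    \<open>?SX\<close>, so these agree almost surely: \<open>X\<close> is a stationary solution of
    the recursion.\<close>
  have "(\<integral>\<^sup>+\<omega>. ennreal (min 1 (d (X \<omega>) (?SX \<omega>))) \<partial>stream_space \<gamma>) \<le> 0"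
  proof (rule LIMSEQ_le_const)
    have "(\<lambda>k. e (Suc (n k))) \<longlonglongrightarrow> 0"
      using n_ge by (intro filterlim_compose[OF e_tendsto_0] filterlim_at_top_mono[OF filterlim_ident])
        (auto intro!: always_eventually le_SucI)
    then have "(\<lambda>k. ennreal (e (Suc (n k)))) \<longlonglongrightarrow> ennreal 0"
      by (intro tendsto_ennrealI)
    from tendsto_add[OF this step]
    show "(\<lambda>k. ennreal (e (Suc (n k))) + (\<integral>\<^sup>+\<omega>. ennreal (min 1 (d (pull (Suc (n k)) x0 \<omega>) (?SX \<omega>))) \<partial>stream_space \<gamma>)) \<longlonglongrightarrow> 0"
      by simp
    have "(\<integral>\<^sup>+\<omega>. ennreal (min 1 (d (X \<omega>) (?SX \<omega>))) \<partial>stream_space \<gamma>)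
        \<le> ennreal (e (Suc (n k))) + (\<integral>\<^sup>+\<omega>. ennreal (min 1 (d (pull (Suc (n k)) x0 \<omega>) (?SX \<omega>))) \<partial>stream_space \<gamma>)" for k
    proof -
      have "(\<integral>\<^sup>+\<omega>. ennreal (min 1 (d (X \<omega>) (?SX \<omega>))) \<partial>stream_space \<gamma>)
        \<le> (\<integral>\<^sup>+\<omega>. ennreal (min 1 (d (pull (Suc (n k)) x0 \<omega>) (X \<omega>))) + ennreal (min 1 (d (pull (Suc (n k)) x0 \<omega>) (?SX \<omega>))) \<partial>stream_space \<gamma>)"
      proof (intro nn_integral_mono min_1_triangle)
        fix \<omega> assume sp: "\<omega> \<in> space (stream_space \<gamma>)"
        have "pull (Suc (n k)) x0 \<omega> \<in> mspace (segment_space \<tau>)"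
          using pull_in_A[OF sp] A_subset by blast
        from mdist_triangle[OF X_C this SX_C[OF sp]]
        show "d (X \<omega>) (?SX \<omega>) \<le> d (pull (Suc (n k)) x0 \<omega>) (X \<omega>) + d (pull (Suc (n k)) x0 \<omega>) (?SX \<omega>)"
          by (simp only: mdist_commute)
      qed auto
      moreover have "(\<integral>\<^sup>+\<omega>. ennreal (min 1 (d (pull (Suc (n k)) x0 \<omega>) (X \<omega>))) + ennreal (min 1 (d (pull (Suc (n k)) x0 \<omega>) (?SX \<omega>))) \<partial>stream_space \<gamma>)
        = (\<integral>\<^sup>+\<omega>. ennreal (min 1 (d (pull (Suc (n k)) x0 \<omega>) (X \<omega>))) \<partial>stream_space \<gamma>) + (\<integral>\<^sup>+\<omega>. ennreal (min 1 (d (pull (Suc (n k)) x0 \<omega>) (?SX \<omega>))) \<partial>stream_space \<gamma>)"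
        by (intro nn_integral_add) measurable
      ultimately show ?thesis
        using add_right_mono[OF rate[of "Suc (n k)"]] by (simp only:) (erule order_trans)
    qed
    then show "\<exists>K. \<forall>k\<ge>K. (\<integral>\<^sup>+\<omega>. ennreal (min 1 (d (X \<omega>) (?SX \<omega>))) \<partial>stream_space \<gamma>)
        \<le> ennreal (e (Suc (n k))) + (\<integral>\<^sup>+\<omega>. ennreal (min 1 (d (pull (Suc (n k)) x0 \<omega>) (?SX \<omega>))) \<partial>stream_space \<gamma>)"
      by blast
  qed
  then have "(\<integral>\<^sup>+\<omega>. ennreal (min 1 (d (X \<omega>) (?SX \<omega>))) \<partial>stream_space \<gamma>) = 0"
    by simp
  then have "AE \<omega> in stream_space \<gamma>. ennreal (min 1 (d (X \<omega>) (?SX \<omega>))) = 0"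
    by (subst (asm) nn_integral_0_iff_AE) auto
  then have fixpoint: "AE \<omega> in stream_space \<gamma>. X \<omega> = ?SX \<omega>"
    using AE_space
  proof eventually_elim
    fix \<omega> assume *: "ennreal (min 1 (d (X \<omega>) (?SX \<omega>))) = 0" and sp: "\<omega> \<in> space (stream_space \<gamma>)"
    have "d (X \<omega>) (?SX \<omega>) \<le> 0"
      using * by (simp add: ennreal_eq_0_iff min_def split: if_splits)
    then have "d (X \<omega>) (?SX \<omega>) = 0"
      by (rule antisym) simp
    then show "X \<omega> = ?SX \<omega>"
      using X_C SX_C[OF sp] by simp
  qed
  define \<pi> where "\<pi> = distr (stream_space \<gamma>) (borel_segment \<tau>) X"
  show ?thesis
  proof (intro exI[of _ \<pi>] conjI ballI)
    show "prob_space \<pi>" unfolding \<pi>_def by (rule stream.prob_space_distr) (rule X_meas)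
    show "sets \<pi> = sets (borel_segment \<tau>)" by (simp add: \<pi>_def)
    show "AE X in \<pi>. X \<in> A"
      unfolding \<pi>_def using X_A A_sets by (subst AE_distr_iff) (auto simp: Int_absorb1[OF A_subset] Collect_conj_eq)
    fix \<phi> :: "(real \<Rightarrow> 'b) \<Rightarrow> ennreal" assume [measurable]: "\<phi> \<in> borel_measurable (borel_segment \<tau>)"
    interpret PP: pair_sigma_finite \<gamma> "stream_space \<gamma>" ..
    have e1: "(\<integral>\<^sup>+Y. \<phi> Y \<partial>\<pi>) = (\<integral>\<^sup>+\<omega>. \<phi> (X \<omega>) \<partial>stream_space \<gamma>)"
      unfolding \<pi>_def by (subst nn_integral_distr) auto
    have e2: "(\<integral>\<^sup>+\<omega>. \<phi> (X \<omega>) \<partial>stream_space \<gamma>) = (\<integral>\<^sup>+\<omega>. \<phi> (?SX \<omega>) \<partial>stream_space \<gamma>)"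
      using fixpoint by (intro nn_integral_cong_AE) auto
    \<comment> \<open>Head and tail of the stream are independent and the tail has the law of the
      stream, so the fixed point equation turns into invariance of the law of
      \<open>X\<close>.\<close>
    have e3: "(\<integral>\<^sup>+\<omega>. \<phi> (?SX \<omega>) \<partial>stream_space \<gamma>) = (\<integral>\<^sup>+z. \<integral>\<^sup>+\<omega>. \<phi> (S (X \<omega>) z) \<partial>stream_space \<gamma> \<partial>\<gamma>)"
      by (subst nn_integral_stream_space) simp_all
    have e4: "(\<integral>\<^sup>+z. \<integral>\<^sup>+\<omega>. \<phi> (S (X \<omega>) z) \<partial>stream_space \<gamma> \<partial>\<gamma>) = (\<integral>\<^sup>+\<omega>. \<integral>\<^sup>+z. \<phi> (S (X \<omega>) z) \<partial>\<gamma> \<partial>stream_space \<gamma>)"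
      by (rule PP.Fubini'[symmetric]) simp
    have e5: "(\<integral>\<^sup>+\<omega>. \<integral>\<^sup>+z. \<phi> (S (X \<omega>) z) \<partial>\<gamma> \<partial>stream_space \<gamma>) = (\<integral>\<^sup>+\<omega>. expect (Suc 0) \<phi> (X \<omega>) \<partial>stream_space \<gamma>)"
      using X_C by (simp add: expect_1)
    have e6: "(\<integral>\<^sup>+\<omega>. expect (Suc 0) \<phi> (X \<omega>) \<partial>stream_space \<gamma>) = (\<integral>\<^sup>+Y. expect (Suc 0) \<phi> Y \<partial>\<pi>)"
      unfolding \<pi>_def by (subst nn_integral_distr) auto
    show "(\<integral>\<^sup>+Y. expect (Suc 0) \<phi> Y \<partial>\<pi>) = (\<integral>\<^sup>+Y. \<phi> Y \<partial>\<pi>)"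
      by (simp only: e1 e2 e3 e4 e5 e6)
  qed
qed

end

section \<open>The truncation\<close>

lemma norm_scaleR_sgn: "norm x *\<^sub>R sgn x = x"
  by (cases "x = 0") (simp_all add: sgn_div_norm)

lemma norm_trunc: "0 \<le> r \<Longrightarrow> norm (trunc r x) = min (norm x) r"
  by (cases "x = 0") (auto simp: trunc_def norm_sgn)

lemma norm_trunc_le: "0 \<le> r \<Longrightarrow> norm (trunc r x) \<le> r"
  by (simp add: norm_trunc)

lemma trunc_id: "norm x \<le> r \<Longrightarrow> trunc r x = x"
  by (simp add: trunc_def min_def norm_scaleR_sgn)

text \<open>Metric projections onto closed convex sets are nonexpansive; that is the purpose of this
  identification.\<close>

lemma trunc_eq_closest_point:
  fixes x :: "'b::euclidean_space"
  assumes "0 \<le> r"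
  shows "trunc r x = closest_point (cball 0 r) x"
proof (rule closest_point_unique)
  show "trunc r x \<in> cball 0 r"
    using assms by (simp add: norm_trunc_le)
  show "\<forall>z\<in>cball 0 r. dist x (trunc r x) \<le> dist x z"
  proof
    fix z :: 'b assume "z \<in> cball 0 r"
    then have z: "norm z \<le> r" by simp
    show "dist x (trunc r x) \<le> dist x z"
    proof (cases "norm x \<le> r")
      case False
      have "x - trunc r x = (norm x - r) *\<^sub>R sgn x"
        using False by (simp add: trunc_def scaleR_diff_left norm_scaleR_sgn)
      then have "dist x (trunc r x) = norm x - r"
        using False assms by (auto simp: dist_norm norm_sgn)
      also have "\<dots> \<le> norm x - norm z" using z by simp
      also have "\<dots> \<le> dist x z" by (simp add: dist_norm norm_triangle_ineq2)
      finally show ?thesis .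
    qed (simp add: trunc_id)
  qed
qed auto

lemma norm_trunc_diff_le:
  fixes x y :: "'b::euclidean_space"
  shows "0 \<le> r \<Longrightarrow> norm (trunc r x - trunc r y) \<le> norm (x - y)"
  using closest_point_lipschitz[of "cball 0 r" x y]
  by (simp add: trunc_eq_closest_point dist_norm)

lemma continuous_on_trunc [continuous_intros]:
  fixes h :: "'a::metric_space \<Rightarrow> 'b::euclidean_space"
  assumes "0 \<le> r" "continuous_on A h"
  shows "continuous_on A (\<lambda>x. trunc r (h x))"
proof -
  have "continuous_on UNIV (trunc r :: 'b \<Rightarrow> 'b)"
    by (rule continuous_onI)
       (metis assms(1) dist_norm norm_trunc_diff_le order_le_less_trans less_imp_le)
  then show ?thesis
    by (rule continuous_on_compose2[OF _ assms(2)]) simp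
qed

lemma borel_measurable_trunc [measurable (raw)]:
  fixes h :: "'a \<Rightarrow> 'b::euclidean_space"
  assumes "h \<in> borel_measurable M"
  shows "(\<lambda>x. trunc r (h x)) \<in> borel_measurable M"
  unfolding trunc_def sgn_div_norm using assms by measurable

section \<open>Matrices acting on a centred isotropic noise\<close>

lemma norm_matrix_vector_mult_le:
  fixes A :: "real^'m^'d"
  shows "norm (A *v z) \<le> norm A * norm z"
proof -
  have "norm (A *v z) = L2_set (\<lambda>i. \<bar>A $ i \<bullet> z\<bar>) UNIV"
    by (simp add: norm_vec_def matrix_vector_mul_component)
  also have "\<dots> \<le> L2_set (\<lambda>i. norm (A $ i) * norm z) UNIV"
    by (intro L2_set_mono Cauchy_Schwarz_ineq2) auto
  also have "\<dots> = norm A * norm z"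
    by (simp add: norm_vec_def[of A] L2_set_left_distrib)
  finally show ?thesis .
qed

lemma borel_measurable_matrix_vector_mult [measurable (raw)]:
  fixes A :: "'a \<Rightarrow> real^'m^'d"
  assumes "A \<in> borel_measurable M" "z \<in> borel_measurable M"
  shows "(\<lambda>x. A x *v z x) \<in> borel_measurable M"
proof (rule borel_measurable_continuous_Pair[OF assms])
  show "continuous_on UNIV (\<lambda>x. fst x *v snd x :: real^'d)"
    unfolding matrix_vector_mult_def by (intro continuous_intros)
qed

lemma norm_sq_vec: "(norm (v :: 'a::real_normed_vector^'d))\<^sup>2 = (\<Sum>i\<in>UNIV. (norm (v $ i))\<^sup>2)"
  by (simp add: norm_vec_def L2_set_def sum_nonneg)

text \<open>The one-step estimates see the noise only through its mean and its covariance \<Delta>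
  I.\<close>

locale isotropic_noise = prob_space \<gamma> for \<gamma> :: "(real^'m) measure" +
  fixes \<Delta> :: real
  assumes sets_noise: "sets \<gamma> = sets borel"
    and noise_integrable: "\<And>i. integrable \<gamma> (\<lambda>z. z $ i)"
    and noise_centred: "\<And>i. (\<integral>z. z $ i \<partial>\<gamma>) = 0"
    and noise_prod_integrable: "\<And>i j. integrable \<gamma> (\<lambda>z. z $ i * z $ j)"
    and noise_covariance: "\<And>i j. (\<integral>z. z $ i * z $ j \<partial>\<gamma>) = (if i = j then \<Delta> else 0)"
begin

lemma affine_second_moment:
  shows "integrable \<gamma> (\<lambda>z. (c + b \<bullet> z)\<^sup>2)"
    and "(\<integral>z. (c + b \<bullet> z)\<^sup>2 \<partial>\<gamma>) = c\<^sup>2 + \<Delta> * (norm b)\<^sup>2"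
proof -
  have eq: "(c + b \<bullet> z)\<^sup>2 = c\<^sup>2 + (\<Sum>j\<in>UNIV. 2 * c * b $ j * z $ j) + (\<Sum>j\<in>UNIV. \<Sum>l\<in>UNIV. b $ j * b $ l * (z $ j * z $ l))" for z
    by (simp add: power2_eq_square inner_vec_def sum_product sum_distrib_left algebra_simps)
  have i1: "integrable \<gamma> (\<lambda>z. \<Sum>j\<in>UNIV. 2 * c * b $ j * z $ j)"
    by (intro Bochner_Integration.integrable_sum integrable_mult_right noise_integrable)
  have i2: "integrable \<gamma> (\<lambda>z. \<Sum>j\<in>UNIV. \<Sum>l\<in>UNIV. b $ j * b $ l * (z $ j * z $ l))"
    by (intro Bochner_Integration.integrable_sum integrable_mult_right noise_prod_integrable)
  show "integrable \<gamma> (\<lambda>z. (c + b \<bullet> z)\<^sup>2)"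
    unfolding eq using i1 i2 by simp
  have "(\<integral>z. (c + b \<bullet> z)\<^sup>2 \<partial>\<gamma>) = c\<^sup>2 + (\<integral>z. (\<Sum>j\<in>UNIV. 2 * c * b $ j * z $ j) \<partial>\<gamma>)
      + (\<integral>z. (\<Sum>j\<in>UNIV. \<Sum>l\<in>UNIV. b $ j * b $ l * (z $ j * z $ l)) \<partial>\<gamma>)"
    unfolding eq using i1 i2 prob_space by simp
  moreover have "(\<integral>z. (\<Sum>j\<in>UNIV. 2 * c * b $ j * z $ j) \<partial>\<gamma>) = 0"
    by (subst Bochner_Integration.integral_sum) (auto simp: noise_integrable noise_centred)
  moreover have "(\<integral>z. (\<Sum>j\<in>UNIV. \<Sum>l\<in>UNIV. b $ j * b $ l * (z $ j * z $ l)) \<partial>\<gamma>)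
      = (\<Sum>j\<in>UNIV. \<Sum>l\<in>UNIV. b $ j * b $ l * (\<integral>z. z $ j * z $ l \<partial>\<gamma>))"
    by (simp add: noise_prod_integrable Bochner_Integration.integral_sum Bochner_Integration.integrable_sum)
  moreover have "(\<Sum>j\<in>UNIV. \<Sum>l\<in>UNIV. b $ j * b $ l * (\<integral>z. z $ j * z $ l \<partial>\<gamma>)) = \<Delta> * (norm b)\<^sup>2"
    by (subst norm_sq_vec) (simp add: noise_covariance sum_distrib_left power2_eq_square mult.commute if_distrib cong: if_cong)
  ultimately show "(\<integral>z. (c + b \<bullet> z)\<^sup>2 \<partial>\<gamma>) = c\<^sup>2 + \<Delta> * (norm b)\<^sup>2"
    by simp
qed

text \<open>A discrete Ito isometry: the cross term vanishes because the noise is centred, and each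
  row of B contributes \<Delta> times its squared norm, which adds up to the Frobenius norm.\<close>

lemma nn_integral_norm_affine_sq:
  fixes B :: "real^'m^'d"
  assumes "0 \<le> \<Delta>"
  shows "(\<integral>\<^sup>+z. ennreal ((norm (a + B *v z))\<^sup>2) \<partial>\<gamma>) = ennreal ((norm a)\<^sup>2 + \<Delta> * (norm B)\<^sup>2)"
proof -
  have eq: "(norm (a + B *v z))\<^sup>2 = (\<Sum>i\<in>UNIV. (a $ i + B $ i \<bullet> z)\<^sup>2)" for z
    by (simp add: norm_sq_vec matrix_vector_mul_component)
  have "(\<integral>\<^sup>+z. ennreal ((norm (a + B *v z))\<^sup>2) \<partial>\<gamma>) = ennreal (\<integral>z. (\<Sum>i\<in>UNIV. (a $ i + B $ i \<bullet> z)\<^sup>2) \<partial>\<gamma>)"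
    unfolding eq
    by (intro nn_integral_eq_integral Bochner_Integration.integrable_sum affine_second_moment AE_I2 sum_nonneg) simp
  moreover have "(\<integral>z. (\<Sum>i\<in>UNIV. (a $ i + B $ i \<bullet> z)\<^sup>2) \<partial>\<gamma>) = (\<Sum>i\<in>UNIV. (a $ i)\<^sup>2 + \<Delta> * (norm (B $ i))\<^sup>2)"
    by (subst Bochner_Integration.integral_sum) (auto simp: affine_second_moment)
  moreover have "(\<Sum>i\<in>UNIV. (a $ i)\<^sup>2 + \<Delta> * (norm (B $ i))\<^sup>2) = (norm a)\<^sup>2 + \<Delta> * (norm B)\<^sup>2"
    by (simp add: norm_sq_vec[of a] norm_sq_vec[of B] sum.distrib sum_distrib_left)
  ultimately show ?thesis by simp
qed

end

section \<open>The scheme as a random map on segments\<close>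

text \<open>\<open>X 0\<close> and \<open>X (-\<tau>)\<close> enter without truncation, because the
  segments of the scheme consist of already truncated values.\<close>

definition em_next ::
  "((real^'d) \<times> (real^'d) \<Rightarrow> real^'d) \<Rightarrow> ((real^'d) \<times> (real^'d) \<Rightarrow> real^'m^'d) \<Rightarrow>
     real \<Rightarrow> real \<Rightarrow> real \<Rightarrow> (real \<Rightarrow> real^'d) \<Rightarrow> real^'m \<Rightarrow> real^'d" where
  "em_next f g r \<tau> \<Delta> X z = trunc r (X 0 + \<Delta> *\<^sub>R f (X 0, X (-\<tau>)) + g (X 0, X (-\<tau>)) *v z)"

definition em_step ::
  "((real^'d) \<times> (real^'d) \<Rightarrow> real^'d) \<Rightarrow> ((real^'d) \<times> (real^'d) \<Rightarrow> real^'m^'d) \<Rightarrow>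
     real \<Rightarrow> real \<Rightarrow> real \<Rightarrow> (real \<Rightarrow> real^'d) \<Rightarrow> real^'m \<Rightarrow> real \<Rightarrow> real^'d" where
  "em_step f g r \<tau> \<Delta> X z = (\<lambda>\<theta>\<in>{-\<tau>..0}.
     if \<theta> \<le> -\<Delta> then X (\<theta> + \<Delta>)
     else (-\<theta> / \<Delta>) *\<^sub>R X 0 + ((\<theta> + \<Delta>) / \<Delta>) *\<^sub>R em_next f g r \<tau> \<Delta> X z)"

locale em_map = segment_interval \<tau> + isotropic_noise \<gamma> \<Delta>
  for \<tau> :: real and \<gamma> :: "(real^'m) measure" and \<Delta> :: real +
  fixes f :: "(real^'d) \<times> (real^'d) \<Rightarrow> real^'d" and g :: "(real^'d) \<times> (real^'d) \<Rightarrow> real^'m^'d"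
    and r :: real and N :: nat and l :: real
  assumes f_meas [measurable]: "f \<in> borel_measurable borel"
    and g_meas [measurable]: "g \<in> borel_measurable borel"
    and r_nonneg: "0 \<le> r"
    and Delta_pos: "0 < \<Delta>" and Delta: "real N * \<Delta> = \<tau>"
    and l_nonneg: "0 \<le> l"
    and lipschitz_ball: "\<And>x y x' y'. norm x \<le> r \<Longrightarrow> norm y \<le> r \<Longrightarrow> norm x' \<le> r \<Longrightarrow> norm y' \<le> r \<Longrightarrow>
        norm (f (x, y) - f (x', y')) \<le> l * (norm (x - x') + norm (y - y')) \<and>
        norm (g (x, y) - g (x', y')) \<le> l * (norm (x - x') + norm (y - y'))"
begin

lemma N_pos: "0 < N"
  using Delta tau_pos by (cases N) auto

lemma Delta_le: "\<Delta> \<le> \<tau>"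
proof -
  have "1 * \<Delta> \<le> real N * \<Delta>"
    using N_pos Delta_pos by (intro mult_right_mono) auto
  then show ?thesis by (simp add: Delta)
qed

abbreviation "next_node \<equiv> em_next f g r \<tau> \<Delta>"
abbreviation "step \<equiv> em_step f g r \<tau> \<Delta>"

lemma step_apply:
  "\<theta> \<in> {-\<tau>..-\<Delta>} \<Longrightarrow> step X z \<theta> = X (\<theta> + \<Delta>)"
  "\<theta> \<in> {-\<Delta><..0} \<Longrightarrow> step X z \<theta> = (-\<theta> / \<Delta>) *\<^sub>R X 0 + ((\<theta> + \<Delta>) / \<Delta>) *\<^sub>R next_node X z"
  using Delta_le Delta_pos by (auto simp: em_step_def)

lemma step_0: "step X z 0 = next_node X z"
  using Delta_pos by (subst step_apply) auto

lemma norm_next_node: "norm (next_node X z) \<le> r"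
  unfolding em_next_def by (rule norm_trunc_le[OF r_nonneg])

lemma norm_next_node_diff_le:
  "norm (next_node X z - next_node Y z) \<le> norm ((X 0 - Y 0)
     + \<Delta> *\<^sub>R (f (X 0, X (-\<tau>)) - f (Y 0, Y (-\<tau>))) + (g (X 0, X (-\<tau>)) - g (Y 0, Y (-\<tau>))) *v z)"
proof -
  have "norm (next_node X z - next_node Y z) \<le> norm ((X 0 + \<Delta> *\<^sub>R f (X 0, X (-\<tau>)) + g (X 0, X (-\<tau>)) *v z)
      - (Y 0 + \<Delta> *\<^sub>R f (Y 0, Y (-\<tau>)) + g (Y 0, Y (-\<tau>)) *v z))"
    unfolding em_next_def by (rule norm_trunc_diff_le[OF r_nonneg])
  then show ?thesis
    by (simp add: algebra_simps matrix_vector_mult_diff_rdistrib)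
qed

lemma step_mem:
  assumes "X \<in> mspace (segment_space \<tau>)"
  shows "step X z \<in> mspace (segment_space \<tau>)"
  unfolding em_step_def restrict_mem_mspace_iff
\<comment> \<open>At \<theta> = -\<Delta> both branches give \<open>X 0\<close>, so the two pieces
  glue continuously.\<close>
proof (rule continuous_on_cases_le)
  have X: "continuous_on {-\<tau>..0} X"
    using assms by (simp add: mspace_segment_iff)
  show "continuous_on {\<theta> \<in> {-\<tau>..0}. \<theta> \<le> -\<Delta>} (\<lambda>\<theta>. X (\<theta> + \<Delta>))"
    using Delta_pos by (intro continuous_on_compose2[OF X] continuous_intros) auto
  show "continuous_on {\<theta> \<in> {-\<tau>..0}. -\<Delta> \<le> \<theta>} (\<lambda>\<theta>. (-\<theta> / \<Delta>) *\<^sub>R X 0 + ((\<theta> + \<Delta>) / \<Delta>) *\<^sub>R next_node X z)"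
    using Delta_pos by (intro continuous_intros) auto
qed (use Delta_pos in \<open>auto intro!: continuous_intros\<close>)

sublocale random_map \<gamma> "borel_segment \<tau>" step
proof
  show "case_prod step \<in> borel_segment \<tau> \<Otimes>\<^sub>M \<gamma> \<rightarrow>\<^sub>M borel_segment \<tau>"
  proof (rule measurable_borel_segmentI)
    show "(case p of (X, z) \<Rightarrow> step X z) \<in> mspace (segment_space \<tau>)"
      if "p \<in> space (borel_segment \<tau> \<Otimes>\<^sub>M \<gamma>)" for p
      using that by (auto simp: space_pair_measure step_mem)
    note sets_noise [measurable_cong]
    have z [measurable]: "snd \<in> borel_measurable (borel_segment \<tau> \<Otimes>\<^sub>M \<gamma>)" for \<tau> :: real
      by measurable
    have [measurable]: "(\<lambda>p. fst p 0) \<in> borel_measurable (borel_segment \<tau> \<Otimes>\<^sub>M \<gamma> :: ((real \<Rightarrow> real^'d) \<times> _) measure)"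
      "(\<lambda>p. fst p (-\<tau>)) \<in> borel_measurable (borel_segment \<tau> \<Otimes>\<^sub>M \<gamma> :: ((real \<Rightarrow> real^'d) \<times> _) measure)"
      using tau_pos by (intro measurable_eval; simp)+
    have nx [measurable]: "(\<lambda>p. next_node (fst p) (snd p)) \<in> borel_measurable (borel_segment \<tau> \<Otimes>\<^sub>M \<gamma>)"
      unfolding em_next_def by measurable
    fix \<theta> assume \<theta>: "\<theta> \<in> {-\<tau>..0}"
    show "(\<lambda>p. (case p of (X, z) \<Rightarrow> step X z) \<theta>) \<in> borel_measurable (borel_segment \<tau> \<Otimes>\<^sub>M \<gamma>)"
    proof (cases "\<theta> \<le> -\<Delta>")
      case True
      have "(\<lambda>p. fst p (\<theta> + \<Delta>)) \<in> borel_measurable (borel_segment \<tau> \<Otimes>\<^sub>M \<gamma> :: ((real \<Rightarrow> real^'d) \<times> _) measure)"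
        using True \<theta> Delta_pos by (intro measurable_eval) auto
      then show ?thesis
        using True \<theta> by (simp add: split_beta step_apply)
    next
      case False
      have "(\<lambda>p. (-\<theta> / \<Delta>) *\<^sub>R fst p 0 + ((\<theta> + \<Delta>) / \<Delta>) *\<^sub>R next_node (fst p) (snd p)) \<in> borel_measurable (borel_segment \<tau> \<Otimes>\<^sub>M \<gamma>)"
        by measurable
      then show ?thesis
        using False \<theta> by (simp add: split_beta step_apply)
    qed
  qed
qed

section \<open>Segments with values in a ball\<close>

definition bounded_segments :: "real \<Rightarrow> (real \<Rightarrow> real^'d) set" where
  "bounded_segments R = {X \<in> mspace (segment_space \<tau>). \<forall>\<theta>\<in>{-\<tau>..0}. norm (X \<theta>) \<le> R}"

lemma node_mem: "i \<le> N \<Longrightarrow> - (real i * \<Delta>) \<in> {-\<tau>..0}"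
  using Delta_pos Delta[symmetric] by (auto intro!: mult_right_mono)

lemma bounded_segments_D:
  assumes "X \<in> bounded_segments R"
  shows "X \<in> mspace (segment_space \<tau>)" "\<theta> \<in> {-\<tau>..0} \<Longrightarrow> norm (X \<theta>) \<le> R"
    "norm (X 0) \<le> R" "norm (X (-\<tau>)) \<le> R" "i \<le> N \<Longrightarrow> norm (X (- (real i * \<Delta>))) \<le> R"
proof -
  have "0 \<in> {-\<tau>..0}" "-\<tau> \<in> {-\<tau>..0}" using tau_pos by auto
  then show "X \<in> mspace (segment_space \<tau>)" "\<theta> \<in> {-\<tau>..0} \<Longrightarrow> norm (X \<theta>) \<le> R"
    "norm (X 0) \<le> R" "norm (X (-\<tau>)) \<le> R" "i \<le> N \<Longrightarrow> norm (X (- (real i * \<Delta>))) \<le> R"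
    using assms node_mem[of i] unfolding bounded_segments_def by blast+
qed

lemma restrict_0_bounded: "0 \<le> R \<Longrightarrow> (\<lambda>\<theta>\<in>{-\<tau>..0}. 0) \<in> bounded_segments R"
  by (simp add: bounded_segments_def restrict_mem_mspace_iff del: restrict_apply)
     (simp add: restrict_def)

lemma bounded_segments_eq:
  "0 \<le> R \<Longrightarrow> bounded_segments R = {X \<in> mspace (segment_space \<tau>). mdist (segment_space \<tau>) X (\<lambda>\<theta>\<in>{-\<tau>..0}. 0) \<le> R}"
proof -
  have 0: "(\<lambda>\<theta>\<in>{-\<tau>..0}. 0) \<in> mspace (segment_space \<tau>)"
    unfolding restrict_mem_mspace_iff by simp
  show "bounded_segments R = {X \<in> mspace (segment_space \<tau>). mdist (segment_space \<tau>) X (\<lambda>\<theta>\<in>{-\<tau>..0}. 0) \<le> R}"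
    unfolding bounded_segments_def using mdist_segment_le_iff[OF _ 0] by auto
qed

lemma sets_bounded_segments: "0 \<le> R \<Longrightarrow> bounded_segments R \<in> sets (borel_segment \<tau>)"
proof -
  assume R: "0 \<le> R"
  have 0: "(\<lambda>\<theta>\<in>{-\<tau>..0}. 0 :: real^'d) \<in> mspace (segment_space \<tau>)"
    unfolding restrict_mem_mspace_iff by simp
  have "(\<lambda>X. mdist (segment_space \<tau>) X (\<lambda>\<theta>\<in>{-\<tau>..0}. 0 :: real^'d)) \<in> borel_measurable (borel_segment \<tau>)"
    using 0 by (intro measurable_mdist_segment measurable_ident_sets measurable_const) auto
  from borel_measurable_le[OF this borel_measurable_const[of R]] show ?thesis
    unfolding bounded_segments_eq[OF R] by simp
qed

lemma bounded_segments_closed: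
  assumes \<sigma>: "\<And>n::nat. \<sigma> n \<in> bounded_segments R" and X: "X \<in> mspace (segment_space \<tau>)"
    and lim: "(\<lambda>n. mdist (segment_space \<tau>) (\<sigma> n) X) \<longlonglongrightarrow> 0"
  shows "X \<in> bounded_segments R"
proof -
  have "norm (X \<theta>) \<le> R" if \<theta>: "\<theta> \<in> {-\<tau>..0}" for \<theta>
  proof (rule LIMSEQ_le_const[where X="\<lambda>n. mdist (segment_space \<tau>) (\<sigma> n) X + R"])
    show "(\<lambda>n. mdist (segment_space \<tau>) (\<sigma> n) X + R) \<longlonglongrightarrow> R"
      using tendsto_add[OF lim tendsto_const[of R]] by simp
    have "norm (X \<theta>) \<le> mdist (segment_space \<tau>) (\<sigma> n) X + R" for n
      using norm_diff_le_mdist[OF bounded_segments_D(1)[OF \<sigma>[of n]] X \<theta>]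
        bounded_segments_D(2)[OF \<sigma>[of n] \<theta>] norm_triangle_sub[of "X \<theta>" "\<sigma> n \<theta>"]
      by (simp add: norm_minus_commute)
    then show "\<exists>N. \<forall>n\<ge>N. norm (X \<theta>) \<le> mdist (segment_space \<tau>) (\<sigma> n) X + R" by blast
  qed
  with X show ?thesis by (simp add: bounded_segments_def)
qed

text \<open>Every value of the new segment is either an old value or a point on the chord from
  \<open>X 0\<close> to the new node, with a weight u independent of X and z. Bounds on values and
  on differences thus pass from nodes to segments by convexity.\<close>

lemma step_cases:
  assumes "\<theta> \<in> {-\<tau>..0}"
  obtains (old) "\<And>X z. step X z \<theta> = X (\<theta> + \<Delta>)" "\<theta> + \<Delta> \<in> {-\<tau>..0}"
  | (new) u where "0 \<le> u" "u \<le> 1" "\<And>X z. step X z \<theta> = (1 - u) *\<^sub>R X 0 + u *\<^sub>R next_node X z"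
proof (cases "\<theta> \<le> -\<Delta>")
  case True
  then show ?thesis
    using assms Delta_pos by (intro old) (auto simp: step_apply)
next
  case False
  have "1 - (\<theta> + \<Delta>) / \<Delta> = - \<theta> / \<Delta>"
    using Delta_pos by (simp add: field_simps)
  then show ?thesis
    using False assms Delta_pos by (intro new[of "(\<theta> + \<Delta>) / \<Delta>"]) (auto simp: step_apply)
qed

lemma step_bounded:
  assumes X: "X \<in> bounded_segments r"
  shows "step X z \<in> bounded_segments r"
proof -
  have "norm (step X z \<theta>) \<le> r" if "\<theta> \<in> {-\<tau>..0}" for \<theta>
    using that
  proof (cases rule: step_cases)
    case old
    then show ?thesis using bounded_segments_D(2)[OF X] by simp
  next
    case (new u)
    have "(1 - u) *\<^sub>R X 0 + u *\<^sub>R next_node X z \<in> cball 0 r"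
      using new(1,2) bounded_segments_D(3)[OF X] norm_next_node[of X z]
      by (intro convexD[OF convex_cball]) auto
    then show ?thesis by (simp add: new(3))
  qed
  then show ?thesis
    using step_mem[OF bounded_segments_D(1)[OF X]] by (simp add: bounded_segments_def)
qed

text \<open>The constant involves |z| and the Lipschitz constant l of the r-ball. It need not be
  uniform in \<Delta>: it serves only the construction of the invariant law at one step
  size.\<close>

lemma step_lipschitz:
  assumes X: "X \<in> bounded_segments r" and Y: "Y \<in> bounded_segments r"
  shows "mdist (segment_space \<tau>) (step X z) (step Y z) \<le> (1 + 2 * \<Delta> * l + 2 * l * norm z) * mdist (segment_space \<tau>) X Y"
    (is "_ \<le> ?L * ?d")
proof -
  note XC = bounded_segments_D(1)[OF X] and YC = bounded_segments_D(1)[OF Y]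
  have d0: "norm (X 0 - Y 0) \<le> ?d" and d\<tau>: "norm (X (-\<tau>) - Y (-\<tau>)) \<le> ?d"
    using norm_diff_le_mdist[OF XC YC] tau_pos by auto
  have lip: "norm (f (X 0, X (-\<tau>)) - f (Y 0, Y (-\<tau>))) \<le> l * (2 * ?d)"
    "norm (g (X 0, X (-\<tau>)) - g (Y 0, Y (-\<tau>))) \<le> l * (2 * ?d)"
    using lipschitz_ball[OF bounded_segments_D(3,4)[OF X] bounded_segments_D(3,4)[OF Y]] d0 d\<tau>
    by (auto intro: order_trans[OF _ mult_left_mono[OF _ l_nonneg]])
  let ?F = "\<Delta> *\<^sub>R (f (X 0, X (-\<tau>)) - f (Y 0, Y (-\<tau>)))"
  let ?G = "(g (X 0, X (-\<tau>)) - g (Y 0, Y (-\<tau>))) *v z"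
  have n1: "norm (next_node X z - next_node Y z) \<le> norm ((X 0 - Y 0) + ?F + ?G)"
    by (rule norm_next_node_diff_le)
  have n2: "norm ((X 0 - Y 0) + ?F + ?G) \<le> ?L * ?d"
  proof -
    have "norm ((X 0 - Y 0) + ?F + ?G) \<le> norm (X 0 - Y 0) + norm ?F + norm ?G"
      by (intro norm_triangle_le add_mono order_refl)
    moreover have "norm ?F \<le> \<Delta> * (l * (2 * ?d))"
      using lip(1) Delta_pos by (simp add: mult_left_mono)
    moreover have "norm ?G \<le> (l * (2 * ?d)) * norm z"
      by (rule order_trans[OF norm_matrix_vector_mult_le mult_right_mono[OF lip(2) norm_ge_zero]])
    ultimately show ?thesis
      using d0 by (simp add: algebra_simps)
  qed
  have L: "1 \<le> ?L" using Delta_pos l_nonneg by simp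
  have dL: "?d \<le> ?L * ?d"
    using mult_right_mono[OF L, of ?d] by simp
  have "norm (step X z \<theta> - step Y z \<theta>) \<le> ?L * ?d" if "\<theta> \<in> {-\<tau>..0}" for \<theta>
    using that
  proof (cases rule: step_cases)
    case old
    then show ?thesis
      using norm_diff_le_mdist[OF XC YC old(2)] dL unfolding old(1) by linarith
  next
    case (new u)
    have "(1 - u) *\<^sub>R (X 0 - Y 0) + u *\<^sub>R (next_node X z - next_node Y z) \<in> cball 0 (?L * ?d)"
      using new(1,2) d0 dL n1 n2 by (intro convexD[OF convex_cball]) auto
    moreover have "(1 - u) *\<^sub>R (X 0 - Y 0) + u *\<^sub>R (next_node X z - next_node Y z) = step X z \<theta> - step Y z \<theta>"
      by (simp only: new(3)) (simp add: algebra_simps)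
    ultimately show ?thesis by simp
  qed
  then show ?thesis
    by (subst mdist_segment_le_iff[OF step_mem[OF XC] step_mem[OF YC]]) blast
qed

end

section \<open>The contraction step\<close>

lemma (in isotropic_noise) nn_integral_norm_affine_sq_add:
  fixes B :: "real^'m^'d"
  assumes "0 \<le> \<Delta>"
  shows "(\<integral>\<^sup>+z. ennreal ((norm (a + B *v z))\<^sup>2) + k \<partial>\<gamma>) = ennreal ((norm a)\<^sup>2 + \<Delta> * (norm B)\<^sup>2) + k"
proof -
  have "(\<lambda>z. ennreal ((norm (a + B *v z))\<^sup>2)) \<in> borel_measurable \<gamma>"
    unfolding measurable_cong_sets[OF sets_noise refl] by measurable
  then have "(\<integral>\<^sup>+z. ennreal ((norm (a + B *v z))\<^sup>2) + k \<partial>\<gamma>) = (\<integral>\<^sup>+z. ennreal ((norm (a + B *v z))\<^sup>2) \<partial>\<gamma>) + (\<integral>\<^sup>+z. k \<partial>\<gamma>)"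
    by (rule nn_integral_add) simp
  moreover have "(\<integral>\<^sup>+z. k \<partial>\<gamma>) = k"
    using emeasure_space_1 by simp
  ultimately show ?thesis
    by (simp only: nn_integral_norm_affine_sq[OF assms])
qed

context em_map begin

text \<open>The condition i \<le> n ensures that the value i grid steps back was passed through the
  present position 0 at step n - i, instead of being inherited from the past of the initial
  segment.\<close>

lemma iter_node:
  "i \<le> n \<Longrightarrow> i \<le> N \<Longrightarrow> iter n X \<omega> (- (real i * \<Delta>)) = iter (n - i) X \<omega> 0"
proof (induction i arbitrary: n)
  case (Suc i)
  then obtain m where n: "n = Suc m" by (cases n) auto
  have "- (real (Suc i) * \<Delta>) \<in> {-\<tau>..-\<Delta>}"
    using node_mem[OF Suc.prems(2)] Delta_pos by (auto simp: algebra_simps)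
  from step_apply(1)[OF this]
  have "iter n X \<omega> (- (real (Suc i) * \<Delta>)) = iter m X \<omega> (- (real i * \<Delta>))"
    unfolding n iter_Suc_last by (simp add: algebra_simps)
  also have "\<dots> = iter (m - i) X \<omega> 0"
    using Suc by (simp add: n)
  finally show ?case by (simp add: n)
qed simp

text \<open>Between nodes the path is interpolated linearly. Stated for pairs of paths and any
  convex set, this yields both the bound on differences and the bound on a single path.\<close>

lemma iter_convex:
  fixes K :: "((real^'d) \<times> (real^'d)) set"
  assumes "convex K" "\<And>j. j \<le> n \<Longrightarrow> (iter j X \<omega> 0, iter j Y \<omega> 0) \<in> K"
    and "\<theta> \<in> {- (real n * \<Delta>)..0}" "n \<le> N"
  shows "(iter n X \<omega> \<theta>, iter n Y \<omega> \<theta>) \<in> K"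
  using assms(2-)
proof (induction n arbitrary: \<theta>)
  case 0
  then show ?case by auto
next
  case (Suc n)
  have "\<theta> \<in> {-\<tau>..0}"
    using Suc.prems(2) node_mem[OF Suc.prems(3)] by auto
  then show ?case
  proof (cases rule: step_cases)
    case old
    have "(iter n X \<omega> (\<theta> + \<Delta>), iter n Y \<omega> (\<theta> + \<Delta>)) \<in> K"
      using old(2) Suc.prems by (intro Suc.IH) (auto simp: algebra_simps)
    then show ?thesis unfolding iter_Suc_last old(1) .
  next
    case (new u)
    have "(1 - u) *\<^sub>R (iter n X \<omega> 0, iter n Y \<omega> 0) + u *\<^sub>R (iter (Suc n) X \<omega> 0, iter (Suc n) Y \<omega> 0) \<in> K"
      using Suc.prems(1)[of n] Suc.prems(1)[of "Suc n"] new(1,2) by (intro convexD[OF assms(1)]) auto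
    then show ?thesis
      unfolding iter_Suc_last new(3) by (simp add: step_0)
  qed
qed

text \<open>After N steps nothing of the initial segment remains except its value at 0, so the nodes
  alone control the supremum distance.\<close>

lemma mdist_iter_le:
  assumes X: "X \<in> mspace (segment_space \<tau>)" and Y: "Y \<in> mspace (segment_space \<tau>)"
    and c: "\<And>j. j \<le> N \<Longrightarrow> norm (iter j X \<omega> 0 - iter j Y \<omega> 0) \<le> c"
    and \<omega>: "\<omega> \<in> space (stream_space \<gamma>)"
  shows "mdist (segment_space \<tau>) (iter N X \<omega>) (iter N Y \<omega>) \<le> c"
proof -
  let ?K = "{p :: (real^'d) \<times> (real^'d). norm (fst p - snd p) \<le> c}"
  have "convex ?K"
  proof (rule convexI, clarsimp)
    fix a b a' b' :: "real^'d" and u v :: real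
    assume *: "norm (a - b) \<le> c" "norm (a' - b') \<le> c" "0 \<le> u" "0 \<le> v" "u + v = 1"
    then have "u *\<^sub>R (a - b) + v *\<^sub>R (a' - b') \<in> cball 0 c"
      by (intro convexD[OF convex_cball]) auto
    then show "norm (u *\<^sub>R a + v *\<^sub>R a' - (u *\<^sub>R b + v *\<^sub>R b')) \<le> c"
      by (simp add: algebra_simps)
  qed
  then have "norm (iter N X \<omega> \<theta> - iter N Y \<omega> \<theta>) \<le> c" if "\<theta> \<in> {-\<tau>..0}" for \<theta>
    using iter_convex[of ?K N X \<omega> Y \<theta>] c that by (auto simp: Delta)
  then show ?thesis
    using iter_in_space[of _ \<omega> N] X Y \<omega> by (subst mdist_segment_le_iff) auto
qed

lemma norm_iter_le:
  assumes c: "\<And>j. j \<le> N \<Longrightarrow> norm (iter j X \<omega> 0) \<le> c" and "\<theta> \<in> {-\<tau>..0}"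
  shows "norm (iter N X \<omega> \<theta>) \<le> c"
proof -
  have "{p :: (real^'d) \<times> (real^'d). norm (fst p) \<le> c} = cball 0 c \<times> UNIV" by auto
  then have "convex {p :: (real^'d) \<times> (real^'d). norm (fst p) \<le> c}"
    by (simp add: convex_Times)
  from iter_convex[OF this, of N X \<omega> X \<theta>] show ?thesis
    using assms by (auto simp: Delta)
qed

lemma bounded_segments_invariant:
  "X \<in> bounded_segments r \<Longrightarrow> z \<in> space \<gamma> \<Longrightarrow> step X z \<in> bounded_segments r"
  by (rule step_bounded)

text \<open>The delays are \<Delta>, ..., N \<Delta> = \<tau>; the present value is left out. A step
  therefore brings in the term at 0 and drops the term at -\<tau>, which is the one that has to
  absorb the delayed terms of the drift inequalities.\<close>

definition window :: "(real^'d \<Rightarrow> real^'d \<Rightarrow> real) \<Rightarrow> (real \<Rightarrow> real^'d) \<Rightarrow> (real \<Rightarrow> real^'d) \<Rightarrow> real" where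
  "window h X Y = (\<Sum>i<N. h (X (- (real (Suc i) * \<Delta>))) (Y (- (real (Suc i) * \<Delta>))))"

lemma window_step:
  "window h (step X z) (step Y z) = window h X Y + h (X 0) (Y 0) - h (X (-\<tau>)) (Y (-\<tau>))"
proof -
  define a where "a i = h (X (- (real i * \<Delta>))) (Y (- (real i * \<Delta>)))" for i :: nat
  have *: "step Z z (- (real (Suc i) * \<Delta>)) = Z (- (real i * \<Delta>))" if "i < N" for i Z
  proof -
    have "- (real (Suc i) * \<Delta>) \<in> {-\<tau>..-\<Delta>}"
      using node_mem[of "Suc i"] that Delta_pos by (auto simp: algebra_simps)
    then show ?thesis
      by (subst step_apply(1)) (auto simp: algebra_simps)
  qed
  have "window h (step X z) (step Y z) = (\<Sum>i<N. a i)"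
    unfolding window_def a_def by (intro sum.cong refl) (auto simp only: * lessThan_iff)
  moreover have "(\<Sum>i<N. a i) + a N = a 0 + (\<Sum>i<N. a (Suc i))"
    by (simp only: sum.lessThan_Suc[symmetric] sum.lessThan_Suc_shift)
  moreover have "a N = h (X (-\<tau>)) (Y (-\<tau>))" "a 0 = h (X 0) (Y 0)"
    by (simp_all add: a_def Delta)
  ultimately show ?thesis
    by (simp add: window_def a_def)
qed

lemma window_nonneg: "(\<And>x y. 0 \<le> h x y) \<Longrightarrow> 0 \<le> window h X Y"
  unfolding window_def by (intro sum_nonneg) auto

lemma window_le:
  assumes "X \<in> bounded_segments R" "Y \<in> bounded_segments R"
    and "\<And>x y. norm x \<le> R \<Longrightarrow> norm y \<le> R \<Longrightarrow> h x y \<le> c"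
  shows "\<Delta> * window h X Y \<le> \<tau> * c"
proof -
  have "window h X Y \<le> (\<Sum>i<N. c)"
    unfolding window_def
    by (intro sum_mono assms(3) bounded_segments_D(5)[OF assms(1)] bounded_segments_D(5)[OF assms(2)]) auto
  then have "\<Delta> * window h X Y \<le> \<Delta> * (real N * c)"
    using Delta_pos by (intro mult_left_mono) auto
  also have "\<Delta> * (real N * c) = \<tau> * c"
    by (simp add: Delta[symmetric])
  finally show ?thesis .
qed

lemma measurable_node [measurable (raw)]:
  assumes "h \<in> L \<rightarrow>\<^sub>M (borel_segment \<tau> :: (real \<Rightarrow> real^'d) measure)" "i \<le> N"
  shows "(\<lambda>\<omega>. h \<omega> (- (real i * \<Delta>))) \<in> borel_measurable L"
  by (rule measurable_eval[OF assms(1) node_mem[OF assms(2)]])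

lemma measurable_eval_0 [measurable (raw)]:
  assumes "h \<in> L \<rightarrow>\<^sub>M (borel_segment \<tau> :: (real \<Rightarrow> real^'d) measure)"
  shows "(\<lambda>\<omega>. h \<omega> 0) \<in> borel_measurable L"
  using tau_pos by (intro measurable_eval[OF assms]) auto

lemma measurable_window:
  assumes "(\<lambda>p. h (fst p) (snd p)) \<in> borel_measurable borel"
    and [measurable]: "F \<in> L \<rightarrow>\<^sub>M borel_segment \<tau>" "G \<in> L \<rightarrow>\<^sub>M borel_segment \<tau>"
  shows "(\<lambda>\<omega>. window h (F \<omega>) (G \<omega>)) \<in> borel_measurable L"
  unfolding window_def
proof (rule borel_measurable_sum)
  fix i assume i: "i \<in> {..<N}"
  have "(\<lambda>\<omega>. (F \<omega> (- (real (Suc i) * \<Delta>)), G \<omega> (- (real (Suc i) * \<Delta>)))) \<in> borel_measurable L"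
    using i by (intro borel_measurable_Pair measurable_node assms) auto
  from measurable_compose[OF this assms(1)]
  show "(\<lambda>\<omega>. h (F \<omega> (- (real (Suc i) * \<Delta>))) (G \<omega> (- (real (Suc i) * \<Delta>)))) \<in> borel_measurable L"
    by simp
qed

end

lemma sum_delayed_le:
  fixes S :: "nat \<Rightarrow> ennreal"
  assumes "i < N"
  shows "(\<Sum>m\<in>{N..<n}. S (m - Suc i)) \<le> (\<Sum>m<n. S m)"
proof -
  have "inj_on (\<lambda>m. m - Suc i) {N..<n}"
    using assms by (auto simp: inj_on_def)
  then have "(\<Sum>m\<in>{N..<n}. S (m - Suc i)) = sum S ((\<lambda>m. m - Suc i) ` {N..<n})"
    by (simp add: sum.reindex)
  also have "\<dots> \<le> sum S {..<n}"
    using assms by (intro sum_mono2) auto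
  finally show ?thesis .
qed

text \<open>A supermartingale whose dissipation controls it up to a delay decays at least like \<open>1/n\<close>;
  this rate makes any exponential weighting superfluous.\<close>

lemma averaged_decay:
  fixes S D :: "nat \<Rightarrow> ennreal" and b c G :: ennreal
  assumes dissipation: "(\<Sum>m<n. c * S m) \<le> G"
    and antimono: "\<And>m. m \<le> n \<Longrightarrow> D n \<le> D m"
    and control: "\<And>m. N \<le> m \<Longrightarrow> D m \<le> S m + b * (\<Sum>i<N. S (m - Suc i))"
  shows "c * (of_nat (n - N) * D n) \<le> (1 + of_nat N * b) * G"
proof -
  let ?T = "\<Sum>m<n. S m"
  have "of_nat (n - N) * D n = (\<Sum>m\<in>{N..<n}. D n)"
    by simp
  also have "\<dots> \<le> (\<Sum>m\<in>{N..<n}. S m + b * (\<Sum>i<N. S (m - Suc i)))"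
    by (intro sum_mono order_trans[OF antimono control]) auto
  also have "\<dots> = (\<Sum>m\<in>{N..<n}. S m) + b * (\<Sum>i<N. \<Sum>m\<in>{N..<n}. S (m - Suc i))"
    by (simp add: sum.distrib sum_distrib_left) (rule disjI2, rule sum.swap)
  \<comment> \<open>For each delay the summation times stay distinct and below n, so every delayed
    sum is at most the full one; the N delays cost the factor 1 + N b, whatever n is.\<close>
  also have "\<dots> \<le> ?T + b * (\<Sum>i<N. ?T)"
    by (intro add_mono mult_left_mono sum_mono sum_delayed_le sum_mono2) auto
  also have "\<dots> = (1 + of_nat N * b) * ?T"
    by (simp add: algebra_simps)
  finally have "c * (of_nat (n - N) * D n) \<le> c * ((1 + of_nat N * b) * ?T)"
    by (rule mult_left_mono) simp
  also have "\<dots> = (1 + of_nat N * b) * (\<Sum>m<n. c * S m)"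
    by (simp add: sum_distrib_left mult.left_commute)
  also have "\<dots> \<le> (1 + of_nat N * b) * G"
    by (intro mult_left_mono dissipation) simp
  finally show ?thesis .
qed

lemma ennreal_le_plusI:
  "0 \<le> b \<Longrightarrow> 0 \<le> c \<Longrightarrow> a \<le> b + c \<Longrightarrow> ennreal a \<le> ennreal b + ennreal c"
  by (metis ennreal_leI ennreal_plus)

lemma ennreal_plus_leI:
  "0 \<le> a \<Longrightarrow> 0 \<le> b \<Longrightarrow> 0 \<le> c \<Longrightarrow> a + b + c \<le> d \<Longrightarrow> ennreal a + ennreal b + ennreal c \<le> ennreal d"
  by (metis add_nonneg_nonneg ennreal_leI ennreal_plus)

lemma norm_add_scaleR_sq:
  fixes u v :: "'a::real_inner"
  shows "(norm (u + c *\<^sub>R v))\<^sup>2 = (norm u)\<^sup>2 + c * (2 * (u \<bullet> v) + (norm v)\<^sup>2 * c)"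
  unfolding power2_norm_eq_inner
  by (simp add: inner_add_left inner_add_right inner_commute algebra_simps)

text \<open>P bounds the increments of f on the r-ball. The constants \<beta>, \<kappa> and
  \<open>Ch\<close> depend on P and \<Delta> only through the bound q for P^2 \<Delta>, so a q
  common to all steps makes them uniform.\<close>

locale em_contraction = em_map \<tau> \<gamma> \<Delta> f g r N l
  for \<tau> :: real and \<gamma> :: "(real^'m) measure" and \<Delta> :: real
    and f :: "(real^'d) \<times> (real^'d) \<Rightarrow> real^'d" and g :: "(real^'d) \<times> (real^'d) \<Rightarrow> real^'m^'d"
    and r :: real and N :: nat and l :: real +
  fixes V :: "(real^'d) \<times> (real^'d) \<Rightarrow> real" and b1 b2 b3 b4 P q :: real
  assumes V_meas [measurable]: "V \<in> borel_measurable borel"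
    and V_nonneg: "\<And>p. 0 \<le> V p"
    and b_nonneg: "0 \<le> b2" "0 \<le> b4"
    and contraction:
      "\<And>x x' y y'.
         2 * ((x - x') \<bullet> (f (x, y) - f (x', y'))) + (norm (g (x, y) - g (x', y')))\<^sup>2
           \<le> - b1 * (norm (x - x'))\<^sup>2 + b2 * (norm (y - y'))\<^sup>2 - b3 * V (x, x') + b4 * V (y, y')"
    and f_growth: "\<And>x y x' y'. norm x \<le> r \<Longrightarrow> norm y \<le> r \<Longrightarrow> norm x' \<le> r \<Longrightarrow> norm y' \<le> r \<Longrightarrow>
        norm (f (x, y) - f (x', y')) \<le> P * (norm (x - x') + min 1 (norm (y - y')))"
    and P_nonneg: "0 \<le> P" and P_q: "P\<^sup>2 * \<Delta> \<le> q"
    and gap: "b2 + 2 * q < b1 - 2 * q" "b4 < b3"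
begin

text \<open>The weight of the delayed |D|^2: b2 from the hypothesis and 2q from the squared drift,
  so that the term leaving the window cancels both. \<kappa> is what the two gaps leave over for
  dissipation.\<close>

definition "\<beta> = b2 + 2 * q"
definition "\<kappa> = min (b1 - 2 * q - \<beta>) (b3 - b4)"
definition "h x y = \<beta> * (norm (x - y))\<^sup>2 + b4 * V (x, y)"
definition "s x y = (norm (x - y))\<^sup>2 + V (x, y)"
definition "U X Y = (norm (X 0 - Y 0))\<^sup>2 + \<Delta> * window h X Y"

lemma q_nonneg: "0 \<le> q"
  using P_q Delta_pos by (meson mult_nonneg_nonneg order_trans zero_le_power2 less_imp_le)

lemma beta_nonneg: "0 \<le> \<beta>"
  using q_nonneg b_nonneg by (simp add: \<beta>_def)

lemma kappa_pos: "0 < \<kappa>"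
  using gap by (simp add: \<kappa>_def \<beta>_def)

lemma h_nonneg: "0 \<le> h x y"
  using beta_nonneg b_nonneg V_nonneg by (simp add: h_def)

lemma s_nonneg: "0 \<le> s x y"
  using V_nonneg by (simp add: s_def)

lemma h_le_s: "h x y \<le> max \<beta> b4 * s x y"
  unfolding h_def s_def distrib_left using V_nonneg
  by (intro add_mono mult_right_mono) auto

lemma U_nonneg: "0 \<le> U X Y"
  unfolding U_def using Delta_pos window_nonneg[OF h_nonneg] by simp

lemma measurable_h: "(\<lambda>p. h (fst p) (snd p)) \<in> borel_measurable borel"
proof -
  have [measurable]: "fst \<in> borel_measurable borel" "snd \<in> borel_measurable borel"
    by (intro borel_measurable_continuous_onI continuous_intros)+
  show ?thesis
    unfolding h_def prod.collapse by measurable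
qed

lemma measurable_U [measurable (raw)]:
  assumes [measurable]: "F \<in> L \<rightarrow>\<^sub>M borel_segment \<tau>" "G \<in> L \<rightarrow>\<^sub>M borel_segment \<tau>"
  shows "(\<lambda>\<omega>. U (F \<omega>) (G \<omega>)) \<in> borel_measurable L"
  unfolding U_def using measurable_window[OF measurable_h assms] by measurable

lemma measurable_s [measurable (raw)]:
  assumes [measurable]: "F \<in> borel_measurable L" "G \<in> borel_measurable L"
  shows "(\<lambda>\<omega>. s (F \<omega>) (G \<omega>)) \<in> borel_measurable L"
proof -
  have "(\<lambda>\<omega>. V (F \<omega>, G \<omega>)) \<in> borel_measurable L"
    by (rule measurable_compose[OF borel_measurable_Pair[OF assms] V_meas])
  then show ?thesis unfolding s_def by measurable
qed

text \<open>Projection does not enlarge the difference, and the noise contributes \<Delta> |G|^2 in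
  the mean. The contraction hypothesis then covers everything except \<Delta>^2 |F|^2, and the
  delayed terms are absorbed by the term leaving the window.\<close>

lemma one_step_contraction:
  assumes X: "X \<in> bounded_segments r" and Y: "Y \<in> bounded_segments r"
  shows "(\<integral>\<^sup>+z. ennreal (U (step X z) (step Y z)) \<partial>\<gamma>) + ennreal (\<Delta> * \<kappa> * s (X 0) (Y 0)) \<le> ennreal (U X Y)"
proof -
  let ?D = "X 0 - Y 0" and ?D\<tau> = "X (-\<tau>) - Y (-\<tau>)"
  let ?F = "f (X 0, X (-\<tau>)) - f (Y 0, Y (-\<tau>))" and ?G = "g (X 0, X (-\<tau>)) - g (Y 0, Y (-\<tau>))"
  define W where "W = window h X Y + h (X 0) (Y 0) - h (X (-\<tau>)) (Y (-\<tau>))"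
  have W: "window h (step X z) (step Y z) = W" for z
    by (simp add: window_step W_def)
  \<comment> \<open>\<open>W\<close> is written with a subtraction; it is nonnegative because it is
    the window of a stepped pair, here with noise 0.\<close>
  have W0: "0 \<le> W" using window_nonneg[of h "step X 0" "step Y 0"] h_nonneg by (simp add: W)
  have p1: "(\<integral>\<^sup>+z. ennreal (U (step X z) (step Y z)) \<partial>\<gamma>)
      \<le> (\<integral>\<^sup>+z. ennreal ((norm (?D + \<Delta> *\<^sub>R ?F + ?G *v z))\<^sup>2) + ennreal (\<Delta> * W) \<partial>\<gamma>)"
  proof (intro nn_integral_mono)
    fix z
    have "U (step X z) (step Y z) \<le> (norm (?D + \<Delta> *\<^sub>R ?F + ?G *v z))\<^sup>2 + \<Delta> * W"
      unfolding U_def W step_0 by (intro add_right_mono power_mono norm_next_node_diff_le norm_ge_zero)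
    then show "ennreal (U (step X z) (step Y z)) \<le> ennreal ((norm (?D + \<Delta> *\<^sub>R ?F + ?G *v z))\<^sup>2) + ennreal (\<Delta> * W)"
      using W0 Delta_pos by (intro ennreal_le_plusI) auto
  qed
  have p2: "(\<integral>\<^sup>+z. ennreal ((norm (?D + \<Delta> *\<^sub>R ?F + ?G *v z))\<^sup>2) + ennreal (\<Delta> * W) \<partial>\<gamma>)
      = ennreal ((norm (?D + \<Delta> *\<^sub>R ?F))\<^sup>2 + \<Delta> * (norm ?G)\<^sup>2) + ennreal (\<Delta> * W)"
    by (rule nn_integral_norm_affine_sq_add[OF less_imp_le[OF Delta_pos]])
  have p3: "ennreal ((norm (?D + \<Delta> *\<^sub>R ?F))\<^sup>2 + \<Delta> * (norm ?G)\<^sup>2) + ennreal (\<Delta> * W) + ennreal (\<Delta> * \<kappa> * s (X 0) (Y 0))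
      \<le> ennreal (U X Y)"
  proof -
    \<comment> \<open>The minimum with 1 is relaxed to the full delayed distance, and (u + v)^2
      \<le> 2 u^2 + 2 v^2 places 2q on the present and 2q on the delayed difference.\<close>
    have nF: "(norm ?F)\<^sup>2 * \<Delta> \<le> q * (2 * (norm ?D)\<^sup>2 + 2 * (norm ?D\<tau>)\<^sup>2)"
    proof -
      have "norm ?F \<le> P * (norm ?D + min 1 (norm ?D\<tau>))"
        by (intro f_growth bounded_segments_D(3,4)[OF X] bounded_segments_D(3,4)[OF Y])
      also have "\<dots> \<le> P * (norm ?D + norm ?D\<tau>)"
        by (intro mult_left_mono P_nonneg) auto
      finally have "(norm ?F)\<^sup>2 \<le> P\<^sup>2 * (norm ?D + norm ?D\<tau>)\<^sup>2"
        by (subst power_mult_distrib[symmetric]) (intro power_mono norm_ge_zero)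
      also have "(norm ?D + norm ?D\<tau>)\<^sup>2 \<le> 2 * (norm ?D)\<^sup>2 + 2 * (norm ?D\<tau>)\<^sup>2"
        using sum_squares_bound[of "norm ?D" "norm ?D\<tau>"] by (simp add: power2_sum)
      finally have "(norm ?F)\<^sup>2 * \<Delta> \<le> (P\<^sup>2 * \<Delta>) * (2 * (norm ?D)\<^sup>2 + 2 * (norm ?D\<tau>)\<^sup>2)"
        using Delta_pos by (simp add: mult_right_mono mult.commute mult.left_commute)
      also have "\<dots> \<le> q * (2 * (norm ?D)\<^sup>2 + 2 * (norm ?D\<tau>)\<^sup>2)"
        by (intro mult_right_mono P_q) auto
      finally show ?thesis .
    qed
    have a: "(norm (?D + \<Delta> *\<^sub>R ?F))\<^sup>2 = (norm ?D)\<^sup>2 + \<Delta> * (2 * (?D \<bullet> ?F) + (norm ?F)\<^sup>2 * \<Delta>)"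
      by (rule norm_add_scaleR_sq)
    have k: "\<kappa> * s (X 0) (Y 0) \<le> (b1 - 2 * q - \<beta>) * (norm ?D)\<^sup>2 + (b3 - b4) * V (X 0, Y 0)"
      unfolding s_def distrib_left \<kappa>_def using V_nonneg
      by (intro add_mono mult_right_mono) auto
    have "2 * (?D \<bullet> ?F) + (norm ?F)\<^sup>2 * \<Delta> + (norm ?G)\<^sup>2 + h (X 0) (Y 0) - h (X (-\<tau>)) (Y (-\<tau>)) + \<kappa> * s (X 0) (Y 0) \<le> 0"
      using contraction[of "X 0" "Y 0" "X (-\<tau>)" "Y (-\<tau>)"] nF k
      unfolding h_def \<beta>_def by (simp add: algebra_simps)
    then have "\<Delta> * (2 * (?D \<bullet> ?F) + (norm ?F)\<^sup>2 * \<Delta> + (norm ?G)\<^sup>2 + h (X 0) (Y 0) - h (X (-\<tau>)) (Y (-\<tau>)) + \<kappa> * s (X 0) (Y 0)) \<le> 0"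
      using Delta_pos by (simp add: mult_nonneg_nonpos)
    then have "((norm (?D + \<Delta> *\<^sub>R ?F))\<^sup>2 + \<Delta> * (norm ?G)\<^sup>2) + \<Delta> * W + \<Delta> * \<kappa> * s (X 0) (Y 0) \<le> U X Y"
      unfolding a U_def W_def by (simp add: algebra_simps)
    then show ?thesis
      using W0 Delta_pos kappa_pos s_nonneg[of "X 0" "Y 0"]
      by (intro ennreal_plus_leI) auto
  qed
  show ?thesis
    by (rule order_trans[OF add_right_mono[OF p1[unfolded p2]] p3])
qed

end

section \<open>Coalescence, uniformly in the step size\<close>

lemma ennreal_le_divideI:
  assumes "0 < k" "ennreal k * D \<le> ennreal v"
  shows "D \<le> ennreal (v / k)"
proof -
  have "D = ennreal (1 / k) * (ennreal k * D)"
    using assms(1) by (simp add: mult.assoc[symmetric] ennreal_mult'[symmetric])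
  also have "\<dots> \<le> ennreal (1 / k) * ennreal v"
    by (intro mult_left_mono assms(2)) simp
  also have "\<dots> = ennreal (v / k)"
    using assms(1) by (simp add: ennreal_mult'[symmetric])
  finally show ?thesis .
qed

context em_contraction begin

interpretation pair: random_map \<gamma> "borel_segment \<tau> \<Otimes>\<^sub>M borel_segment \<tau>" "pair_map step"
  by (rule random_map_pair)

definition "U_pair p = ennreal (U (fst p) (snd p))"
definition "s_pair p = ennreal (s (fst p 0) (snd p 0))"
definition "r_pairs = bounded_segments r \<times> bounded_segments r"
definition "Ch = max \<beta> b4"

lemma Ch_nonneg: "0 \<le> Ch"
  using b_nonneg by (simp add: Ch_def)

lemma measurable_U_pair [measurable]: "U_pair \<in> borel_measurable (borel_segment \<tau> \<Otimes>\<^sub>M borel_segment \<tau>)"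
  unfolding U_pair_def by measurable

lemma measurable_s_pair [measurable]: "s_pair \<in> borel_measurable (borel_segment \<tau> \<Otimes>\<^sub>M borel_segment \<tau>)"
  unfolding s_pair_def by measurable

lemma r_pairs_subset: "r_pairs \<subseteq> space (borel_segment \<tau> \<Otimes>\<^sub>M borel_segment \<tau>)"
  by (auto simp: r_pairs_def space_pair_measure dest: bounded_segments_D(1))

lemma r_pairs_invariant: "p \<in> r_pairs \<Longrightarrow> z \<in> space \<gamma> \<Longrightarrow> pair_map step p z \<in> r_pairs"
  by (auto simp: r_pairs_def pair_map_def step_bounded)

lemma one_step_pair:
  "p \<in> r_pairs \<Longrightarrow> (\<integral>\<^sup>+z. U_pair (pair_map step p z) \<partial>\<gamma>) + ennreal (\<Delta> * \<kappa>) * s_pair p \<le> U_pair p"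
  using one_step_contraction[of "fst p" "snd p"] Delta_pos kappa_pos s_nonneg
  by (auto simp: r_pairs_def U_pair_def s_pair_def pair_map_def ennreal_mult'[symmetric])

lemma pair_dissipation:
  assumes "p \<in> r_pairs"
  shows "(\<Sum>m<n. ennreal (\<Delta> * \<kappa>) * pair.expect m s_pair p) + pair.expect n U_pair p \<le> U_pair p"
proof -
  have p: "p \<in> space (borel_segment \<tau> \<Otimes>\<^sub>M borel_segment \<tau>)"
    using assms r_pairs_subset by blast
  have "pair.expect m (\<lambda>p. ennreal (\<Delta> * \<kappa>) * s_pair p) p = ennreal (\<Delta> * \<kappa>) * pair.expect m s_pair p" for m
    unfolding pair.expect_def
  proof (rule nn_integral_cmult)
    have "(\<lambda>\<omega>. pair.iter m p \<omega>) \<in> stream_space \<gamma> \<rightarrow>\<^sub>M borel_segment \<tau> \<Otimes>\<^sub>M borel_segment \<tau>"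
      using p by (intro pair.measurable_iter) auto
    then show "(\<lambda>\<omega>. s_pair (pair.iter m p \<omega>)) \<in> borel_measurable (stream_space \<gamma>)"
      by (rule measurable_compose) measurable
  qed
  then show ?thesis
    using pair.expect_dissipation[of U_pair "\<lambda>p. ennreal (\<Delta> * \<kappa>) * s_pair p" r_pairs p n,
        OF _ _ r_pairs_subset r_pairs_invariant one_step_pair assms]
    by simp
qed

lemma pair_antimono:
  assumes "p \<in> r_pairs" "m \<le> n"
  shows "pair.expect n U_pair p \<le> pair.expect m U_pair p"
proof -
  have p: "p \<in> space (borel_segment \<tau> \<Otimes>\<^sub>M borel_segment \<tau>)"
    using assms r_pairs_subset by blast
  have "pair.expect n U_pair p = pair.expect m (pair.expect (n - m) U_pair) p"
    using pair.expect_add[OF measurable_U_pair p, of m "n - m"] assms(2) by simp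
  also have "\<dots> \<le> pair.expect m U_pair p"
  proof (rule pair.expect_mono)
    fix \<omega> assume \<omega>: "\<omega> \<in> space (stream_space \<gamma>)"
    have "pair.iter m p \<omega> \<in> r_pairs"
      by (rule pair.iter_invariant[OF assms(1) r_pairs_invariant \<omega>])
    from pair_dissipation[OF this, of "n - m"]
    show "pair.expect (n - m) U_pair (pair.iter m p \<omega>) \<le> U_pair (pair.iter m p \<omega>)"
      by (rule order_trans[rotated]) simp
  qed
  finally show ?thesis .
qed

text \<open>From time N on, every window entry is the present value of an earlier iterate, hence
  \<open>h\<close> there is at most \<open>Ch\<close> times the dissipation density \<open>s\<close>
  at that earlier time.\<close>

lemma pair_control:
  assumes "p \<in> r_pairs" "N \<le> m"
  shows "pair.expect m U_pair p \<le> pair.expect m s_pair p + ennreal (\<Delta> * Ch) * (\<Sum>i<N. pair.expect (m - Suc i) s_pair p)"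
proof -
  obtain X Y where p: "p = (X, Y)" and X: "X \<in> bounded_segments r" and Y: "Y \<in> bounded_segments r"
    using assms by (auto simp: r_pairs_def)
  define e where "e j \<omega> = ennreal (s (iter j X \<omega> 0) (iter j Y \<omega> 0))" for j \<omega>
  have e_meas [measurable]: "e j \<in> borel_measurable (stream_space \<gamma>)" for j
    unfolding e_def using bounded_segments_D(1)[OF X] bounded_segments_D(1)[OF Y]
    by (intro measurable_compose[OF _ measurable_ennreal] measurable_s measurable_eval_0 measurable_iter) auto
  have e_int: "pair.expect j s_pair p = (\<integral>\<^sup>+\<omega>. e j \<omega> \<partial>stream_space \<gamma>)" for j
    unfolding pair.expect_def p iter_pair s_pair_def e_def by simp
  have "pair.expect m U_pair p \<le> (\<integral>\<^sup>+\<omega>. e m \<omega> + ennreal (\<Delta> * Ch) * (\<Sum>i<N. e (m - Suc i) \<omega>) \<partial>stream_space \<gamma>)"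
    unfolding pair.expect_def p iter_pair U_pair_def
  proof (intro nn_integral_mono)
    fix \<omega> assume "\<omega> \<in> space (stream_space \<gamma>)"
    let ?S = "\<lambda>j. s (iter j X \<omega> 0) (iter j Y \<omega> 0)"
    have "window h (iter m X \<omega>) (iter m Y \<omega>) \<le> (\<Sum>i<N. Ch * ?S (m - Suc i))"
      unfolding window_def
    proof (rule sum_mono)
      fix i assume "i \<in> {..<N}"
      then have "Suc i \<le> N" "Suc i \<le> m" using assms(2) by auto
      then show "h (iter m X \<omega> (- (real (Suc i) * \<Delta>))) (iter m Y \<omega> (- (real (Suc i) * \<Delta>))) \<le> Ch * ?S (m - Suc i)"
        using h_le_s by (simp only: iter_node Ch_def)
    qed
    then have w: "\<Delta> * window h (iter m X \<omega>) (iter m Y \<omega>) \<le> (\<Delta> * Ch) * (\<Sum>i<N. ?S (m - Suc i))"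
      using Delta_pos by (simp add: sum_distrib_left[symmetric] mult.assoc)
    have "(norm (iter m X \<omega> 0 - iter m Y \<omega> 0))\<^sup>2 \<le> ?S m"
      using V_nonneg by (simp add: s_def)
    with w have "U (iter m X \<omega>) (iter m Y \<omega>) \<le> ?S m + (\<Delta> * Ch) * (\<Sum>i<N. ?S (m - Suc i))"
      unfolding U_def by linarith
    then have "ennreal (U (iter m X \<omega>) (iter m Y \<omega>)) \<le> ennreal (?S m) + ennreal ((\<Delta> * Ch) * (\<Sum>i<N. ?S (m - Suc i)))"
      using s_nonneg Ch_nonneg Delta_pos by (intro ennreal_le_plusI mult_nonneg_nonneg sum_nonneg) auto
    also have "ennreal ((\<Delta> * Ch) * (\<Sum>i<N. ?S (m - Suc i))) = ennreal (\<Delta> * Ch) * (\<Sum>i<N. ennreal (?S (m - Suc i)))"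
      using s_nonneg Ch_nonneg Delta_pos by (subst sum_ennreal) (auto simp: ennreal_mult sum_nonneg)
    finally show "ennreal (U (fst (iter m X \<omega>, iter m Y \<omega>)) (snd (iter m X \<omega>, iter m Y \<omega>)))
        \<le> e m \<omega> + ennreal (\<Delta> * Ch) * (\<Sum>i<N. e (m - Suc i) \<omega>)"
      by (simp add: e_def)
  qed
  moreover have "(\<integral>\<^sup>+\<omega>. e m \<omega> + ennreal (\<Delta> * Ch) * (\<Sum>i<N. e (m - Suc i) \<omega>) \<partial>stream_space \<gamma>)
      = (\<integral>\<^sup>+\<omega>. e m \<omega> \<partial>stream_space \<gamma>) + ennreal (\<Delta> * Ch) * (\<Sum>i<N. \<integral>\<^sup>+\<omega>. e (m - Suc i) \<omega> \<partial>stream_space \<gamma>)"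
    by (simp add: nn_integral_add nn_integral_cmult nn_integral_sum)
  ultimately show ?thesis
    by (simp only: e_int)
qed

text \<open>The delays cost 1 + N \<Delta> \<open>Ch\<close> = 1 + \<tau> \<open>Ch\<close>, and the
  left side contains \<Delta> (n - N). Only elapsed time appears, not the number of steps, which is
  what makes the rate uniform in \<Delta>.\<close>

lemma U_decay:
  assumes p: "p \<in> r_pairs"
  shows "ennreal (\<Delta> * \<kappa>) * (of_nat (n - N) * pair.expect n U_pair p) \<le> ennreal (1 + \<tau> * Ch) * U_pair p"
proof -
  have "ennreal (\<Delta> * \<kappa>) * (of_nat (n - N) * pair.expect n U_pair p) \<le> (1 + of_nat N * ennreal (\<Delta> * Ch)) * U_pair p"
  proof (rule averaged_decay[where S="\<lambda>m. pair.expect m s_pair p"])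
    show "(\<Sum>m<n. ennreal (\<Delta> * \<kappa>) * pair.expect m s_pair p) \<le> U_pair p"
      using pair_dissipation[OF p, of n] by (rule order_trans[rotated]) simp
  qed (use pair_antimono[OF p] pair_control[OF p] in auto)
  moreover have "1 + of_nat N * ennreal (\<Delta> * Ch) = ennreal (1 + \<tau> * Ch)"
    using Ch_nonneg Delta_pos tau_pos
    by (simp add: Delta[symmetric] ennreal_of_nat_eq_real_of_nat ennreal_mult[symmetric] mult.assoc)
  ultimately show ?thesis by simp
qed

text \<open>Either U stays below c^2 during N steps, and then all nodes and hence the final segments
  are within c; or U reaches c^2, and by the maximal inequality c^2 times that probability is at
  most the initial U.\<close>

lemma coalescence_bound:
  assumes X: "X \<in> bounded_segments r" and Y: "Y \<in> bounded_segments r" and c: "0 < c"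
  shows "ennreal (c\<^sup>2) * (\<integral>\<^sup>+\<omega>. ennreal (min 1 (mdist (segment_space \<tau>) (iter N X \<omega>) (iter N Y \<omega>))) \<partial>stream_space \<gamma>)
    \<le> ennreal (c ^ 3) + U_pair (X, Y)"
proof -
  note XC = bounded_segments_D(1)[OF X] and YC = bounded_segments_D(1)[OF Y]
  let ?B = "\<lambda>\<omega>. if \<exists>j\<le>N. ennreal (c\<^sup>2) \<le> U_pair (pair.iter j (X, Y) \<omega>) then ennreal (c\<^sup>2) else 0"
  let ?d = "\<lambda>\<omega>. mdist (segment_space \<tau>) (iter N X \<omega>) (iter N Y \<omega>)"
  have [measurable]: "(\<lambda>\<omega>. pair.iter j (X, Y) \<omega>) \<in> stream_space \<gamma> \<rightarrow>\<^sub>M borel_segment \<tau> \<Otimes>\<^sub>M borel_segment \<tau>" for j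
    using XC YC by (intro pair.measurable_iter) (auto simp: space_pair_measure)
  have [measurable]: "iter N X \<in> stream_space \<gamma> \<rightarrow>\<^sub>M borel_segment \<tau>" "iter N Y \<in> stream_space \<gamma> \<rightarrow>\<^sub>M borel_segment \<tau>"
    using XC YC by (intro measurable_iter; simp)+
  have p1: "ennreal (c\<^sup>2) * (\<integral>\<^sup>+\<omega>. ennreal (min 1 (?d \<omega>)) \<partial>stream_space \<gamma>) = (\<integral>\<^sup>+\<omega>. ennreal (c\<^sup>2) * ennreal (min 1 (?d \<omega>)) \<partial>stream_space \<gamma>)"
    by (rule nn_integral_cmult[symmetric]) measurable
  have p2: "(\<integral>\<^sup>+\<omega>. ennreal (c\<^sup>2) * ennreal (min 1 (?d \<omega>)) \<partial>stream_space \<gamma>) \<le> (\<integral>\<^sup>+\<omega>. ennreal (c ^ 3) + ?B \<omega> \<partial>stream_space \<gamma>)"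
  proof (rule nn_integral_mono)
    fix \<omega> assume \<omega>: "\<omega> \<in> space (stream_space \<gamma>)"
    show "ennreal (c\<^sup>2) * ennreal (min 1 (?d \<omega>)) \<le> ennreal (c ^ 3) + ?B \<omega>"
    proof (cases "\<exists>j\<le>N. ennreal (c\<^sup>2) \<le> U_pair (pair.iter j (X, Y) \<omega>)")
      case True
      have "ennreal (c\<^sup>2) * ennreal (min 1 (?d \<omega>)) \<le> ennreal (c\<^sup>2) * ennreal 1"
        by (intro mult_left_mono ennreal_leI) auto
      also have "\<dots> \<le> ennreal (c ^ 3) + ?B \<omega>"
        using True by (simp add: add_increasing)
      finally show ?thesis .
    next
      case False
      have "norm (iter j X \<omega> 0 - iter j Y \<omega> 0) \<le> c" if "j \<le> N" for j
      proof -
        have "\<not> ennreal (c\<^sup>2) \<le> ennreal (U (iter j X \<omega>) (iter j Y \<omega>))"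
          using False that by (simp add: U_pair_def iter_pair)
        then have "U (iter j X \<omega>) (iter j Y \<omega>) \<le> c\<^sup>2"
          by (meson ennreal_leI linear)
        moreover have "0 \<le> \<Delta> * window h (iter j X \<omega>) (iter j Y \<omega>)"
          using Delta_pos window_nonneg[of h] h_nonneg by simp
        ultimately have "(norm (iter j X \<omega> 0 - iter j Y \<omega> 0))\<^sup>2 \<le> c\<^sup>2"
          unfolding U_def by linarith
        then show ?thesis
          using c by (simp add: power2_le_iff_abs_le)
      qed
      then have "?d \<omega> \<le> c"
        by (rule mdist_iter_le[OF XC YC _ \<omega>])
      then have "ennreal (c\<^sup>2) * ennreal (min 1 (?d \<omega>)) \<le> ennreal (c\<^sup>2) * ennreal c"
        by (intro mult_left_mono ennreal_leI) auto
      also have "\<dots> = ennreal (c ^ 3)"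
        using c by (simp add: ennreal_mult[symmetric] power2_eq_square power3_eq_cube)
      finally show ?thesis
        by (simp add: add_increasing2)
    qed
  qed
  have p3: "(\<integral>\<^sup>+\<omega>. ennreal (c ^ 3) + ?B \<omega> \<partial>stream_space \<gamma>) = ennreal (c ^ 3) + (\<integral>\<^sup>+\<omega>. ?B \<omega> \<partial>stream_space \<gamma>)"
    by (subst nn_integral_add) (auto simp: stream.emeasure_space_1)
  have p4: "(\<integral>\<^sup>+\<omega>. ?B \<omega> \<partial>stream_space \<gamma>) \<le> U_pair (X, Y) + of_nat N * 0"
  proof (rule pair.maximal_inequality[OF measurable_U_pair r_pairs_subset r_pairs_invariant])
    show "(X, Y) \<in> r_pairs" using X Y by (simp add: r_pairs_def)
    show "(\<integral>\<^sup>+z. U_pair (pair_map step p z) \<partial>\<gamma>) \<le> U_pair p + 0" if "p \<in> r_pairs" for p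
      using one_step_pair[OF that] by (simp add: add_increasing2 order_trans[rotated])
  qed
  then have p5: "ennreal (c ^ 3) + (\<integral>\<^sup>+\<omega>. ?B \<omega> \<partial>stream_space \<gamma>) \<le> ennreal (c ^ 3) + U_pair (X, Y)"
    by (intro add_left_mono) simp
  show ?thesis
    unfolding p1 by (rule order_trans[OF p2 p5[folded p3]])
qed

text \<open>The first n steps make U small in the mean; N further steps convert this into closeness
  of whole segments. The level c stays free: it is a multiple of the target accuracy in the uniform
  estimate and decreases with n at a fixed step size.\<close>

theorem uniform_coalescence:
  assumes X: "X \<in> bounded_segments r" and Y: "Y \<in> bounded_segments r"
    and u: "U X Y \<le> u" and c: "0 < c" and n: "N < n"
  shows "(\<integral>\<^sup>+\<omega>. ennreal (min 1 (mdist (segment_space \<tau>) (iter (n + N) X \<omega>) (iter (n + N) Y \<omega>))) \<partial>stream_space \<gamma>)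
    \<le> ennreal (c + (1 + \<tau> * Ch) * u / (\<kappa> * (real (n - N) * \<Delta>) * c\<^sup>2))"
proof -
  note XC = bounded_segments_D(1)[OF X] and YC = bounded_segments_D(1)[OF Y]
  let ?\<phi> = "\<lambda>p :: (real \<Rightarrow> real^'d) \<times> (real \<Rightarrow> real^'d). ennreal (min 1 (mdist (segment_space \<tau>) (fst p) (snd p)))"
  have p: "(X, Y) \<in> r_pairs" using X Y by (simp add: r_pairs_def)
  then have sp: "(X, Y) \<in> space (borel_segment \<tau> \<Otimes>\<^sub>M borel_segment \<tau>)" using r_pairs_subset by blast
  have \<phi> [measurable]: "?\<phi> \<in> borel_measurable (borel_segment \<tau> \<Otimes>\<^sub>M borel_segment \<tau>)" by measurable
  define E where "E = pair.expect (n + N) ?\<phi> (X, Y)"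
  define D where "D = pair.expect n U_pair (X, Y)"
  have [measurable]: "(\<lambda>\<omega>. pair.iter j (X, Y) \<omega>) \<in> stream_space \<gamma> \<rightarrow>\<^sub>M borel_segment \<tau> \<Otimes>\<^sub>M borel_segment \<tau>" for j
    using sp by (intro pair.measurable_iter) auto
  have u0: "0 \<le> u" using u U_nonneg[of X Y] by linarith
  have "ennreal (c\<^sup>2) * E = pair.expect n (\<lambda>q. ennreal (c\<^sup>2) * pair.expect N ?\<phi> q) (X, Y)"
    unfolding E_def pair.expect_add[OF \<phi> sp] pair.expect_def[of n]
    by (rule nn_integral_cmult[symmetric], rule measurable_compose[OF _ pair.measurable_expect[OF \<phi>]]) measurable
  also have "\<dots> \<le> pair.expect n (\<lambda>q. ennreal (c ^ 3) + U_pair q) (X, Y)"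
  proof (rule pair.expect_mono)
    fix \<omega> assume \<omega>: "\<omega> \<in> space (stream_space \<gamma>)"
    have "pair.iter n (X, Y) \<omega> \<in> r_pairs"
      by (rule pair.iter_invariant[OF p r_pairs_invariant \<omega>])
    then obtain X' Y' where *: "pair.iter n (X, Y) \<omega> = (X', Y')" "X' \<in> bounded_segments r" "Y' \<in> bounded_segments r"
      by (auto simp: r_pairs_def)
    show "ennreal (c\<^sup>2) * pair.expect N ?\<phi> (pair.iter n (X, Y) \<omega>) \<le> ennreal (c ^ 3) + U_pair (pair.iter n (X, Y) \<omega>)"
      using coalescence_bound[OF *(2,3) c] by (simp only: *(1)) (simp add: pair.expect_def iter_pair)
  qed
  also have "\<dots> = ennreal (c ^ 3) + D"
    unfolding pair.expect_def D_def
    by (subst nn_integral_add) (auto simp: stream.emeasure_space_1)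
  finally have 1: "ennreal (c\<^sup>2) * E \<le> ennreal (c ^ 3) + D" .
  have "ennreal (\<Delta> * \<kappa>) * (of_nat (n - N) * D) \<le> ennreal (1 + \<tau> * Ch) * U_pair (X, Y)"
    unfolding D_def by (rule U_decay[OF p])
  also have "\<dots> \<le> ennreal (1 + \<tau> * Ch) * ennreal u"
    unfolding U_pair_def using u by (intro mult_left_mono ennreal_leI) auto
  finally have 2: "ennreal (\<Delta> * \<kappa>) * (of_nat (n - N) * D) \<le> ennreal ((1 + \<tau> * Ch) * u)"
    using u0 Ch_nonneg tau_pos by (simp add: ennreal_mult)
  define k where "k = \<Delta> * \<kappa> * real (n - N)"
  have k: "0 < k" using Delta_pos kappa_pos n by (simp add: k_def)
  have "ennreal k * D \<le> ennreal ((1 + \<tau> * Ch) * u)"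
    using 2 Delta_pos kappa_pos
    by (simp add: k_def ennreal_mult ennreal_of_nat_eq_real_of_nat mult.assoc)
  then have "D \<le> ennreal ((1 + \<tau> * Ch) * u / k)"
    by (rule ennreal_le_divideI[OF k])
  then have "ennreal (c\<^sup>2) * E \<le> ennreal (c ^ 3) + ennreal ((1 + \<tau> * Ch) * u / k)"
    using 1 by (meson add_left_mono order_trans)
  then have "ennreal (c\<^sup>2) * E \<le> ennreal (c ^ 3 + (1 + \<tau> * Ch) * u / k)"
    using c u0 k Ch_nonneg tau_pos by simp
  then have "E \<le> ennreal ((c ^ 3 + (1 + \<tau> * Ch) * u / k) / c\<^sup>2)"
    using c by (intro ennreal_le_divideI) auto
  also have "(c ^ 3 + (1 + \<tau> * Ch) * u / k) / c\<^sup>2 = c + (1 + \<tau> * Ch) * u / (\<kappa> * (real (n - N) * \<Delta>) * c\<^sup>2)"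
  proof -
    have "\<kappa> * (real (n - N) * \<Delta>) = k"
      by (simp only: k_def mult_ac)
    moreover have "c ^ 3 / c\<^sup>2 = c"
      using c by (simp add: power2_eq_square power3_eq_cube)
    ultimately show ?thesis
      by (simp only: add_divide_distrib divide_divide_eq_left)
  qed
  finally show ?thesis
    unfolding E_def pair.expect_def iter_pair by simp
qed

text \<open>The N window terms weighted by \<Delta> amount to \<tau>, so the bound depends on the
  ball and not on the step. The bound v for V has to be supplied because V satisfies no growth
  condition.\<close>

lemma U_le:
  assumes X: "X \<in> bounded_segments R" and Y: "Y \<in> bounded_segments R"
    and v: "\<And>x y. norm x \<le> R \<Longrightarrow> norm y \<le> R \<Longrightarrow> V (x, y) \<le> v"
  shows "U X Y \<le> 4 * R\<^sup>2 + \<tau> * (\<beta> * (4 * R\<^sup>2) + b4 * v)"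
proof -
  have n: "(norm (x - y))\<^sup>2 \<le> 4 * R\<^sup>2" if "norm x \<le> R" "norm y \<le> R" for x y :: "real^'d"
  proof -
    have "norm (x - y) \<le> 2 * R" using that norm_triangle_ineq4[of x y] by linarith
    from power_mono[OF this norm_ge_zero, of 2] show ?thesis by (simp add: power_mult_distrib)
  qed
  have "h x y \<le> \<beta> * (4 * R\<^sup>2) + b4 * v" if "norm x \<le> R" "norm y \<le> R" for x y
    unfolding h_def using n[OF that] v[OF that] beta_nonneg b_nonneg by (intro add_mono mult_left_mono) auto
  from window_le[OF X Y, of h, OF this] show ?thesis
    unfolding U_def using n[OF bounded_segments_D(3)[OF X] bounded_segments_D(3)[OF Y]] by linarith
qed

end

section \<open>Transition laws in the Fortet-Mourier distance\<close>

lemma (in prob_space) abs_expectation_diff_le: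
  fixes \<phi> :: "'a \<Rightarrow> real"
  assumes [measurable]: "\<phi> \<in> borel_measurable M" "B \<in> sets M"
    and bound: "\<And>x. x \<in> space M \<Longrightarrow> \<bar>\<phi> x\<bar> \<le> 1" "\<bar>c\<bar> \<le> 1"
    and close: "\<And>x. x \<in> B \<Longrightarrow> \<bar>\<phi> x - c\<bar> \<le> \<eta>" and "0 \<le> \<eta>"
  shows "\<bar>expectation \<phi> - c\<bar> \<le> \<eta> + 2 * prob (space M - B)"
proof -
  have int: "integrable M \<phi>"
    using bound(1) by (intro integrable_const_bound[of _ 1]) auto
  have int2: "integrable M (\<lambda>x. \<eta> + 2 * indicator (space M - B) x :: real)"
    using \<open>0 \<le> \<eta>\<close> by (intro integrable_const_bound[of _ "\<eta> + 2"] AE_I2) (auto split: split_indicator)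
  have "\<bar>expectation \<phi> - c\<bar> = \<bar>expectation (\<lambda>x. \<phi> x - c)\<bar>"
    using int by (simp add: prob_space)
  also have "\<dots> \<le> expectation (\<lambda>x. \<bar>\<phi> x - c\<bar>)"
    by (rule integral_abs_bound)
  also have "\<dots> \<le> expectation (\<lambda>x. \<eta> + 2 * indicator (space M - B) x)"
  proof (rule integral_mono)
    fix x assume x: "x \<in> space M"
    show "\<bar>\<phi> x - c\<bar> \<le> \<eta> + 2 * indicator (space M - B) x"
      using close[of x] bound(1)[OF x] bound(2) x \<open>0 \<le> \<eta>\<close>
      by (cases "x \<in> B") (auto simp: abs_le_iff)
  qed (use int int2 in auto)
  also have "\<dots> = \<eta> + 2 * prob (space M - B)"
    by (subst Bochner_Integration.integral_add) (auto simp: prob_space emeasure_eq_measure Int_absorb2)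
  finally show ?thesis .
qed

text \<open>The preceding lemma is used twice: under Q with the constant \<phi> x for a fixed x in
  B, then under P with the Q-mean of \<phi> as the constant.\<close>

lemma abs_expectation_diff_le2:
  fixes \<phi> :: "'a \<Rightarrow> real"
  assumes "prob_space P" "prob_space Q" and P: "sets P = sets S" and Q: "sets Q = sets S"
    and \<phi>: "\<phi> \<in> borel_measurable S" and B: "B \<in> sets S"
    and bound: "\<And>x. x \<in> space S \<Longrightarrow> \<bar>\<phi> x\<bar> \<le> 1"
    and close: "\<And>x y. x \<in> B \<Longrightarrow> y \<in> B \<Longrightarrow> \<bar>\<phi> x - \<phi> y\<bar> \<le> \<eta>" and \<eta>: "0 \<le> \<eta>"
  shows "\<bar>(\<integral>x. \<phi> x \<partial>P) - (\<integral>x. \<phi> x \<partial>Q)\<bar> \<le> \<eta> + 2 * measure P (space S - B) + 2 * measure Q (space S - B)"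
proof -
  interpret P: prob_space P by fact
  interpret Q: prob_space Q by fact
  have sp: "space P = space S" "space Q = space S"
    using P Q by (auto dest: sets_eq_imp_space_eq)
  have m: "\<phi> \<in> borel_measurable P" "\<phi> \<in> borel_measurable Q" "B \<in> sets P" "B \<in> sets Q"
    using \<phi> B P Q by (simp_all cong: measurable_cong_sets)
  have c1: "\<bar>\<integral>x. \<phi> x \<partial>Q\<bar> \<le> 1"
  proof -
    have "\<bar>\<integral>x. \<phi> x \<partial>Q\<bar> \<le> (\<integral>x. \<bar>\<phi> x\<bar> \<partial>Q)" by (rule integral_abs_bound)
    also have "\<dots> \<le> (\<integral>x. 1 \<partial>Q)"
      using bound m sp by (intro integral_mono Q.integrable_const_bound[of _ 1]) auto
    finally show ?thesis by (simp add: Q.prob_space)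
  qed
  have "\<bar>(\<integral>x. \<phi> x \<partial>P) - (\<integral>x. \<phi> x \<partial>Q)\<bar> \<le> (\<eta> + 2 * measure Q (space S - B)) + 2 * measure P (space P - B)"
  proof (rule P.abs_expectation_diff_le[OF m(1,3) _ c1])
    fix x assume x: "x \<in> B"
    then have xS: "x \<in> space S" using B sets.sets_into_space by blast
    have "\<bar>(\<integral>x. \<phi> x \<partial>Q) - \<phi> x\<bar> \<le> \<eta> + 2 * measure Q (space Q - B)"
      using close[of _ x] x bound xS sp \<eta> by (intro Q.abs_expectation_diff_le m) auto
    then show "\<bar>\<phi> x - (\<integral>x. \<phi> x \<partial>Q)\<bar> \<le> \<eta> + 2 * measure Q (space S - B)"
      by (simp add: abs_minus_commute sp)
  qed (use bound sp \<eta> in auto)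
  then show ?thesis by (simp add: sp)
qed

context random_map begin

section \<open>Laws after n steps from a random start\<close>

lemma nn_integral_expect_invariant:
  assumes sets: "sets \<pi> = sets \<S>"
    and inv: "\<And>\<phi>. \<phi> \<in> borel_measurable \<S> \<Longrightarrow> (\<integral>\<^sup>+x. expect (Suc 0) \<phi> x \<partial>\<pi>) = (\<integral>\<^sup>+x. \<phi> x \<partial>\<pi>)"
    and \<phi>: "\<phi> \<in> borel_measurable \<S>"
  shows "(\<integral>\<^sup>+x. expect n \<phi> x \<partial>\<pi>) = (\<integral>\<^sup>+x. \<phi> x \<partial>\<pi>)"
proof (induction n)
  case (Suc n)
  have "(\<integral>\<^sup>+x. expect (Suc n) \<phi> x \<partial>\<pi>) = (\<integral>\<^sup>+x. expect (Suc 0) (expect n \<phi>) x \<partial>\<pi>)"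
    using expect_add[OF \<phi>, of _ "Suc 0" n] sets_eq_imp_space_eq[OF sets]
    by (intro nn_integral_cong) simp
  then show ?case
    using inv[OF measurable_expect[OF \<phi>, of n]] Suc by simp
qed simp

definition push :: "nat \<Rightarrow> 's measure \<Rightarrow> 's measure" where
  "push n \<rho> = distr (\<rho> \<Otimes>\<^sub>M stream_space \<gamma>) \<S> (\<lambda>(x, \<omega>). iter n x \<omega>)"

lemma sets_push [simp]: "sets (push n \<rho>) = sets \<S>"
  by (simp add: push_def)

lemma measurable_push_map:
  "sets \<rho> = sets \<S> \<Longrightarrow> (\<lambda>(x, \<omega>). iter n x \<omega>) \<in> \<rho> \<Otimes>\<^sub>M stream_space \<gamma> \<rightarrow>\<^sub>M \<S>"
proof -
  assume [measurable_cong]: "sets \<rho> = sets \<S>"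
  show ?thesis by measurable
qed

lemma nn_integral_push:
  assumes sets: "sets \<rho> = sets \<S>" and [measurable]: "\<phi> \<in> borel_measurable \<S>"
  shows "(\<integral>\<^sup>+y. \<phi> y \<partial>push n \<rho>) = (\<integral>\<^sup>+x. expect n \<phi> x \<partial>\<rho>)"
proof -
  note sets [measurable_cong]
  have "(\<integral>\<^sup>+y. \<phi> y \<partial>push n \<rho>) = (\<integral>\<^sup>+p. \<phi> (case p of (x, \<omega>) \<Rightarrow> iter n x \<omega>) \<partial>(\<rho> \<Otimes>\<^sub>M stream_space \<gamma>))"
    unfolding push_def by (rule nn_integral_distr[OF measurable_push_map[OF sets]]) simp
  also have "\<dots> = (\<integral>\<^sup>+x. \<integral>\<^sup>+\<omega>. \<phi> (iter n x \<omega>) \<partial>stream_space \<gamma> \<partial>\<rho>)"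
    by (subst stream.nn_integral_fst[symmetric]) auto
  finally show ?thesis by (simp add: expect_def)
qed

lemma prob_space_push:
  assumes "prob_space \<rho>" and sets: "sets \<rho> = sets \<S>"
  shows "prob_space (push n \<rho>)"
proof -
  interpret \<rho>: prob_space \<rho> by fact
  interpret pair_prob_space \<rho> "stream_space \<gamma>" ..
  show ?thesis
    unfolding push_def by (rule prob_space_distr[OF measurable_push_map[OF sets]])
qed

text \<open>Used to recognise an n-step law from its transition probabilities: the law of the
  scheme, a stationary law, and any competing invariant measure.\<close>

lemma push_unique:
  assumes sets: "sets \<rho> = sets \<S>" and "sets Q = sets \<S>"
    and "\<And>A. A \<in> sets \<S> \<Longrightarrow> emeasure Q A = (\<integral>\<^sup>+x. expect n (indicator A) x \<partial>\<rho>)"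
  shows "Q = push n \<rho>"
proof (rule measure_eqI)
  fix A assume "A \<in> sets Q"
  then have A [measurable]: "A \<in> sets \<S>" using assms by simp
  have "emeasure (push n \<rho>) A = (\<integral>\<^sup>+y. indicator A y \<partial>push n \<rho>)"
    by simp
  also have "\<dots> = (\<integral>\<^sup>+x. expect n (indicator A) x \<partial>\<rho>)"
    by (rule nn_integral_push[OF sets]) simp
  finally show "emeasure Q A = emeasure (push n \<rho>) A"
    using assms(3)[OF A] by simp
qed (simp add: assms)

end


text \<open>Increments of a test function are bounded both by the distance and by 2, hence by 2
  min(1, distance), the quantity that coalescence controls.\<close>

lemma (in segment_interval) FM_functions_D:
  assumes "\<Psi> \<in> FM_functions \<tau>"
  shows "X \<in> mspace (segment_space \<tau>) \<Longrightarrow> \<bar>\<Psi> X\<bar> \<le> 1"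
    and "X \<in> mspace (segment_space \<tau>) \<Longrightarrow> Y \<in> mspace (segment_space \<tau>) \<Longrightarrow>
      \<bar>\<Psi> X - \<Psi> Y\<bar> \<le> 2 * min 1 (mdist (segment_space \<tau>) X Y)"
    and "\<Psi> \<in> borel_measurable (borel_segment \<tau>)"
proof -
  show 1: "\<bar>\<Psi> X\<bar> \<le> 1" if "X \<in> mspace (segment_space \<tau>)" for X
    using assms that by (simp add: FM_functions_def)
  have 2: "\<bar>\<Psi> X - \<Psi> Y\<bar> \<le> mdist (segment_space \<tau>) X Y"
    if "X \<in> mspace (segment_space \<tau>)" "Y \<in> mspace (segment_space \<tau>)" for X Y
    using assms that by (simp add: FM_functions_def)
  show "\<bar>\<Psi> X - \<Psi> Y\<bar> \<le> 2 * min 1 (mdist (segment_space \<tau>) X Y)"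
    if "X \<in> mspace (segment_space \<tau>)" "Y \<in> mspace (segment_space \<tau>)"
    using 1[OF that(1)] 1[OF that(2)] 2[OF that] by (auto simp: min_def)
  show "\<Psi> \<in> borel_measurable (borel_segment \<tau>)"
    by (rule borel_measurable_lipschitz_segment[OF 2])
qed

locale segment_random_map = segment_interval \<tau> + random_map \<gamma> "borel_segment \<tau>" S
  for \<tau> :: real and \<gamma> :: "'z measure" and S :: "(real \<Rightarrow> 'b::euclidean_space) \<Rightarrow> 'z \<Rightarrow> real \<Rightarrow> 'b"
begin

lemma integral_push:
  assumes "prob_space \<rho>" and sets: "sets \<rho> = sets (borel_segment \<tau>)" and \<Psi>: "\<Psi> \<in> FM_functions \<tau>"
  shows "(\<integral>Y. \<Psi> Y \<partial>push n \<rho>) = (\<integral>X. (\<integral>\<omega>. \<Psi> (iter n X \<omega>) \<partial>stream_space \<gamma>) \<partial>\<rho>)"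
proof -
  interpret \<rho>: prob_space \<rho> by fact
  interpret pair_prob_space \<rho> "stream_space \<gamma>" ..
  note sets [measurable_cong] and FM_functions_D(3)[OF \<Psi>, measurable]
  have sp: "space \<rho> = mspace (segment_space \<tau>)"
    using sets_eq_imp_space_eq[OF sets] by simp
  have "(\<integral>Y. \<Psi> Y \<partial>push n \<rho>) = (\<integral>p. \<Psi> (case p of (X, \<omega>) \<Rightarrow> iter n X \<omega>) \<partial>(\<rho> \<Otimes>\<^sub>M stream_space \<gamma>))"
    unfolding push_def by (rule integral_distr[OF measurable_push_map[OF sets]]) simp
  also have "\<dots> = (\<integral>X. \<integral>\<omega>. \<Psi> (iter n X \<omega>) \<partial>stream_space \<gamma> \<partial>\<rho>)"
  proof (subst integral_fst'[symmetric])
    show "integrable (\<rho> \<Otimes>\<^sub>M stream_space \<gamma>) (\<lambda>p. \<Psi> (case p of (X, \<omega>) \<Rightarrow> iter n X \<omega>))"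
      using FM_functions_D(1)[OF \<Psi>] iter_in_space
      by (intro P.integrable_const_bound[of _ 1] AE_I2) (auto simp: space_pair_measure sp)
  qed simp
  finally show ?thesis .
qed

text \<open>By the synchronous coupling, the mean of \<Psi> after n steps varies by at most
  2\<epsilon> between starts in B; what is lost is only the initial mass outside B.\<close>

theorem FM_push_close:
  assumes P: "prob_space P" and Q: "prob_space Q"
    and sP: "sets P = sets (borel_segment \<tau>)" and sQ: "sets Q = sets (borel_segment \<tau>)"
    and B: "B \<in> sets (borel_segment \<tau>)"
    and close: "\<And>X Y. X \<in> B \<Longrightarrow> Y \<in> B \<Longrightarrow>
      (\<integral>\<^sup>+\<omega>. ennreal (min 1 (mdist (segment_space \<tau>) (iter n X \<omega>) (iter n Y \<omega>))) \<partial>stream_space \<gamma>) \<le> ennreal \<epsilon>"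
    and \<epsilon>: "0 \<le> \<epsilon>" and \<Psi>: "\<Psi> \<in> FM_functions \<tau>"
  shows "\<bar>(\<integral>Y. \<Psi> Y \<partial>push n P) - (\<integral>Y. \<Psi> Y \<partial>push n Q)\<bar>
    \<le> 2 * \<epsilon> + 2 * measure P (space (borel_segment \<tau>) - B) + 2 * measure Q (space (borel_segment \<tau>) - B)"
  unfolding integral_push[OF P sP \<Psi>] integral_push[OF Q sQ \<Psi>]
proof (rule abs_expectation_diff_le2[OF P Q sP sQ _ B])
  note FM_functions_D(3)[OF \<Psi>, measurable]
  show "(\<lambda>X. \<integral>\<omega>. \<Psi> (iter n X \<omega>) \<partial>stream_space \<gamma>) \<in> borel_measurable (borel_segment \<tau>)"
    by measurable
  have meas [measurable]: "(\<lambda>\<omega>. iter n X \<omega>) \<in> stream_space \<gamma> \<rightarrow>\<^sub>M borel_segment \<tau>" if "X \<in> space (borel_segment \<tau>)" for X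
    using that by (intro measurable_iter) auto
  have int: "integrable (stream_space \<gamma>) (\<lambda>\<omega>. \<Psi> (iter n X \<omega>))" if X: "X \<in> space (borel_segment \<tau>)" for X
    using FM_functions_D(1)[OF \<Psi>] iter_in_space[OF X] X
    by (intro stream.integrable_const_bound[of _ 1] AE_I2) auto
  show "\<bar>\<integral>\<omega>. \<Psi> (iter n X \<omega>) \<partial>stream_space \<gamma>\<bar> \<le> 1" if X: "X \<in> space (borel_segment \<tau>)" for X
  proof -
    have "\<bar>\<integral>\<omega>. \<Psi> (iter n X \<omega>) \<partial>stream_space \<gamma>\<bar> \<le> (\<integral>\<omega>. \<bar>\<Psi> (iter n X \<omega>)\<bar> \<partial>stream_space \<gamma>)"
      by (rule integral_abs_bound)
    also have "\<dots> \<le> (\<integral>\<omega>. 1 \<partial>stream_space \<gamma>)"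
      using FM_functions_D(1)[OF \<Psi>] iter_in_space[OF X] int[OF X] by (intro integral_mono) auto
    finally show ?thesis by (simp add: stream.prob_space)
  qed
  fix X Y assume X: "X \<in> B" and Y: "Y \<in> B"
  then have sp: "X \<in> space (borel_segment \<tau>)" "Y \<in> space (borel_segment \<tau>)"
    using sets.sets_into_space[OF B] by auto
  note [measurable] = meas[OF sp(1)] meas[OF sp(2)]
  let ?d = "\<lambda>\<omega>. mdist (segment_space \<tau>) (iter n X \<omega>) (iter n Y \<omega>)"
  have "\<bar>(\<integral>\<omega>. \<Psi> (iter n X \<omega>) \<partial>stream_space \<gamma>) - (\<integral>\<omega>. \<Psi> (iter n Y \<omega>) \<partial>stream_space \<gamma>)\<bar>
     = \<bar>\<integral>\<omega>. \<Psi> (iter n X \<omega>) - \<Psi> (iter n Y \<omega>) \<partial>stream_space \<gamma>\<bar>"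
    using int[OF sp(1)] int[OF sp(2)] by simp
  also have "\<dots> \<le> (\<integral>\<omega>. \<bar>\<Psi> (iter n X \<omega>) - \<Psi> (iter n Y \<omega>)\<bar> \<partial>stream_space \<gamma>)"
    by (rule integral_abs_bound)
  also have "\<dots> \<le> (\<integral>\<omega>. 2 * min 1 (?d \<omega>) \<partial>stream_space \<gamma>)"
  proof (rule integral_mono)
    show "integrable (stream_space \<gamma>) (\<lambda>\<omega>. 2 * min 1 (?d \<omega>))"
      by (intro stream.integrable_const_bound[of _ 2] AE_I2) (auto simp: min_def)
    show "\<bar>\<Psi> (iter n X \<omega>) - \<Psi> (iter n Y \<omega>)\<bar> \<le> 2 * min 1 (?d \<omega>)" if "\<omega> \<in> space (stream_space \<gamma>)" for \<omega>
      using FM_functions_D(2)[OF \<Psi>] iter_in_space[OF sp(1) that] iter_in_space[OF sp(2) that] by simp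
  qed (use int[OF sp(1)] int[OF sp(2)] in auto)
  also have "\<dots> \<le> 2 * \<epsilon>"
  proof -
    have "(\<integral>\<omega>. min 1 (?d \<omega>) \<partial>stream_space \<gamma>) = enn2real (\<integral>\<^sup>+\<omega>. ennreal (min 1 (?d \<omega>)) \<partial>stream_space \<gamma>)"
      by (intro integral_eq_nn_integral) auto
    also have "\<dots> \<le> \<epsilon>"
      using close[OF X Y] \<epsilon> by (simp add: enn2real_leI)
    finally show ?thesis by simp
  qed
  finally show "\<bar>(\<integral>\<omega>. \<Psi> (iter n X \<omega>) \<partial>stream_space \<gamma>) - (\<integral>\<omega>. \<Psi> (iter n Y \<omega>) \<partial>stream_space \<gamma>)\<bar> \<le> 2 * \<epsilon>" .
qed (use \<epsilon> in simp)

end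

section \<open>Tightness of the invariant laws\<close>

sublocale em_map \<subseteq> segment_random_map \<tau> \<gamma> step ..

lemma power2_le_powr:
  fixes u :: real
  assumes "0 \<le> u" "2 \<le> \<alpha>"
  shows "u\<^sup>2 \<le> 1 + u powr \<alpha>"
proof (cases "u \<le> 1")
  case True
  then have "u\<^sup>2 \<le> 1" using assms by (simp add: power_le_one)
  then show ?thesis by (simp add: add_increasing2)
next
  case False
  then have "u\<^sup>2 = u powr 2" using assms by simp
  also have "\<dots> \<le> u powr \<alpha>" using False assms by (intro powr_mono) auto
  finally show ?thesis by simp
qed

locale em_dissipation = em_contraction \<tau> \<gamma> \<Delta> f g r N l V b1 b2 b3 b4 P q
  for \<tau> :: real and \<gamma> :: "(real^'m) measure" and \<Delta> :: real
    and f :: "(real^'d) \<times> (real^'d) \<Rightarrow> real^'d" and g :: "(real^'d) \<times> (real^'d) \<Rightarrow> real^'m^'d"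
    and r :: real and N :: nat and l :: real
    and V :: "(real^'d) \<times> (real^'d) \<Rightarrow> real" and b1 b2 b3 b4 P q :: real +
  fixes \<alpha> a1 a2 a3 :: real
  assumes alpha: "2 \<le> \<alpha>" and a_nonneg: "0 \<le> a1" "0 \<le> a3"
    and Khasminskii: "\<And>x y. 2 * (x \<bullet> f (x, y)) + (norm (g (x, y)))\<^sup>2
         \<le> a1 - a2 * norm x powr \<alpha> + a3 * norm y powr \<alpha>"
    and f_0: "norm (f (0, 0)) \<le> P"
    and gap_a: "a3 < a2 - 2 * q"
    and V_cont: "continuous_on UNIV V"
begin

text \<open>The squared drift costs at most q (2 |x|^\<alpha> + 10): the first part is taken from
  a2, the second is added to a1.\<close>

definition "a_gap = a2 - 2 * q - a3"
definition "A1 = a1 + 10 * q"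
text \<open>The weight is the delayed term of the Khasminskii condition, so that it cancels on
  leaving the window. \<open>window\<close> compares two paths; here it is used on the
  diagonal.\<close>

definition "E_window x y = a3 * norm x powr \<alpha>" for x y :: "real^'d"
definition "energy X = (norm (X 0))\<^sup>2 + \<Delta> * window E_window X X"

lemma a_gap_pos: "0 < a_gap" using gap_a by (simp add: a_gap_def)
lemma A1_nonneg: "0 \<le> A1" using a_nonneg q_nonneg by (simp add: A1_def)
lemma E_window_nonneg: "0 \<le> E_window x y" using a_nonneg by (simp add: E_window_def)
lemma energy_nonneg: "0 \<le> energy X"
  unfolding energy_def using Delta_pos window_nonneg[OF E_window_nonneg] by simp

lemma measurable_energy [measurable]: "(\<lambda>X. ennreal (energy X)) \<in> borel_measurable (borel_segment \<tau>)"
proof -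
  have fst [measurable]: "fst \<in> borel_measurable borel"
    by (intro borel_measurable_continuous_onI continuous_intros)
  have "(\<lambda>p. E_window (fst p) (snd p)) \<in> borel_measurable borel"
    unfolding E_window_def by measurable
  then have [measurable]: "(\<lambda>X. window E_window X X) \<in> borel_measurable (borel_segment \<tau>)"
    by (intro measurable_window) auto
  have [measurable]: "(\<lambda>X. X 0) \<in> borel_measurable (borel_segment \<tau> :: (real \<Rightarrow> real^'d) measure)"
    by (intro measurable_eval_0) auto
  show ?thesis unfolding energy_def by measurable
qed

text \<open>The minimum with 1 in the truncation condition bounds the influence of the delayed state
  by a constant, so growth is linear in the present state alone. Hence the squared drift reduces a2
  but leaves a3 as it is.\<close>

lemma f_linear_growth:
  assumes "norm x \<le> r" "norm y \<le> r"
  shows "norm (f (x, y)) \<le> P * (norm x + 2)"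
proof -
  have "norm (f (x, y) - f (0, 0)) \<le> P * (norm (x - 0) + min 1 (norm (y - 0)))"
    using assms r_nonneg by (intro f_growth) auto
  also have "\<dots> \<le> P * (norm x + 1)"
    by (intro mult_left_mono P_nonneg) auto
  finally have "norm (f (x, y)) \<le> P * (norm x + 1) + P"
    using f_0 norm_triangle_sub[of "f (x, y)" "f (0, 0)"] by linarith
  then show ?thesis by (simp add: algebra_simps)
qed

text \<open>Truncation does not increase the norm and the noise adds \<Delta> |G|^2 in the mean. The
  constants come from (u + 2)^2 \<le> 2 u^2 + 8 and u^2 \<le> 1 + u^\<alpha>, the latter by \<alpha>
  \<ge> 2.\<close>

lemma one_step_energy:
  assumes X: "X \<in> bounded_segments r"
  shows "(\<integral>\<^sup>+z. ennreal (energy (step X z)) \<partial>\<gamma>) + ennreal (\<Delta> * (a_gap * norm (X 0) powr \<alpha>))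
    \<le> ennreal (energy X) + ennreal (\<Delta> * A1)"
proof -
  let ?F = "f (X 0, X (-\<tau>))" and ?G = "g (X 0, X (-\<tau>))"
  define W where "W = window E_window X X + E_window (X 0) (X 0) - E_window (X (-\<tau>)) (X (-\<tau>))"
  have W: "window E_window (step X z) (step X z) = W" for z
    by (simp add: window_step W_def)
  have W0: "0 \<le> W" using window_nonneg[of E_window "step X 0" "step X 0"] E_window_nonneg by (simp add: W)
  have p1: "(\<integral>\<^sup>+z. ennreal (energy (step X z)) \<partial>\<gamma>)
      \<le> (\<integral>\<^sup>+z. ennreal ((norm (X 0 + \<Delta> *\<^sub>R ?F + ?G *v z))\<^sup>2) + ennreal (\<Delta> * W) \<partial>\<gamma>)"
  proof (intro nn_integral_mono)
    fix z
    have "norm (next_node X z) \<le> norm (X 0 + \<Delta> *\<^sub>R ?F + ?G *v z)"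
      unfolding em_next_def using r_nonneg by (simp add: norm_trunc)
    then have "energy (step X z) \<le> (norm (X 0 + \<Delta> *\<^sub>R ?F + ?G *v z))\<^sup>2 + \<Delta> * W"
      unfolding energy_def W step_0 by (intro add_right_mono power_mono norm_ge_zero)
    then show "ennreal (energy (step X z)) \<le> ennreal ((norm (X 0 + \<Delta> *\<^sub>R ?F + ?G *v z))\<^sup>2) + ennreal (\<Delta> * W)"
      using W0 Delta_pos by (intro ennreal_le_plusI) auto
  qed
  have p2: "(\<integral>\<^sup>+z. ennreal ((norm (X 0 + \<Delta> *\<^sub>R ?F + ?G *v z))\<^sup>2) + ennreal (\<Delta> * W) \<partial>\<gamma>)
      = ennreal ((norm (X 0 + \<Delta> *\<^sub>R ?F))\<^sup>2 + \<Delta> * (norm ?G)\<^sup>2) + ennreal (\<Delta> * W)"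
    by (rule nn_integral_norm_affine_sq_add[OF less_imp_le[OF Delta_pos]])
  have p3: "ennreal ((norm (X 0 + \<Delta> *\<^sub>R ?F))\<^sup>2 + \<Delta> * (norm ?G)\<^sup>2) + ennreal (\<Delta> * W) + ennreal (\<Delta> * (a_gap * norm (X 0) powr \<alpha>))
      \<le> ennreal (energy X + \<Delta> * A1)"
  proof -
    let ?u = "norm (X 0)"
    have nF: "(norm ?F)\<^sup>2 * \<Delta> \<le> q * (2 * ?u powr \<alpha> + 10)"
    proof -
      have "norm ?F \<le> P * (?u + 2)"
        by (intro f_linear_growth bounded_segments_D(3,4)[OF X])
      then have "(norm ?F)\<^sup>2 \<le> P\<^sup>2 * (?u + 2)\<^sup>2"
        by (subst power_mult_distrib[symmetric]) (intro power_mono norm_ge_zero)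
      also have "(?u + 2)\<^sup>2 \<le> 2 * ?u\<^sup>2 + 8"
        using sum_squares_bound[of ?u 2] by (simp add: power2_sum)
      also have "2 * ?u\<^sup>2 + 8 \<le> 2 * ?u powr \<alpha> + 10"
        using power2_le_powr[OF norm_ge_zero alpha, of "X 0"] by simp
      finally have "(norm ?F)\<^sup>2 \<le> P\<^sup>2 * (2 * ?u powr \<alpha> + 10)"
        by (simp add: mult_left_mono)
      then have "(norm ?F)\<^sup>2 * \<Delta> \<le> (P\<^sup>2 * \<Delta>) * (2 * ?u powr \<alpha> + 10)"
        using Delta_pos mult_right_mono[of "(norm ?F)\<^sup>2" "P\<^sup>2 * (2 * ?u powr \<alpha> + 10)" \<Delta>]
        by (simp add: mult.commute mult.left_commute)
      also have "\<dots> \<le> q * (2 * ?u powr \<alpha> + 10)"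
        by (intro mult_right_mono P_q) auto
      finally show ?thesis .
    qed
    have "2 * (X 0 \<bullet> ?F) + (norm ?F)\<^sup>2 * \<Delta> + (norm ?G)\<^sup>2 + E_window (X 0) (X 0) - E_window (X (-\<tau>)) (X (-\<tau>)) + a_gap * ?u powr \<alpha> \<le> A1"
      using Khasminskii[of "X 0" "X (-\<tau>)"] nF
      unfolding E_window_def a_gap_def A1_def by (simp add: algebra_simps)
    then have "\<Delta> * (2 * (X 0 \<bullet> ?F) + (norm ?F)\<^sup>2 * \<Delta> + (norm ?G)\<^sup>2 + E_window (X 0) (X 0) - E_window (X (-\<tau>)) (X (-\<tau>)) + a_gap * ?u powr \<alpha>) \<le> \<Delta> * A1"
      using Delta_pos by (intro mult_left_mono) auto
    then have "((norm (X 0 + \<Delta> *\<^sub>R ?F))\<^sup>2 + \<Delta> * (norm ?G)\<^sup>2) + \<Delta> * W + \<Delta> * (a_gap * ?u powr \<alpha>) \<le> energy X + \<Delta> * A1"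
      unfolding norm_add_scaleR_sq energy_def W_def by (simp add: algebra_simps)
    then show ?thesis
      using W0 Delta_pos a_gap_pos by (intro ennreal_plus_leI) auto
  qed
  show ?thesis
    using order_trans[OF add_right_mono[OF p1[unfolded p2]] p3] energy_nonneg A1_nonneg Delta_pos by simp
qed

text \<open>Being carried by the r-ball is part of the notion: the drift inequalities are available
  there, and the energy is bounded there.\<close>

definition "invariant_law \<pi> \<longleftrightarrow> prob_space \<pi> \<and> sets \<pi> = sets (borel_segment \<tau>) \<and>
  (AE X in \<pi>. X \<in> bounded_segments r) \<and>
  (\<forall>\<phi>\<in>borel_measurable (borel_segment \<tau>). (\<integral>\<^sup>+X. expect (Suc 0) \<phi> X \<partial>\<pi>) = (\<integral>\<^sup>+X. \<phi> X \<partial>\<pi>))"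

lemma invariant_lawD:
  assumes "invariant_law \<pi>"
  shows "prob_space \<pi>" "sets \<pi> = sets (borel_segment \<tau>)" "AE X in \<pi>. X \<in> bounded_segments r"
    "\<phi> \<in> borel_measurable (borel_segment \<tau>) \<Longrightarrow> (\<integral>\<^sup>+X. expect n \<phi> X \<partial>\<pi>) = (\<integral>\<^sup>+X. \<phi> X \<partial>\<pi>)"
proof -
  show sets: "sets \<pi> = sets (borel_segment \<tau>)"
    using assms unfolding invariant_law_def by blast
  have "\<And>\<phi>. \<phi> \<in> borel_measurable (borel_segment \<tau>) \<Longrightarrow> (\<integral>\<^sup>+X. expect (Suc 0) \<phi> X \<partial>\<pi>) = (\<integral>\<^sup>+X. \<phi> X \<partial>\<pi>)"
    using assms unfolding invariant_law_def by blast
  then show "\<phi> \<in> borel_measurable (borel_segment \<tau>) \<Longrightarrow> (\<integral>\<^sup>+X. expect n \<phi> X \<partial>\<pi>) = (\<integral>\<^sup>+X. \<phi> X \<partial>\<pi>)"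
    by (rule nn_integral_expect_invariant[OF sets])
qed (use assms in \<open>auto simp: invariant_law_def\<close>)

text \<open>Integrating the one-step energy inequality against the stationary law makes the two
  energy terms cancel; what remains compares the dissipation with \<Delta> \<open>A1\<close>, and
  \<Delta> drops out.\<close>

lemma stationary_moment:
  assumes \<pi>: "invariant_law \<pi>"
  shows "(\<integral>\<^sup>+X. ennreal (norm (X 0) powr \<alpha>) \<partial>\<pi>) \<le> ennreal (A1 / a_gap)"
proof (rule ennreal_le_divideI[OF a_gap_pos])
  interpret \<pi>: prob_space \<pi> using \<pi> by (simp add: invariant_law_def)
  have sets [measurable_cong]: "sets \<pi> = sets (borel_segment \<tau>)" and AE_r: "AE X in \<pi>. X \<in> bounded_segments r"
    using \<pi> by (auto simp: invariant_law_def)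
  have [measurable]: "(\<lambda>X. X 0) \<in> borel_measurable (borel_segment \<tau> :: (real \<Rightarrow> real^'d) measure)"
    by (intro measurable_eval_0) auto
  let ?I = "\<integral>\<^sup>+X. ennreal (energy X) \<partial>\<pi>"
  \<comment> \<open>This bound depends on r; it is used only to know that \<open>?I\<close> is
    finite, so that it may be cancelled in \<open>ennreal\<close>.\<close>
  have "?I \<le> (\<integral>\<^sup>+X. ennreal (r\<^sup>2 + \<tau> * (a3 * r powr \<alpha>)) \<partial>\<pi>)"
    using AE_r
  proof (intro nn_integral_mono_AE, eventually_elim)
    fix X assume X: "X \<in> bounded_segments r"
    have "\<Delta> * window E_window X X \<le> \<tau> * (a3 * r powr \<alpha>)"
      using a_nonneg alpha by (intro window_le[OF X X]) (auto simp: E_window_def intro!: mult_left_mono powr_mono2)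
    moreover have "(norm (X 0))\<^sup>2 \<le> r\<^sup>2"
      by (intro power_mono bounded_segments_D(3)[OF X] norm_ge_zero)
    ultimately show "ennreal (energy X) \<le> ennreal (r\<^sup>2 + \<tau> * (a3 * r powr \<alpha>))"
      unfolding energy_def by (intro ennreal_leI) linarith
  qed
  also have "\<dots> < \<infinity>"
    using \<pi>.emeasure_space_1 by simp
  finally have fin: "?I \<noteq> \<infinity>" by simp
  have "(\<integral>\<^sup>+X. expect (Suc 0) (\<lambda>X. ennreal (energy X)) X + ennreal (\<Delta> * (a_gap * norm (X 0) powr \<alpha>)) \<partial>\<pi>)
      \<le> (\<integral>\<^sup>+X. ennreal (energy X) + ennreal (\<Delta> * A1) \<partial>\<pi>)"
    using AE_r
  proof (intro nn_integral_mono_AE, eventually_elim)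
    fix X assume X: "X \<in> bounded_segments r"
    show "expect (Suc 0) (\<lambda>X. ennreal (energy X)) X + ennreal (\<Delta> * (a_gap * norm (X 0) powr \<alpha>))
      \<le> ennreal (energy X) + ennreal (\<Delta> * A1)"
      using one_step_energy[OF X] bounded_segments_D(1)[OF X] by (subst expect_1) auto
  qed
  moreover have "(\<integral>\<^sup>+X. expect (Suc 0) (\<lambda>X. ennreal (energy X)) X + ennreal (\<Delta> * (a_gap * norm (X 0) powr \<alpha>)) \<partial>\<pi>)
     = (\<integral>\<^sup>+X. expect (Suc 0) (\<lambda>X. ennreal (energy X)) X \<partial>\<pi>) + (\<integral>\<^sup>+X. ennreal (\<Delta> * (a_gap * norm (X 0) powr \<alpha>)) \<partial>\<pi>)"
    by (intro nn_integral_add) measurable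
  moreover have "(\<integral>\<^sup>+X. expect (Suc 0) (\<lambda>X. ennreal (energy X)) X \<partial>\<pi>) = ?I"
    by (rule invariant_lawD(4)[OF \<pi> measurable_energy])
  moreover have "(\<integral>\<^sup>+X. ennreal (energy X) + ennreal (\<Delta> * A1) \<partial>\<pi>) = ?I + ennreal (\<Delta> * A1)"
    using \<pi>.emeasure_space_1 by (subst nn_integral_add) auto
  ultimately have "?I + (\<integral>\<^sup>+X. ennreal (\<Delta> * (a_gap * norm (X 0) powr \<alpha>)) \<partial>\<pi>) \<le> ?I + ennreal (\<Delta> * A1)"
    by (simp only:)
  then have "(\<integral>\<^sup>+X. ennreal (\<Delta> * (a_gap * norm (X 0) powr \<alpha>)) \<partial>\<pi>) \<le> ennreal (\<Delta> * A1)"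
    using fin by (subst (asm) ennreal_add_left_cancel_le) auto
  also have "(\<integral>\<^sup>+X. ennreal (\<Delta> * (a_gap * norm (X 0) powr \<alpha>)) \<partial>\<pi>)
      = ennreal (\<Delta> * a_gap) * (\<integral>\<^sup>+X. ennreal (norm (X 0) powr \<alpha>) \<partial>\<pi>)"
    using Delta_pos a_gap_pos
    by (subst nn_integral_cmult[symmetric]) (auto simp: ennreal_mult[symmetric] mult.assoc)
  finally have "(\<integral>\<^sup>+X. ennreal (norm (X 0) powr \<alpha>) \<partial>\<pi>) \<le> ennreal ((\<Delta> * A1) / (\<Delta> * a_gap))"
    using Delta_pos a_gap_pos by (intro ennreal_le_divideI) auto
  then have "(\<integral>\<^sup>+X. ennreal (norm (X 0) powr \<alpha>) \<partial>\<pi>) \<le> ennreal (A1 / a_gap)"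
    using Delta_pos by simp
  then have "ennreal a_gap * (\<integral>\<^sup>+X. ennreal (norm (X 0) powr \<alpha>) \<partial>\<pi>) \<le> ennreal a_gap * ennreal (A1 / a_gap)"
    by (rule mult_left_mono) simp
  also have "\<dots> = ennreal A1"
    using a_gap_pos by (simp add: ennreal_mult'[symmetric])
  finally show "ennreal a_gap * (\<integral>\<^sup>+X. ennreal (norm (X 0) powr \<alpha>) \<partial>\<pi>) \<le> ennreal A1" .
qed

text \<open>A bound for the stationary mean energy, plus \<tau> \<open>A1\<close> for the drift
  \<Delta> \<open>A1\<close> accumulated over N steps in the maximal inequality.\<close>

definition "energy_bound = 1 + (1 + \<tau> * a3) * (A1 / a_gap) + \<tau> * A1"

lemma stationary_energy:
  assumes \<pi>: "invariant_law \<pi>"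
  shows "(\<integral>\<^sup>+X. ennreal (energy X) \<partial>\<pi>) + ennreal (\<tau> * A1) \<le> ennreal energy_bound"
proof -
  interpret \<pi>: prob_space \<pi> using \<pi> by (simp add: invariant_law_def)
  have sets [measurable_cong]: "sets \<pi> = sets (borel_segment \<tau>)"
    using \<pi> by (auto simp: invariant_law_def)
  have sp: "space \<pi> = mspace (segment_space \<tau>)"
    using sets_eq_imp_space_eq[OF sets] by simp
  define p where "p i X = ennreal (norm (X (- (real i * \<Delta>))) powr \<alpha>)" for i :: nat and X :: "real \<Rightarrow> real^'d"
  have p_meas [measurable]: "p i \<in> borel_measurable (borel_segment \<tau>)" if "i \<le> N" for i
  proof -
    have [measurable]: "(\<lambda>X. X (- (real i * \<Delta>))) \<in> borel_measurable (borel_segment \<tau> :: (real \<Rightarrow> real^'d) measure)"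
      using that by (intro measurable_node) auto
    show ?thesis unfolding p_def by measurable
  qed
  let ?m = "\<integral>\<^sup>+X. p 0 X \<partial>\<pi>"
  have m: "?m \<le> ennreal (A1 / a_gap)"
    using stationary_moment[OF \<pi>] by (simp add: p_def)
  \<comment> \<open>By stationarity the segment may be replaced by its i-th iterate, whose value at
    -i \<Delta> is the original value at 0. All grid values thus share one moment.\<close>
  have shift: "(\<integral>\<^sup>+X. p i X \<partial>\<pi>) = ?m" if i: "i \<le> N" for i
  proof -
    have "(\<integral>\<^sup>+X. p i X \<partial>\<pi>) = (\<integral>\<^sup>+X. expect i (p i) X \<partial>\<pi>)"
      by (rule invariant_lawD(4)[OF \<pi> p_meas[OF i], symmetric])
    also have "\<dots> = ?m"
      using iter_node[OF order_refl i]
      by (intro nn_integral_cong) (simp add: expect_def p_def stream.emeasure_space_1)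
    finally show ?thesis .
  qed
  have pw: "ennreal (energy X) \<le> (1 + p 0 X) + ennreal (\<Delta> * a3) * (\<Sum>i<N. p (Suc i) X)" for X
  proof -
    have "energy X \<le> (1 + norm (X 0) powr \<alpha>) + (\<Delta> * a3) * (\<Sum>i<N. norm (X (- (real (Suc i) * \<Delta>))) powr \<alpha>)"
      using power2_le_powr[OF norm_ge_zero alpha, of "X 0"]
      by (simp add: energy_def window_def E_window_def sum_distrib_left mult.assoc)
    then have "ennreal (energy X) \<le> ennreal (1 + norm (X 0) powr \<alpha>) + ennreal ((\<Delta> * a3) * (\<Sum>i<N. norm (X (- (real (Suc i) * \<Delta>))) powr \<alpha>))"
      using Delta_pos a_nonneg by (intro ennreal_le_plusI mult_nonneg_nonneg sum_nonneg) auto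
    moreover have "ennreal ((\<Delta> * a3) * (\<Sum>i<N. norm (X (- (real (Suc i) * \<Delta>))) powr \<alpha>)) = ennreal (\<Delta> * a3) * (\<Sum>i<N. p (Suc i) X)"
      unfolding p_def using Delta_pos a_nonneg by (subst sum_ennreal) (auto simp: ennreal_mult sum_nonneg)
    ultimately show ?thesis by (simp add: p_def)
  qed
  have "(\<integral>\<^sup>+X. ennreal (energy X) \<partial>\<pi>) \<le> (\<integral>\<^sup>+X. (1 + p 0 X) + ennreal (\<Delta> * a3) * (\<Sum>i<N. p (Suc i) X) \<partial>\<pi>)"
    by (intro nn_integral_mono pw)
  also have "\<dots> = (1 + ?m) + ennreal (\<Delta> * a3) * (of_nat N * ?m)"
  proof -
    have pm: "p i \<in> borel_measurable \<pi>" if "i \<le> N" for i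
      using p_meas[OF that] by (simp only: measurable_cong_sets[OF sets refl])
    have sm: "(\<lambda>X. \<Sum>i<N. p (Suc i) X) \<in> borel_measurable \<pi>"
      by (intro borel_measurable_sum pm) simp
    have "(\<integral>\<^sup>+X. (\<Sum>i<N. p (Suc i) X) \<partial>\<pi>) = (\<Sum>i<N. \<integral>\<^sup>+X. p (Suc i) X \<partial>\<pi>)"
      by (rule nn_integral_sum) (simp add: pm)
    also have "\<dots> = (\<Sum>i<N. ?m)"
      by (intro sum.cong refl shift) simp
    also have "\<dots> = of_nat N * ?m"
      by simp
    finally have "(\<integral>\<^sup>+X. ennreal (\<Delta> * a3) * (\<Sum>i<N. p (Suc i) X) \<partial>\<pi>) = ennreal (\<Delta> * a3) * (of_nat N * ?m)"
      using nn_integral_cmult[OF sm] by (simp only:)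
    moreover have "(\<integral>\<^sup>+X. 1 + p 0 X \<partial>\<pi>) = 1 + ?m"
      using nn_integral_add[of "\<lambda>_. 1" \<pi> "p 0"] pm[of 0] \<pi>.emeasure_space_1 by simp
    moreover have "(\<integral>\<^sup>+X. (1 + p 0 X) + ennreal (\<Delta> * a3) * (\<Sum>i<N. p (Suc i) X) \<partial>\<pi>)
      = (\<integral>\<^sup>+X. 1 + p 0 X \<partial>\<pi>) + (\<integral>\<^sup>+X. ennreal (\<Delta> * a3) * (\<Sum>i<N. p (Suc i) X) \<partial>\<pi>)"
      by (intro nn_integral_add borel_measurable_add borel_measurable_times_ennreal borel_measurable_const sm pm) simp
    ultimately show ?thesis by (simp only:)
  qed
  finally have i1: "(\<integral>\<^sup>+X. ennreal (energy X) \<partial>\<pi>) \<le> (1 + ?m) + ennreal (\<Delta> * a3) * (of_nat N * ?m)" .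
  define k where "k = A1 / a_gap"
  have k: "0 \<le> k" using A1_nonneg a_gap_pos by (simp add: k_def)
  have i2: "(1 + ?m) + ennreal (\<Delta> * a3) * (of_nat N * ?m) \<le> (1 + ennreal k) + ennreal (\<Delta> * a3) * (of_nat N * ennreal k)"
    using m unfolding k_def by (intro add_mono mult_left_mono) auto
  have e1: "of_nat N * ennreal k = ennreal (real N * k)"
    unfolding ennreal_of_nat_eq_real_of_nat using k by (intro ennreal_mult[symmetric]) auto
  have e2: "ennreal (\<Delta> * a3) * ennreal (real N * k) = ennreal ((\<Delta> * a3) * (real N * k))"
    using k Delta_pos a_nonneg by (intro ennreal_mult[symmetric]) auto
  have e3: "(\<Delta> * a3) * (real N * k) = \<tau> * a3 * k"
    unfolding Delta[symmetric] by (simp add: mult_ac)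
  have e4: "ennreal (1 + k + \<tau> * a3 * k + \<tau> * A1) = 1 + ennreal k + ennreal (\<tau> * a3 * k) + ennreal (\<tau> * A1)"
    using k a_nonneg tau_pos A1_nonneg by simp
  have e5: "1 + k + \<tau> * a3 * k + \<tau> * A1 = energy_bound"
    unfolding energy_bound_def k_def[symmetric] by (simp add: distrib_right)
  have "(\<integral>\<^sup>+X. ennreal (energy X) \<partial>\<pi>) \<le> 1 + ennreal k + ennreal (\<tau> * a3 * k)"
    using order_trans[OF i1 i2] unfolding e1 e2 e3 .
  from add_right_mono[OF this, of "ennreal (\<tau> * A1)"] show ?thesis
    unfolding e4[symmetric] e5 .
qed

text \<open>Running the chain for one more delay leaves the law unchanged, while the maximal
  inequality bounds all nodes met on the way and hence the whole segment. The resulting bound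
  contains neither r nor \<Delta>.\<close>

theorem stationary_tightness:
  assumes \<pi>: "invariant_law \<pi>" and R: "0 < R"
  shows "measure \<pi> (space (borel_segment \<tau>) - bounded_segments R) \<le> energy_bound / R\<^sup>2"
proof -
  interpret \<pi>: prob_space \<pi> using \<pi> by (simp add: invariant_law_def)
  have sets [measurable_cong]: "sets \<pi> = sets (borel_segment \<tau>)" and AE_r: "AE X in \<pi>. X \<in> bounded_segments r"
    using \<pi> by (auto simp: invariant_law_def)
  have B [measurable]: "bounded_segments R \<in> sets (borel_segment \<tau>)"
    using R by (intro sets_bounded_segments) simp
  let ?O = "space (borel_segment \<tau>) - bounded_segments R"
  let ?i = "indicator ?O :: _ \<Rightarrow> ennreal"
  have "ennreal (R\<^sup>2) * expect N ?i X \<le> ennreal (energy X) + of_nat N * ennreal (\<Delta> * A1)" if X: "X \<in> bounded_segments r" for X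
  proof -
    note XC = bounded_segments_D(1)[OF X]
    have it [measurable]: "(\<lambda>\<omega>. iter N X \<omega>) \<in> stream_space \<gamma> \<rightarrow>\<^sub>M borel_segment \<tau>"
      using XC by (intro measurable_iter) auto
    have "ennreal (R\<^sup>2) * expect N ?i X = (\<integral>\<^sup>+\<omega>. ennreal (R\<^sup>2) * ?i (iter N X \<omega>) \<partial>stream_space \<gamma>)"
      unfolding expect_def by (rule nn_integral_cmult[symmetric]) measurable
    moreover have "(\<integral>\<^sup>+\<omega>. ennreal (R\<^sup>2) * ?i (iter N X \<omega>) \<partial>stream_space \<gamma>)
      \<le> (\<integral>\<^sup>+\<omega>. (if \<exists>j\<le>N. ennreal (R\<^sup>2) \<le> ennreal (energy (iter j X \<omega>)) then ennreal (R\<^sup>2) else 0) \<partial>stream_space \<gamma>)"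
    proof (rule nn_integral_mono)
      fix \<omega> assume \<omega>: "\<omega> \<in> space (stream_space \<gamma>)"
      show "ennreal (R\<^sup>2) * ?i (iter N X \<omega>) \<le> (if \<exists>j\<le>N. ennreal (R\<^sup>2) \<le> ennreal (energy (iter j X \<omega>)) then ennreal (R\<^sup>2) else 0)"
      proof (cases "\<exists>j\<le>N. ennreal (R\<^sup>2) \<le> ennreal (energy (iter j X \<omega>))")
        case True
        then show ?thesis by (simp add: indicator_def)
      next
        case False
        have "norm (iter j X \<omega> 0) \<le> R" if "j \<le> N" for j
        proof -
          have "energy (iter j X \<omega>) \<le> R\<^sup>2"
            using False that by (meson ennreal_leI linear)
          moreover have "0 \<le> \<Delta> * window E_window (iter j X \<omega>) (iter j X \<omega>)"
            using Delta_pos window_nonneg[of E_window] E_window_nonneg by simp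
          ultimately have "(norm (iter j X \<omega> 0))\<^sup>2 \<le> R\<^sup>2"
            unfolding energy_def by linarith
          then show ?thesis using R by (simp add: power2_le_iff_abs_le)
        qed
        then have "iter N X \<omega> \<in> bounded_segments R"
          using norm_iter_le[of X \<omega> R] iter_in_space[of X \<omega> N] XC \<omega> by (simp add: bounded_segments_def)
        then show ?thesis by simp
      qed
    qed
    moreover have "(\<integral>\<^sup>+\<omega>. (if \<exists>j\<le>N. ennreal (R\<^sup>2) \<le> ennreal (energy (iter j X \<omega>)) then ennreal (R\<^sup>2) else 0) \<partial>stream_space \<gamma>)
      \<le> ennreal (energy X) + of_nat N * ennreal (\<Delta> * A1)"
    proof (rule maximal_inequality[OF measurable_energy _ bounded_segments_invariant _ X])
      show "bounded_segments r \<subseteq> space (borel_segment \<tau>)"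
        using bounded_segments_D(1) by auto
      show "(\<integral>\<^sup>+z. ennreal (energy (step X z)) \<partial>\<gamma>) \<le> ennreal (energy X) + ennreal (\<Delta> * A1)" if "X \<in> bounded_segments r" for X
        using one_step_energy[OF that] by (rule order_trans[rotated]) simp
    qed
    ultimately show ?thesis by (simp only:)
  qed
  then have "(\<integral>\<^sup>+X. ennreal (R\<^sup>2) * expect N ?i X \<partial>\<pi>) \<le> (\<integral>\<^sup>+X. ennreal (energy X) + of_nat N * ennreal (\<Delta> * A1) \<partial>\<pi>)"
    using AE_r by (intro nn_integral_mono_AE) auto
  also have "\<dots> = (\<integral>\<^sup>+X. ennreal (energy X) \<partial>\<pi>) + of_nat N * ennreal (\<Delta> * A1)"
    using \<pi>.emeasure_space_1 by (subst nn_integral_add) auto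
  also have "of_nat N * ennreal (\<Delta> * A1) = ennreal (\<tau> * A1)"
    using Delta_pos A1_nonneg by (simp add: Delta[symmetric] ennreal_of_nat_eq_real_of_nat ennreal_mult[symmetric] mult.assoc)
  also have "(\<integral>\<^sup>+X. ennreal (energy X) \<partial>\<pi>) + ennreal (\<tau> * A1) \<le> ennreal energy_bound"
    by (rule stationary_energy[OF \<pi>])
  also have "(\<integral>\<^sup>+X. ennreal (R\<^sup>2) * expect N ?i X \<partial>\<pi>) = ennreal (R\<^sup>2) * (\<integral>\<^sup>+X. expect N ?i X \<partial>\<pi>)"
    by (rule nn_integral_cmult) measurable
  also have "(\<integral>\<^sup>+X. expect N ?i X \<partial>\<pi>) = (\<integral>\<^sup>+X. ?i X \<partial>\<pi>)"
    by (rule invariant_lawD(4)[OF \<pi>]) measurable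
  also have "(\<integral>\<^sup>+X. ?i X \<partial>\<pi>) = ennreal (measure \<pi> ?O)"
    using sets.compl_sets[OF B] by (subst nn_integral_indicator) (auto simp: \<pi>.emeasure_eq_measure sets)
  finally have "ennreal (R\<^sup>2) * ennreal (measure \<pi> ?O) \<le> ennreal energy_bound" .
  then have "ennreal (measure \<pi> ?O) \<le> ennreal (energy_bound / R\<^sup>2)"
    using R by (intro ennreal_le_divideI) auto
  moreover have "0 \<le> energy_bound / R\<^sup>2"
    unfolding energy_bound_def using A1_nonneg a_gap_pos a_nonneg tau_pos by simp
  ultimately show ?thesis
    by (simp add: ennreal_le_iff)
qed

end

section \<open>Attraction by the invariant law\<close>

lemma continuous_bounded_on_balls:
  fixes V :: "(real^'d) \<times> (real^'d) \<Rightarrow> real"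
  assumes "continuous_on UNIV V"
  shows "\<exists>v. \<forall>x y. norm x \<le> R \<longrightarrow> norm y \<le> R \<longrightarrow> V (x, y) \<le> v"
proof -
  have "compact (V ` (cball 0 R \<times> cball 0 R))"
    by (intro compact_continuous_image continuous_on_subset[OF assms] compact_Times compact_cball) simp
  then have "bdd_above (V ` (cball 0 R \<times> cball 0 R))"
    by (intro bounded_imp_bdd_above compact_imp_bounded)
  then obtain v where "\<And>p. p \<in> cball 0 R \<times> cball 0 R \<Longrightarrow> V p \<le> v"
    unfolding bdd_above_def by blast
  then show ?thesis by (intro exI[of _ v]) auto
qed

context em_dissipation begin

text \<open>At a fixed step size all states lie in the r-ball, where U is bounded, so the rate is
  uniform over the whole state space.\<close>

lemma fixed_step_coalescence:
  obtains e :: "nat \<Rightarrow> real" where "e \<longlonglongrightarrow> 0" "\<And>n. 0 \<le> e n"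
    "\<And>n X Y. X \<in> bounded_segments r \<Longrightarrow> Y \<in> bounded_segments r \<Longrightarrow>
      (\<integral>\<^sup>+\<omega>. ennreal (min 1 (mdist (segment_space \<tau>) (iter n X \<omega>) (iter n Y \<omega>))) \<partial>stream_space \<gamma>) \<le> ennreal (e n)"
proof -
  obtain v where v: "\<And>x y. norm x \<le> r \<Longrightarrow> norm y \<le> r \<Longrightarrow> V (x, y) \<le> v"
    using continuous_bounded_on_balls[OF V_cont, of r] by blast
  define u where "u = max 0 (4 * r\<^sup>2 + \<tau> * (\<beta> * (4 * r\<^sup>2) + b4 * v))"
  have u: "U X Y \<le> u" if "X \<in> bounded_segments r" "Y \<in> bounded_segments r" for X Y
    using U_le[OF that v] by (simp add: u_def)
  define w where "w = (1 + \<tau> * Ch) * u / (\<kappa> * \<Delta>)"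
  have w: "0 \<le> w"
    using kappa_pos Delta_pos Ch_nonneg tau_pos by (simp add: w_def u_def)
  \<comment> \<open>N steps are lost in the averaging and N are spent on the maximal inequality, so
    up to 2N the trivial bound 1 is used. Beyond, with t = n - 2N, the choice c = t^(-1/4) makes
    both c and w / (t c^2) tend to 0.\<close>
  define e where "e n = (if n \<le> 2 * N then 1 else real (n - 2 * N) powr (-1/4) + w * real (n - 2 * N) powr (-1/2))" for n
  show thesis
  proof (rule that)
    have "filterlim (\<lambda>n. real (n - 2 * N)) at_top sequentially"
      by (intro filterlim_compose[OF filterlim_real_sequentially] filterlim_minus_const_nat_at_top)
    then have "(\<lambda>n. real (n - 2 * N) powr (-1/4) + w * real (n - 2 * N) powr (-1/2)) \<longlonglongrightarrow> 0 + w * 0"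
      by (intro tendsto_add tendsto_mult tendsto_const tendsto_neg_powr) auto
    moreover have "eventually (\<lambda>n. real (n - 2 * N) powr (-1/4) + w * real (n - 2 * N) powr (-1/2) = e n) sequentially"
      using eventually_gt_at_top[of "2 * N"] by eventually_elim (simp add: e_def)
    ultimately show "e \<longlonglongrightarrow> 0"
      using Lim_transform_eventually by fastforce
    show "0 \<le> e n" for n using w by (simp add: e_def)
    fix n X Y assume X: "X \<in> bounded_segments r" and Y: "Y \<in> bounded_segments r"
    show "(\<integral>\<^sup>+\<omega>. ennreal (min 1 (mdist (segment_space \<tau>) (iter n X \<omega>) (iter n Y \<omega>))) \<partial>stream_space \<gamma>) \<le> ennreal (e n)"
    proof (cases "n \<le> 2 * N")
      case True
      have "(\<integral>\<^sup>+\<omega>. ennreal (min 1 (mdist (segment_space \<tau>) (iter n X \<omega>) (iter n Y \<omega>))) \<partial>stream_space \<gamma>)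
          \<le> (\<integral>\<^sup>+\<omega>. 1 \<partial>stream_space \<gamma>)"
        by (intro nn_integral_mono) (auto intro: order_trans[OF ennreal_leI[of _ 1]])
      then show ?thesis
        using True by (simp add: e_def stream.emeasure_space_1)
    next
      case False
      define t where "t = real (n - 2 * N)"
      define c where "c = t powr (-1/4)"
      have t: "0 < t" using False by (simp add: t_def)
      have c: "0 < c" using t by (simp add: c_def)
      have c2: "c\<^sup>2 = t powr (-1/2)"
        using t by (simp add: c_def power2_eq_square powr_add[symmetric])
      have tc: "t * c\<^sup>2 = 1 / t powr (-1/2)"
        using t unfolding c2 by (simp add: powr_minus powr_add[symmetric] field_simps powr_half_sqrt)
      have n: "N < n - N" "n - N + N = n" "real (n - N - N) = t"
        using False by (auto simp: t_def)
      have "(1 + \<tau> * Ch) * u / (\<kappa> * (t * \<Delta>) * c\<^sup>2) = w * (1 / (t * c\<^sup>2))"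
        by (simp add: w_def mult_ac)
      also have "\<dots> = w * t powr (-1/2)"
        unfolding tc using t by simp
      finally have "c + (1 + \<tau> * Ch) * u / (\<kappa> * (t * \<Delta>) * c\<^sup>2) = e n"
        using False by (simp add: e_def c_def t_def)
      then show ?thesis
        using uniform_coalescence[OF X Y u[OF X Y] c n(1)] unfolding n(2,3) by simp
    qed
  qed
qed

theorem invariant_law_exists: "\<exists>\<pi>. invariant_law \<pi>"
proof -
  obtain e :: "nat \<Rightarrow> real" where e: "e \<longlonglongrightarrow> 0" "\<And>n. 0 \<le> e n"
    "\<And>n X Y. X \<in> bounded_segments r \<Longrightarrow> Y \<in> bounded_segments r \<Longrightarrow>
      (\<integral>\<^sup>+\<omega>. ennreal (min 1 (mdist (segment_space \<tau>) (iter n X \<omega>) (iter n Y \<omega>))) \<partial>stream_space \<gamma>) \<le> ennreal (e n)"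
    by (rule fixed_step_coalescence) (rule that)
  interpret C: coalescing_segments \<tau> \<gamma> step "bounded_segments r" e
    "\<lambda>z. 1 + 2 * \<Delta> * l + 2 * l * norm z" "\<lambda>\<theta>\<in>{-\<tau>..0}. 0"
  proof
    show "bounded_segments r \<in> sets (borel_segment \<tau>)" by (rule sets_bounded_segments[OF r_nonneg])
    show "(\<lambda>\<theta>\<in>{-\<tau>..0}. 0) \<in> bounded_segments r" by (rule restrict_0_bounded[OF r_nonneg])
    show "step X z \<in> bounded_segments r" if "X \<in> bounded_segments r" for X z
      using that by (rule step_bounded)
    show "X \<in> bounded_segments r"
      if "\<And>n::nat. \<sigma> n \<in> bounded_segments r" "X \<in> mspace (segment_space \<tau>)"
        "(\<lambda>n. mdist (segment_space \<tau>) (\<sigma> n) X) \<longlonglongrightarrow> 0" for \<sigma> X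
      using that by (rule bounded_segments_closed)
    show "mdist (segment_space \<tau>) (step X z) (step Y z) \<le> (1 + 2 * \<Delta> * l + 2 * l * norm z) * mdist (segment_space \<tau>) X Y"
      if "X \<in> bounded_segments r" "Y \<in> bounded_segments r" for X Y z
      using that by (rule step_lipschitz)
    show "(\<integral>\<^sup>+\<omega>. ennreal (min 1 (mdist (segment_space \<tau>) (iter n X \<omega>) (iter n Y \<omega>))) \<partial>stream_space \<gamma>) \<le> ennreal (e n)"
      if "X \<in> bounded_segments r" "Y \<in> bounded_segments r" for n X Y
      using that by (rule e(3))
  qed (rule e(1))
  show ?thesis
    using C.invariant_measure_exists unfolding invariant_law_def .
qed

lemma invariant_push:
  assumes \<pi>: "invariant_law \<pi>"
  shows "push n \<pi> = \<pi>"
proof (rule push_unique[symmetric])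
  show sets: "sets \<pi> = sets (borel_segment \<tau>)" "sets \<pi> = sets (borel_segment \<tau>)"
    using invariant_lawD(2)[OF \<pi>] by auto
  fix A :: "(real \<Rightarrow> real^'d) set" assume A: "A \<in> sets (borel_segment \<tau>)"
  have "(\<integral>\<^sup>+x. expect n (indicator A) x \<partial>\<pi>) = (\<integral>\<^sup>+x. indicator A x \<partial>\<pi>)"
    using A by (intro invariant_lawD(4)[OF \<pi>]) simp
  then show "emeasure \<pi> A = (\<integral>\<^sup>+x. expect n (indicator A) x \<partial>\<pi>)"
    using A sets by simp
qed

text \<open>Coalescence requires segments in the r-ball, the bound on U those in the R-ball. For
  laws carried by the r-ball, intersecting the two costs no mass.\<close>

lemma measure_outside_eq:
  assumes "prob_space \<rho>" and sets: "sets \<rho> = sets (borel_segment \<tau>)" and AE: "AE X in \<rho>. X \<in> bounded_segments r"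
    and "0 \<le> R"
  shows "measure \<rho> (space (borel_segment \<tau>) - bounded_segments r \<inter> bounded_segments R)
    = measure \<rho> (space (borel_segment \<tau>) - bounded_segments R)"
proof -
  interpret \<rho>: prob_space \<rho> by fact
  have s: "bounded_segments r \<in> sets \<rho>" "bounded_segments R \<in> sets \<rho>" "space (borel_segment \<tau>) \<in> sets \<rho>"
    using sets_bounded_segments[OF r_nonneg] sets_bounded_segments[OF \<open>0 \<le> R\<close>] sets.top[of "borel_segment \<tau>"]
    unfolding sets by auto
  show ?thesis
    using AE by (intro \<rho>.finite_measure_eq_AE sets.Diff sets.Int s) (auto elim!: eventually_mono)
qed

text \<open>The rate may depend on \<Delta> here, and in return there is no tail term; this version
  proves uniqueness of the invariant measure.\<close>

theorem FM_fixed_step: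
  obtains e :: "nat \<Rightarrow> real" where "e \<longlonglongrightarrow> 0"
    "\<And>n P Q \<Psi>. prob_space P \<Longrightarrow> sets P = sets (borel_segment \<tau>) \<Longrightarrow> (AE X in P. X \<in> bounded_segments r) \<Longrightarrow>
       prob_space Q \<Longrightarrow> sets Q = sets (borel_segment \<tau>) \<Longrightarrow> (AE X in Q. X \<in> bounded_segments r) \<Longrightarrow>
       \<Psi> \<in> FM_functions \<tau> \<Longrightarrow> \<bar>(\<integral>Y. \<Psi> Y \<partial>push n P) - (\<integral>Y. \<Psi> Y \<partial>push n Q)\<bar> \<le> e n"
proof -
  obtain e :: "nat \<Rightarrow> real" where e: "e \<longlonglongrightarrow> 0" "\<And>n. 0 \<le> e n"
    "\<And>n X Y. X \<in> bounded_segments r \<Longrightarrow> Y \<in> bounded_segments r \<Longrightarrow>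
      (\<integral>\<^sup>+\<omega>. ennreal (min 1 (mdist (segment_space \<tau>) (iter n X \<omega>) (iter n Y \<omega>))) \<partial>stream_space \<gamma>) \<le> ennreal (e n)"
    by (rule fixed_step_coalescence) (rule that)
  show thesis
  proof (rule that)
    show "(\<lambda>n. 2 * e n) \<longlonglongrightarrow> 0"
      using tendsto_mult[OF tendsto_const[of 2] e(1)] by simp
    fix n and P Q :: "(real \<Rightarrow> real^'d) measure" and \<Psi> :: "(real \<Rightarrow> real^'d) \<Rightarrow> real"
    assume P: "prob_space P" "sets P = sets (borel_segment \<tau>)" "AE X in P. X \<in> bounded_segments r"
      and Q: "prob_space Q" "sets Q = sets (borel_segment \<tau>)" "AE X in Q. X \<in> bounded_segments r"
      and \<Psi>: "\<Psi> \<in> FM_functions \<tau>"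
    have 0: "measure \<rho> (space (borel_segment \<tau>) - bounded_segments r) = 0"
      if "prob_space \<rho>" "sets \<rho> = sets (borel_segment \<tau>)" "AE X in \<rho>. X \<in> bounded_segments r"
      for \<rho> :: "(real \<Rightarrow> real^'d) measure"
    proof -
      interpret \<rho>: prob_space \<rho> by fact
      have "bounded_segments r \<in> sets \<rho>" using sets_bounded_segments[OF r_nonneg] that(2) by simp
      moreover have "space \<rho> = space (borel_segment \<tau>)" using sets_eq_imp_space_eq[OF that(2)] .
      ultimately show ?thesis
        using that(3) \<rho>.prob_eq_1[of "bounded_segments r"] \<rho>.prob_compl[of "bounded_segments r"] by simp
    qed
    show "\<bar>(\<integral>Y. \<Psi> Y \<partial>push n P) - (\<integral>Y. \<Psi> Y \<partial>push n Q)\<bar> \<le> 2 * e n"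
      using FM_push_close[OF P(1) Q(1) P(2) Q(2) sets_bounded_segments[OF r_nonneg] e(3) e(2) \<Psi>, of n] 0[OF P] 0[OF Q]
      by simp
  qed
qed

text \<open>Since the invariant law is unchanged by n + N steps, it can play the second initial law.
  Apart from the tail of \<rho>, the step enters the bound only through q and the elapsed time (n -
  N) \<Delta>.\<close>

theorem FM_uniform:
  assumes \<pi>: "invariant_law \<pi>"
    and \<rho>: "prob_space \<rho>" "sets \<rho> = sets (borel_segment \<tau>)" "AE X in \<rho>. X \<in> bounded_segments r"
    and R: "0 < R" and v: "\<And>x y. norm x \<le> R \<Longrightarrow> norm y \<le> R \<Longrightarrow> V (x, y) \<le> v"
    and c: "0 < c" and n: "N < n" and \<Psi>: "\<Psi> \<in> FM_functions \<tau>"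
  shows "\<bar>(\<integral>Y. \<Psi> Y \<partial>push (n + N) \<rho>) - (\<integral>Y. \<Psi> Y \<partial>\<pi>)\<bar>
    \<le> 2 * (c + (1 + \<tau> * Ch) * (4 * R\<^sup>2 + \<tau> * (\<beta> * (4 * R\<^sup>2) + b4 * v)) / (\<kappa> * (real (n - N) * \<Delta>) * c\<^sup>2))
      + 2 * measure \<rho> (space (borel_segment \<tau>) - bounded_segments R) + 2 * (energy_bound / R\<^sup>2)"
proof -
  let ?B = "bounded_segments r \<inter> bounded_segments R"
  let ?u = "4 * R\<^sup>2 + \<tau> * (\<beta> * (4 * R\<^sup>2) + b4 * v)"
  let ?\<epsilon> = "c + (1 + \<tau> * Ch) * ?u / (\<kappa> * (real (n - N) * \<Delta>) * c\<^sup>2)"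
  have B: "?B \<in> sets (borel_segment \<tau>)"
    using R r_nonneg by (intro sets.Int sets_bounded_segments) auto
  have v0: "0 \<le> v"
    using v[of 0 0] V_nonneg[of "(0, 0)"] R by simp
  have u0: "0 \<le> ?u"
    using beta_nonneg b_nonneg tau_pos v0 by simp
  have \<epsilon>: "0 \<le> ?\<epsilon>"
    using c u0 kappa_pos Delta_pos n Ch_nonneg tau_pos by simp
  have "\<bar>(\<integral>Y. \<Psi> Y \<partial>push (n + N) \<rho>) - (\<integral>Y. \<Psi> Y \<partial>push (n + N) \<pi>)\<bar>
    \<le> 2 * ?\<epsilon> + 2 * measure \<rho> (space (borel_segment \<tau>) - ?B) + 2 * measure \<pi> (space (borel_segment \<tau>) - ?B)"
  proof (rule FM_push_close[OF \<rho>(1) invariant_lawD(1)[OF \<pi>] \<rho>(2) invariant_lawD(2)[OF \<pi>] B _ \<epsilon> \<Psi>])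
    fix X Y assume X: "X \<in> ?B" and Y: "Y \<in> ?B"
    have "U X Y \<le> ?u"
      using X Y by (intro U_le v) auto
    then show "(\<integral>\<^sup>+\<omega>. ennreal (min 1 (mdist (segment_space \<tau>) (iter (n + N) X \<omega>) (iter (n + N) Y \<omega>))) \<partial>stream_space \<gamma>) \<le> ennreal ?\<epsilon>"
      using X Y by (intro uniform_coalescence c n) auto
  qed
  moreover have "measure \<rho> (space (borel_segment \<tau>) - ?B) = measure \<rho> (space (borel_segment \<tau>) - bounded_segments R)"
    using R by (intro measure_outside_eq \<rho>) simp
  moreover have "measure \<pi> (space (borel_segment \<tau>) - ?B) = measure \<pi> (space (borel_segment \<tau>) - bounded_segments R)"
    using R by (intro measure_outside_eq invariant_lawD(1-3)[OF \<pi>]) simp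
  ultimately show ?thesis
    using stationary_tightness[OF \<pi> R] unfolding invariant_push[OF \<pi>] by linarith
qed

end

section \<open>The scheme driven by a path\<close>

context
  fixes f :: "(real^'d) \<times> (real^'d) \<Rightarrow> real^'d" and g :: "(real^'d) \<times> (real^'d) \<Rightarrow> real^'m^'d"
    and r \<Delta> :: real and N :: nat and w :: "real \<Rightarrow> real^'m" and x :: "real \<Rightarrow> real^'d"
  assumes Delta_pos: "0 < \<Delta>"
begin

text \<open>At a positive grid point the floor selects the interval to its right, where the weight
  of the left node is 1.\<close>

lemma em_path_grid: "em_path f g r N \<Delta> w x (of_int k * \<Delta>) = em_node f g r N \<Delta> w x k"
proof (cases "k \<le> 0")
  case True
  then have "of_int k * \<Delta> \<le> 0"
    using Delta_pos by (simp add: mult_nonpos_nonneg)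
  then show ?thesis
    using True by (simp add: em_path_def em_node_def em_pre.simps)
next
  case False
  then have "\<not> of_int k * \<Delta> \<le> 0"
    using Delta_pos by (simp add: mult_le_0_iff)
  moreover have "(of_int (k + 1) * \<Delta> - of_int k * \<Delta>) / \<Delta> = 1"
    using Delta_pos by (simp add: field_simps)
  ultimately show ?thesis
    using Delta_pos by (simp add: em_path_def Let_def)
qed

lemma em_path_between:
  assumes "of_int k * \<Delta> < t" "t < of_int (k + 1) * \<Delta>" "0 \<le> k"
  shows "em_path f g r N \<Delta> w x t =
    ((of_int (k + 1) * \<Delta> - t) / \<Delta>) *\<^sub>R em_node f g r N \<Delta> w x k
    + ((t - of_int k * \<Delta>) / \<Delta>) *\<^sub>R em_node f g r N \<Delta> w x (k + 1)"
proof -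
  have "0 \<le> of_int k * \<Delta>" using assms Delta_pos by simp
  then have t: "\<not> t \<le> 0" using assms by linarith
  have "\<lfloor>t / \<Delta>\<rfloor> = k"
    using assms Delta_pos by (intro floor_unique) (simp_all add: field_simps)
  then show ?thesis
    using t by (simp add: em_path_def Let_def)
qed

lemma em_node_Suc:
  "em_node f g r N \<Delta> w x (int k + 1) =
    trunc r (em_node f g r N \<Delta> w x (int k)
      + \<Delta> *\<^sub>R f (em_node f g r N \<Delta> w x (int k), em_node f g r N \<Delta> w x (int k - int N))
      + g (em_node f g r N \<Delta> w x (int k), em_node f g r N \<Delta> w x (int k - int N))
        *v (w (real (Suc k) * \<Delta>) - w (real k * \<Delta>)))"
  by (subst em_node_def, subst em_pre.simps) (simp add: em_node_def add.commute)

end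

lemma em_segment_0:
  "em_segment f g \<Phi> \<nu> \<tau> N w x 0 = (\<lambda>\<theta>\<in>{-\<tau>..0}. trunc (trunc_radius f g \<Phi> \<nu> (\<tau> / real N)) (x \<theta>))"
  by (auto simp: em_segment_def Let_def em_path_def fun_eq_iff)

text \<open>The next segment depends on the path only through the preceding segment and the last
  increment: the delayed node with index k - N is the value of the preceding segment at
  -\<tau>.\<close>

lemma em_segment_Suc:
  assumes "0 < \<tau>" "0 < N"
  shows "em_segment f g \<Phi> \<nu> \<tau> N w x (Suc k) =
    em_step f g (trunc_radius f g \<Phi> \<nu> (\<tau> / real N)) \<tau> (\<tau> / real N) (em_segment f g \<Phi> \<nu> \<tau> N w x k)
      (w (real (Suc k) * (\<tau> / real N)) - w (real k * (\<tau> / real N)))"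
proof
  fix \<theta>
  define \<Delta> where "\<Delta> = \<tau> / real N"
  define r where "r = trunc_radius f g \<Phi> \<nu> \<Delta>"
  have \<Delta>: "0 < \<Delta>" "real N * \<Delta> = \<tau>" using assms by (auto simp: \<Delta>_def)
  let ?n = "em_node f g r N \<Delta> w x" and ?p = "em_path f g r N \<Delta> w x"
  let ?S = "em_segment f g \<Phi> \<nu> \<tau> N w x"
  have seg: "?S j \<theta> = (if \<theta> \<in> {-\<tau>..0} then ?p (real j * \<Delta> + \<theta>) else undefined)" for j \<theta>
    by (simp add: em_segment_def Let_def \<Delta>_def r_def)
  have s0: "?S k 0 = ?n (int k)"
    using assms em_path_grid[OF \<Delta>(1), of f g r N w x "int k"] by (simp add: seg)
  have s1: "?S k (-\<tau>) = ?n (int k - int N)"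
  proof -
    have "real k * \<Delta> + - \<tau> = of_int (int k - int N) * \<Delta>"
      using \<Delta>(2) by (simp add: algebra_simps)
    then show ?thesis
      using assms em_path_grid[OF \<Delta>(1), of f g r N w x "int k - int N"] by (simp only: seg) simp
  qed
  let ?z = "w (real (Suc k) * \<Delta>) - w (real k * \<Delta>)"
  have nx: "em_next f g r \<tau> \<Delta> (?S k) ?z = ?n (int k + 1)"
    unfolding em_next_def s0 s1 em_node_Suc[OF \<Delta>(1)] ..
  have "?S (Suc k) \<theta> = em_step f g r \<tau> \<Delta> (?S k) ?z \<theta>"
  proof (cases "\<theta> \<in> {-\<tau>..0}")
    case False
    then show ?thesis by (simp only: seg em_step_def restrict_apply if_False)
  next
    case True
    show ?thesis
    proof (cases "\<theta> \<le> -\<Delta>")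
      case le: True
      then have "\<theta> + \<Delta> \<in> {-\<tau>..0}" using True \<Delta> by auto
      then show ?thesis
        using True le by (simp add: seg em_step_def algebra_simps)
    next
      case gt: False
      have rhs: "em_step f g r \<tau> \<Delta> (?S k) ?z \<theta> = (-\<theta> / \<Delta>) *\<^sub>R ?n (int k) + ((\<theta> + \<Delta>) / \<Delta>) *\<^sub>R ?n (int k + 1)"
        using True gt by (simp only: em_step_def restrict_apply if_True if_False s0 nx)
      show ?thesis
      \<comment> \<open>At \<theta> = 0 the time is the next grid point, for which the floor has
        already moved on; \<open>em_path_grid\<close> settles it.\<close>
      proof (cases "\<theta> = 0")
        case True
        have "?S (Suc k) 0 = ?n (int k + 1)"
          using assms em_path_grid[OF \<Delta>(1), of f g r N w x "int k + 1"] by (simp add: seg add.commute)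
        then show ?thesis
          unfolding rhs using True \<Delta> by simp
      next
        case ne: False
        have "?p (real (Suc k) * \<Delta> + \<theta>) = ((of_int (int k + 1) * \<Delta> - (real (Suc k) * \<Delta> + \<theta>)) / \<Delta>) *\<^sub>R ?n (int k)
            + (((real (Suc k) * \<Delta> + \<theta>) - of_int (int k) * \<Delta>) / \<Delta>) *\<^sub>R ?n (int k + 1)"
          using True gt ne by (intro em_path_between[OF \<Delta>(1)]) (auto simp: algebra_simps)
        also have "of_int (int k + 1) * \<Delta> - (real (Suc k) * \<Delta> + \<theta>) = - \<theta>"
          by (simp add: algebra_simps)
        also have "(real (Suc k) * \<Delta> + \<theta>) - of_int (int k) * \<Delta> = \<theta> + \<Delta>"
          by (simp add: algebra_simps)
        finally show ?thesis
          unfolding rhs using True by (simp only: seg if_True)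
      qed
    qed
  qed
  then show "?S (Suc k) \<theta> = em_step f g (trunc_radius f g \<Phi> \<nu> (\<tau> / real N)) \<tau> (\<tau> / real N) (?S k)
      (w (real (Suc k) * (\<tau> / real N)) - w (real k * (\<tau> / real N))) \<theta>"
    by (simp only: \<Delta>_def r_def)
qed

section \<open>Brownian increments\<close>

definition isotropic_gaussian :: "real \<Rightarrow> (real^'m) measure" where
  "isotropic_gaussian \<Delta> =
     distr (\<Pi>\<^sub>M i\<in>UNIV. density lborel (\<lambda>x. ennreal (normal_density 0 (sqrt \<Delta>) x))) borel (\<lambda>x. \<chi> i. x i)"

lemma measurable_vec_lambda_PiM:
  "(\<lambda>x. \<chi> i. x i) \<in> borel_measurable (\<Pi>\<^sub>M i\<in>(UNIV :: 'm::finite set). (borel :: real measure))"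
  unfolding borel_measurable_euclidean_space[where 'c="real^'m"]
  by (auto simp: Basis_vec_def inner_axis)

locale brownian = prob_space M for M :: "'w measure" +
  fixes F :: "real \<Rightarrow> 'w measure" and W :: "real \<Rightarrow> 'w \<Rightarrow> real^'m"
  assumes filtration: "usual_filtration M F" and brownian_motion: "brownian_motion M F W"
begin

lemma subalgebra_F: "0 \<le> t \<Longrightarrow> subalgebra M (F t)"
  using filtration by (simp add: usual_filtration_def)

lemma space_F: "0 \<le> t \<Longrightarrow> space (F t) = space M"
  using subalgebra_F by (simp add: subalgebra_def)

lemma sets_F_mono: "0 \<le> s \<Longrightarrow> s \<le> t \<Longrightarrow> sets (F s) \<subseteq> sets (F t)"
  using filtration unfolding usual_filtration_def by blast

lemma measurable_F_mono:
  assumes "0 \<le> s" "s \<le> t" "h \<in> F s \<rightarrow>\<^sub>M L"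
  shows "h \<in> F t \<rightarrow>\<^sub>M L"
  using assms sets_F_mono[OF assms(1,2)] space_F[of s] space_F[of t] unfolding measurable_def by auto

lemma measurable_W: "0 \<le> t \<Longrightarrow> W t \<in> borel_measurable (F t)"
  using brownian_motion by (simp add: brownian_motion_def)

lemma measurable_W_M [measurable]: "0 \<le> t \<Longrightarrow> W t \<in> borel_measurable M"
  using measurable_from_subalg[OF subalgebra_F measurable_W] .

lemma increment_measurable: "0 \<le> s \<Longrightarrow> s < t \<Longrightarrow> (\<lambda>\<omega>. W t \<omega> - W s \<omega>) \<in> borel_measurable M"
  by (intro borel_measurable_diff measurable_W_M) auto

lemma increment_components:
  assumes "0 \<le> s" "s < t"
  shows "indep_vars (\<lambda>_. borel) (\<lambda>i \<omega>. (W t \<omega> - W s \<omega>) $ i) UNIV"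
    "distributed M lborel (\<lambda>\<omega>. (W t \<omega> - W s \<omega>) $ i) (\<lambda>x. ennreal (normal_density 0 (sqrt (t - s)) x))"
    "indep_set (sets (F s)) (sets (vimage_algebra (space M) (\<lambda>\<omega>. W t \<omega> - W s \<omega>) borel))"
  using assms brownian_motion by (auto simp: brownian_motion_def)

text \<open>Independence of the coordinates makes their joint law a product. It depends on t - s
  alone, so every step of the scheme uses the same noise measure.\<close>

lemma increment_law:
  assumes "0 \<le> s" "s < t"
  shows "distr M borel (\<lambda>\<omega>. W t \<omega> - W s \<omega>) = isotropic_gaussian (t - s)"
proof -
  let ?Z = "\<lambda>\<omega>. W t \<omega> - W s \<omega>"
  note [measurable] = increment_measurable[OF assms]
  have Zi [measurable]: "(\<lambda>\<omega>. ?Z \<omega> $ i) \<in> borel_measurable M" for i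
    by (intro measurable_compose[OF increment_measurable[OF assms]] borel_measurable_continuous_onI continuous_intros)
  have "distr M (\<Pi>\<^sub>M i\<in>UNIV. borel) (\<lambda>\<omega>. \<lambda>i\<in>UNIV. ?Z \<omega> $ i) = (\<Pi>\<^sub>M i\<in>UNIV. distr M borel (\<lambda>\<omega>. ?Z \<omega> $ i))"
    using increment_components(1)[OF assms] indep_vars_iff_distr_eq_PiM[where I=UNIV and M'="\<lambda>_. borel" and X="\<lambda>i \<omega>. ?Z \<omega> $ i", OF _ Zi] by simp
  also have "\<dots> = (\<Pi>\<^sub>M i\<in>UNIV. density lborel (\<lambda>x. ennreal (normal_density 0 (sqrt (t - s)) x)))"
  proof (intro PiM_cong refl)
    fix i :: 'm
    have "distr M borel (\<lambda>\<omega>. ?Z \<omega> $ i) = distr M lborel (\<lambda>\<omega>. ?Z \<omega> $ i)"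
      by (rule distr_cong) auto
    then show "distr M borel (\<lambda>\<omega>. ?Z \<omega> $ i) = density lborel (\<lambda>x. ennreal (normal_density 0 (sqrt (t - s)) x))"
      using increment_components(2)[OF assms, of i] by (simp add: distributed_def)
  qed
  finally have *: "distr M (\<Pi>\<^sub>M i\<in>UNIV. borel) (\<lambda>\<omega>. \<lambda>i\<in>UNIV. ?Z \<omega> $ i)
     = (\<Pi>\<^sub>M i\<in>UNIV. density lborel (\<lambda>x. ennreal (normal_density 0 (sqrt (t - s)) x)))" .
  have "distr M borel ?Z = distr (distr M (\<Pi>\<^sub>M i\<in>UNIV. borel) (\<lambda>\<omega>. \<lambda>i\<in>UNIV. ?Z \<omega> $ i)) borel (\<lambda>x. \<chi> i. x i)"
    by (subst distr_distr[OF measurable_vec_lambda_PiM])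
       (auto simp: comp_def vec_eq_iff intro!: distr_cong measurable_restrict)
  then show ?thesis
    unfolding * isotropic_gaussian_def .
qed

text \<open>The moments are read off from the Brownian increment over [0, \<Delta>], which has this
  law; its coordinates are independent normal variables, so mixed second moments factor and
  vanish.\<close>

lemma isotropic_noise_gaussian:
  assumes \<Delta>: "0 < \<Delta>"
  shows "isotropic_noise (isotropic_gaussian \<Delta> :: (real^'m) measure) \<Delta>"
proof -
  let ?Z = "\<lambda>\<omega>. W \<Delta> \<omega> - W 0 \<omega>"
  have law: "isotropic_gaussian \<Delta> = distr M borel ?Z"
    using increment_law[of 0 \<Delta>] \<Delta> by simp
  have Z [measurable]: "?Z \<in> borel_measurable M"
    using increment_measurable[of 0 \<Delta>] \<Delta> by simp
  have comp [measurable]: "(\<lambda>z::real^'m. z $ i) \<in> borel_measurable borel" for i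
    by (intro borel_measurable_continuous_onI continuous_intros)
  have D: "distributed M lborel (\<lambda>\<omega>. ?Z \<omega> $ i) (\<lambda>x. ennreal (normal_density 0 (sqrt \<Delta>) x))" for i
    using increment_components(2)[of 0 \<Delta> i] \<Delta> by simp
  have s: "0 < sqrt \<Delta>" using \<Delta> by simp
  have int1: "integrable M (\<lambda>\<omega>. ?Z \<omega> $ i)" for i
    using distributed_integrable[OF D[of i], of "\<lambda>x. x"] integrable_normal_moment[OF s, of 0 1] by simp
  have int2: "integrable M (\<lambda>\<omega>. (?Z \<omega> $ i)\<^sup>2)" for i
    using distributed_integrable[OF D[of i], of "\<lambda>x. x\<^sup>2"] integrable_normal_moment[OF s, of 0 2] by simp
  have E1: "expectation (\<lambda>\<omega>. ?Z \<omega> $ i) = 0" for i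
    by (rule normal_distributed_expectation[OF s D])
  have E2: "expectation (\<lambda>\<omega>. (?Z \<omega> $ i)\<^sup>2) = \<Delta>" for i
  proof -
    have "expectation (\<lambda>\<omega>. (?Z \<omega> $ i - expectation (\<lambda>\<omega>. ?Z \<omega> $ i))\<^sup>2) = (sqrt \<Delta>)\<^sup>2"
      by (rule normal_distributed_variance[OF s D])
    moreover have "(sqrt \<Delta>)\<^sup>2 = \<Delta>" using \<Delta> by simp
    ultimately show ?thesis by (simp only: E1 diff_zero)
  qed
  have mixed: "integrable M (\<lambda>\<omega>. ?Z \<omega> $ i * ?Z \<omega> $ j) \<and> expectation (\<lambda>\<omega>. ?Z \<omega> $ i * ?Z \<omega> $ j) = 0" if "i \<noteq> j" for i j
  proof -
    have "indep_vars (\<lambda>_. borel) (\<lambda>i \<omega>. ?Z \<omega> $ i) {i, j}"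
      by (rule indep_vars_subset[OF increment_components(1)[OF order_refl \<Delta>] subset_UNIV])
    from indep_vars_lebesgue_integral[OF _ this int1] indep_vars_integrable[OF _ this int1] finite.intros
    have "integrable M (\<lambda>\<omega>. \<Prod>k\<in>{i, j}. ?Z \<omega> $ k)"
      "expectation (\<lambda>\<omega>. \<Prod>k\<in>{i, j}. ?Z \<omega> $ k) = (\<Prod>k\<in>{i, j}. expectation (\<lambda>\<omega>. ?Z \<omega> $ k))"
      by blast+
    moreover have "(\<Prod>k\<in>{i, j}. h k) = h i * h j" for h :: "'m \<Rightarrow> real"
      using that by simp
    ultimately show ?thesis by (simp only: E1 mult_zero_left simp_thms)
  qed
  show ?thesis
    unfolding isotropic_noise_def isotropic_noise_axioms_def
  proof (intro conjI allI)
    show "prob_space (isotropic_gaussian \<Delta> :: (real^'m) measure)"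
      unfolding law by (rule prob_space_distr[OF Z])
    show "sets (isotropic_gaussian \<Delta> :: (real^'m) measure) = sets borel"
      by (simp add: isotropic_gaussian_def)
    have comp2: "(\<lambda>z::real^'m. z $ i * z $ j) \<in> borel_measurable borel" for i j
      by (intro borel_measurable_times comp)
    show "integrable (isotropic_gaussian \<Delta>) (\<lambda>z::real^'m. z $ i)" for i
      unfolding law integrable_distr_eq[OF Z comp] by (rule int1)
    show "(\<integral>z. z $ i \<partial>(isotropic_gaussian \<Delta> :: (real^'m) measure)) = 0" for i
      unfolding law integral_distr[OF Z comp] by (rule E1)
    show "integrable (isotropic_gaussian \<Delta>) (\<lambda>z::real^'m. z $ i * z $ j)" for i j
      unfolding law integrable_distr_eq[OF Z comp2]
      using mixed[of i j] int2[of i] by (cases "i = j") (simp_all only: power2_eq_square simp_thms)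
    show "(\<integral>z. z $ i * z $ j \<partial>(isotropic_gaussian \<Delta> :: (real^'m) measure)) = (if i = j then \<Delta> else 0)" for i j
      unfolding law integral_distr[OF Z comp2]
      using mixed[of i j] E2[of i] by (cases "i = j") (simp_all only: power2_eq_square if_True if_False simp_thms)
  qed
qed

text \<open>The past and the next increment are independent, which on measurable rectangles is the
  product formula. This is where adaptedness to the filtration is exploited.\<close>

lemma distr_increment_pair:
  assumes s: "0 \<le> s" "s < t" and Y: "Y \<in> F s \<rightarrow>\<^sub>M L"
  shows "distr M (L \<Otimes>\<^sub>M borel) (\<lambda>\<omega>. (Y \<omega>, W t \<omega> - W s \<omega>)) = distr M L Y \<Otimes>\<^sub>M isotropic_gaussian (t - s)"
proof -
  let ?Z = "\<lambda>\<omega>. W t \<omega> - W s \<omega>"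
  have YM: "Y \<in> M \<rightarrow>\<^sub>M L"
    by (rule measurable_from_subalg[OF subalgebra_F[OF s(1)] Y])
  have ZM: "?Z \<in> borel_measurable M"
    by (rule increment_measurable[OF s])
  have pair: "(\<lambda>\<omega>. (Y \<omega>, ?Z \<omega>)) \<in> M \<rightarrow>\<^sub>M L \<Otimes>\<^sub>M borel"
    by (rule measurable_Pair[OF YM ZM])
  interpret Y: prob_space "distr M L Y" by (rule prob_space_distr[OF YM])
  interpret Z: prob_space "distr M borel ?Z" by (rule prob_space_distr[OF ZM])
  have "distr M L Y \<Otimes>\<^sub>M distr M borel ?Z = distr M (L \<Otimes>\<^sub>M borel) (\<lambda>\<omega>. (Y \<omega>, ?Z \<omega>))"
  proof (rule pair_measure_eqI)
    show "sets (distr M L Y \<Otimes>\<^sub>M distr M borel ?Z) = sets (distr M (L \<Otimes>\<^sub>M borel) (\<lambda>\<omega>. (Y \<omega>, ?Z \<omega>)))"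
      by (simp cong: sets_pair_measure_cong)
    fix A B assume "A \<in> sets (distr M L Y)" "B \<in> sets (distr M borel ?Z)"
    then have A: "A \<in> sets L" and B: "B \<in> sets borel" by auto
    have YA: "Y -` A \<inter> space M \<in> sets (F s)"
      using measurable_sets[OF Y A] space_F[OF s(1)] by simp
    have ZB: "?Z -` B \<inter> space M \<in> sets (vimage_algebra (space M) ?Z borel)"
      using B by (rule in_vimage_algebra)
    have "prob ((Y -` A \<inter> space M) \<inter> (?Z -` B \<inter> space M)) = prob (Y -` A \<inter> space M) * prob (?Z -` B \<inter> space M)"
      using increment_components(3)[OF s] YA ZB unfolding indep_sets2_eq by blast
    moreover have "(\<lambda>\<omega>. (Y \<omega>, ?Z \<omega>)) -` (A \<times> B) \<inter> space M = (Y -` A \<inter> space M) \<inter> (?Z -` B \<inter> space M)"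
      by auto
    ultimately show "emeasure (distr M L Y) A * emeasure (distr M borel ?Z) B
        = emeasure (distr M (L \<Otimes>\<^sub>M borel) (\<lambda>\<omega>. (Y \<omega>, ?Z \<omega>))) (A \<times> B)"
      using A B by (simp add: emeasure_distr[OF YM] emeasure_distr[OF ZM] emeasure_distr[OF pair]
          emeasure_eq_measure ennreal_mult)
  qed (rule Y.sigma_finite_measure_axioms Z.sigma_finite_measure_axioms)+
  then show ?thesis
    by (simp only: increment_law[OF s])
qed

end

section \<open>The law of the scheme\<close>

context em_map begin

text \<open>The scheme truncates the initial segment before the first step, so its states lie in the
  r-ball even if the initial data are unbounded.\<close>

definition trunc_segment :: "(real \<Rightarrow> real^'d) \<Rightarrow> real \<Rightarrow> real^'d" where
  "trunc_segment X = (\<lambda>\<theta>\<in>{-\<tau>..0}. trunc r (X \<theta>))"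

lemma trunc_segment_mem:
  "X \<in> mspace (segment_space \<tau>) \<Longrightarrow> trunc_segment X \<in> mspace (segment_space \<tau>)"
  unfolding trunc_segment_def restrict_mem_mspace_iff
  by (intro continuous_on_trunc[OF r_nonneg]) (simp add: mspace_segment_iff)

lemma trunc_segment_bounded:
  "X \<in> mspace (segment_space \<tau>) \<Longrightarrow> trunc_segment X \<in> bounded_segments r"
  using trunc_segment_mem[of X]
  by (simp add: bounded_segments_def) (simp add: trunc_segment_def norm_trunc_le[OF r_nonneg])

lemma trunc_segment_id: "X \<in> bounded_segments r \<Longrightarrow> trunc_segment X = X"
  by (force simp: trunc_segment_def bounded_segments_def mspace_segment_iff extensional_def fun_eq_iff trunc_id)

lemma norm_trunc_segment_le: "\<theta> \<in> {-\<tau>..0} \<Longrightarrow> norm (trunc_segment X \<theta>) \<le> norm (X \<theta>)"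
  using norm_trunc[OF r_nonneg, of "X \<theta>"] by (simp add: trunc_segment_def)

lemma measurable_trunc_segment:
  assumes "h \<in> L \<rightarrow>\<^sub>M borel_segment \<tau>"
  shows "(\<lambda>\<omega>. trunc_segment (h \<omega>)) \<in> L \<rightarrow>\<^sub>M borel_segment \<tau>"
proof (rule measurable_borel_segmentI)
  show "trunc_segment (h \<omega>) \<in> mspace (segment_space \<tau>)" if "\<omega> \<in> space L" for \<omega>
    using trunc_segment_mem measurable_space[OF assms that] by simp
  fix \<theta> assume "\<theta> \<in> {-\<tau>..0}"
  then show "(\<lambda>\<omega>. trunc_segment (h \<omega>) \<theta>) \<in> borel_measurable L"
    using borel_measurable_trunc[OF measurable_eval[OF assms]] by (simp add: trunc_segment_def)
qed

end

context brownian begin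

context
  fixes f :: "(real^'d) \<times> (real^'d) \<Rightarrow> real^'d" and g :: "(real^'d) \<times> (real^'d) \<Rightarrow> real^'m^'d"
    and \<Phi> :: "real \<Rightarrow> real" and \<nu> \<tau> l :: real and N :: nat
  assumes em: "em_map \<tau> (isotropic_gaussian (\<tau> / real N) :: (real^'m) measure) (\<tau> / real N) f g (trunc_radius f g \<Phi> \<nu> (\<tau> / real N)) N l"
begin

interpretation E: em_map \<tau> "isotropic_gaussian (\<tau> / real N) :: (real^'m) measure" "\<tau> / real N" f g "trunc_radius f g \<Phi> \<nu> (\<tau> / real N)" N l
  by (rule em)

context
  fixes \<xi> :: "'w \<Rightarrow> real \<Rightarrow> real^'d"
  assumes \<xi>: "\<xi> \<in> F 0 \<rightarrow>\<^sub>M borel_segment \<tau>"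
begin

definition "seg k \<omega> = em_segment f g \<Phi> \<nu> \<tau> N (\<lambda>t. W t \<omega>) (\<xi> \<omega>) k"

lemma seg_0: "seg 0 = (\<lambda>\<omega>. E.trunc_segment (\<xi> \<omega>))"
  by (simp add: seg_def em_segment_0 E.trunc_segment_def fun_eq_iff)

lemma seg_Suc: "seg (Suc k) \<omega> = E.step (seg k \<omega>) (W (real (Suc k) * (\<tau> / real N)) \<omega> - W (real k * (\<tau> / real N)) \<omega>)"
  unfolding seg_def by (rule em_segment_Suc[OF E.tau_pos E.N_pos])

lemma grid_time: "0 \<le> real k * (\<tau> / real N)" "real k * (\<tau> / real N) < real (Suc k) * (\<tau> / real N)"
  "real (Suc k) * (\<tau> / real N) - real k * (\<tau> / real N) = \<tau> / real N"
proof -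
  show "0 \<le> real k * (\<tau> / real N)"
    using E.tau_pos by simp
  show "real k * (\<tau> / real N) < real (Suc k) * (\<tau> / real N)"
    using E.Delta_pos by (intro mult_strict_right_mono) auto
  show "real (Suc k) * (\<tau> / real N) - real k * (\<tau> / real N) = \<tau> / real N"
    by (simp only: left_diff_distrib[symmetric]) simp
qed

text \<open>\<open>seg k\<close> has to be known at time k \<Delta>, and not merely measurable, for
  the next increment to be independent of it.\<close>

lemma seg_measurable: "seg k \<in> F (real k * (\<tau> / real N)) \<rightarrow>\<^sub>M borel_segment \<tau>"
proof (induction k)
  case 0
  then show ?case using E.measurable_trunc_segment[OF \<xi>] by (simp add: seg_0)
next
  case (Suc k)
  let ?t = "real (Suc k) * (\<tau> / real N)" and ?s = "real k * (\<tau> / real N)"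
  note t = grid_time[of k]
  have s: "seg k \<in> F ?t \<rightarrow>\<^sub>M borel_segment \<tau>"
    by (rule measurable_F_mono[OF t(1) less_imp_le[OF t(2)] Suc])
  have "W ?s \<in> borel_measurable (F ?t)"
    by (rule measurable_F_mono[OF t(1) less_imp_le[OF t(2)] measurable_W[OF t(1)]])
  moreover have "W ?t \<in> borel_measurable (F ?t)"
    using t by (intro measurable_W) linarith
  ultimately have "(\<lambda>\<omega>. W ?t \<omega> - W ?s \<omega>) \<in> borel_measurable (F ?t)"
    by (intro borel_measurable_diff)
  then have z: "(\<lambda>\<omega>. W ?t \<omega> - W ?s \<omega>) \<in> F ?t \<rightarrow>\<^sub>M (isotropic_gaussian (\<tau> / real N) :: (real^'m) measure)"
    by (simp only: measurable_cong_sets[OF refl E.sets_noise])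
  have "seg (Suc k) = (\<lambda>\<omega>. E.step (seg k \<omega>) (W ?t \<omega> - W ?s \<omega>))"
    by (simp add: seg_Suc fun_eq_iff)
  then show ?case
    using E.measurable_map2[OF s z] by (simp only:)
qed

lemma seg_measurable_M: "seg k \<in> M \<rightarrow>\<^sub>M borel_segment \<tau>"
  by (rule measurable_from_subalg[OF subalgebra_F[OF grid_time(1)] seg_measurable])

text \<open>The last step is split off: the independent increment is integrated out for given
  \<open>seg k\<close>, and the induction hypothesis is applied to the averaged function.\<close>

lemma nn_integral_seg:
  assumes "\<phi> \<in> borel_measurable (borel_segment \<tau>)"
  shows "(\<integral>\<^sup>+\<omega>. \<phi> (seg k \<omega>) \<partial>M) = (\<integral>\<^sup>+X. E.expect k \<phi> X \<partial>distr M (borel_segment \<tau>) (seg 0))"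
  using assms
proof (induction k arbitrary: \<phi>)
  case 0
  then show ?case
    by (simp add: nn_integral_distr[OF seg_measurable_M])
next
  case (Suc k)
  note \<phi> = Suc.prems
  let ?\<gamma> = "isotropic_gaussian (\<tau> / real N) :: (real^'m) measure"
  let ?Z = "\<lambda>\<omega>. W (real (Suc k) * (\<tau> / real N)) \<omega> - W (real k * (\<tau> / real N)) \<omega>"
  let ?L = "distr M (borel_segment \<tau>) (seg k)"
  have pair: "(\<lambda>\<omega>. (seg k \<omega>, ?Z \<omega>)) \<in> M \<rightarrow>\<^sub>M borel_segment \<tau> \<Otimes>\<^sub>M borel"
    by (rule measurable_Pair[OF seg_measurable_M increment_measurable[OF grid_time(1,2)]])
  have sc: "sets (borel_segment \<tau> \<Otimes>\<^sub>M borel :: ((real \<Rightarrow> real^'d) \<times> (real^'m)) measure) = sets (borel_segment \<tau> \<Otimes>\<^sub>M ?\<gamma>)"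
    by (rule sets_pair_measure_cong[OF refl E.sets_noise[symmetric]])
  have m: "(\<lambda>p. \<phi> (E.step (fst p) (snd p))) \<in> borel_measurable (borel_segment \<tau> \<Otimes>\<^sub>M ?\<gamma>)"
    using measurable_compose[OF E.measurable_map \<phi>] by (simp add: split_beta)
  have i1: "(\<integral>\<^sup>+\<omega>. \<phi> (seg (Suc k) \<omega>) \<partial>M) = (\<integral>\<^sup>+p. \<phi> (E.step (fst p) (snd p)) \<partial>distr M (borel_segment \<tau> \<Otimes>\<^sub>M borel) (\<lambda>\<omega>. (seg k \<omega>, ?Z \<omega>)))"
    using m by (subst nn_integral_distr[OF pair]) (simp_all add: seg_Suc measurable_cong_sets[OF sc refl])
  have i2: "distr M (borel_segment \<tau> \<Otimes>\<^sub>M borel) (\<lambda>\<omega>. (seg k \<omega>, ?Z \<omega>)) = ?L \<Otimes>\<^sub>M ?\<gamma>"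
    using distr_increment_pair[OF grid_time(1,2) seg_measurable, of k] unfolding grid_time(3) .
  have i3: "(\<integral>\<^sup>+p. \<phi> (E.step (fst p) (snd p)) \<partial>(?L \<Otimes>\<^sub>M ?\<gamma>)) = (\<integral>\<^sup>+X. \<integral>\<^sup>+z. \<phi> (E.step X z) \<partial>?\<gamma> \<partial>?L)"
    using E.nn_integral_fst[of "\<lambda>p. \<phi> (E.step (fst p) (snd p))" ?L] m
    by (simp add: measurable_cong_sets[OF sets_pair_measure_cong[OF sets_distr refl] refl])
  have i4: "(\<integral>\<^sup>+X. \<integral>\<^sup>+z. \<phi> (E.step X z) \<partial>?\<gamma> \<partial>?L) = (\<integral>\<^sup>+X. E.expect (Suc 0) \<phi> X \<partial>?L)"
    using \<phi> by (intro nn_integral_cong) (simp add: E.expect_1)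
  have i5: "(\<integral>\<^sup>+X. E.expect (Suc 0) \<phi> X \<partial>?L) = (\<integral>\<^sup>+\<omega>. E.expect (Suc 0) \<phi> (seg k \<omega>) \<partial>M)"
    by (rule nn_integral_distr[OF seg_measurable_M]) (simp add: E.measurable_expect[OF \<phi>])
  have i6: "(\<integral>\<^sup>+\<omega>. E.expect (Suc 0) \<phi> (seg k \<omega>) \<partial>M) = (\<integral>\<^sup>+X. E.expect k (E.expect (Suc 0) \<phi>) X \<partial>distr M (borel_segment \<tau>) (seg 0))"
    by (rule Suc.IH[OF E.measurable_expect[OF \<phi>]])
  have i7: "(\<integral>\<^sup>+X. E.expect k (E.expect (Suc 0) \<phi>) X \<partial>distr M (borel_segment \<tau>) (seg 0)) = (\<integral>\<^sup>+X. E.expect (Suc k) \<phi> X \<partial>distr M (borel_segment \<tau>) (seg 0))"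
    using E.expect_add[OF \<phi>, of _ k "Suc 0"] by (intro nn_integral_cong) simp
  show ?case
    unfolding i1 i2 i3 i4 i5 i6 i7 ..
qed

text \<open>From here on the initial data matter only through the law of the truncated segment; the
  original probability space and the Brownian path have disappeared.\<close>

lemma em_law_eq_push:
  "em_law M W f g \<Phi> \<nu> \<tau> N \<xi> k = E.push k (distr M (borel_segment \<tau>) (\<lambda>\<omega>. E.trunc_segment (\<xi> \<omega>)))"
proof (rule E.push_unique)
  have law: "em_law M W f g \<Phi> \<nu> \<tau> N \<xi> k = distr M (borel_segment \<tau>) (seg k)"
    unfolding em_law_def seg_def ..
  show "sets (em_law M W f g \<Phi> \<nu> \<tau> N \<xi> k) = sets (borel_segment \<tau>)"
    by (simp add: law)
  fix A :: "(real \<Rightarrow> real^'d) set" assume A: "A \<in> sets (borel_segment \<tau>)"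
  have "emeasure (em_law M W f g \<Phi> \<nu> \<tau> N \<xi> k) A = (\<integral>\<^sup>+X. indicator A X \<partial>distr M (borel_segment \<tau>) (seg k))"
    using A by (simp add: law)
  also have "\<dots> = (\<integral>\<^sup>+\<omega>. indicator A (seg k \<omega>) \<partial>M)"
    using A by (intro nn_integral_distr[OF seg_measurable_M]) simp
  also have "\<dots> = (\<integral>\<^sup>+X. E.expect k (indicator A) X \<partial>distr M (borel_segment \<tau>) (seg 0))"
    using A by (intro nn_integral_seg) simp
  finally show "emeasure (em_law M W f g \<Phi> \<nu> \<tau> N \<xi> k) A
      = (\<integral>\<^sup>+X. E.expect k (indicator A) X \<partial>distr M (borel_segment \<tau>) (\<lambda>\<omega>. E.trunc_segment (\<xi> \<omega>)))"
    unfolding seg_0 .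
qed simp

lemma initial_measurable_M: "\<xi> \<in> M \<rightarrow>\<^sub>M borel_segment \<tau>"
  by (rule measurable_from_subalg[OF subalgebra_F[OF order_refl] \<xi>])

text \<open>Truncation does not increase norms, so the tail of the truncated initial law is bounded
  by that of \<xi>, whatever the truncation radius is.\<close>

lemma initial_trunc_law:
  defines "\<rho> \<equiv> distr M (borel_segment \<tau>) (\<lambda>\<omega>. E.trunc_segment (\<xi> \<omega>))"
  shows "prob_space \<rho>" "sets \<rho> = sets (borel_segment \<tau>)"
    "AE X in \<rho>. X \<in> E.bounded_segments (trunc_radius f g \<Phi> \<nu> (\<tau> / real N))"
    "0 \<le> R \<Longrightarrow> measure \<rho> (space (borel_segment \<tau>) - E.bounded_segments R)
       \<le> prob {\<omega> \<in> space M. \<xi> \<omega> \<notin> E.bounded_segments R}"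
proof -
  have T: "(\<lambda>\<omega>. E.trunc_segment (\<xi> \<omega>)) \<in> M \<rightarrow>\<^sub>M borel_segment \<tau>"
    by (rule E.measurable_trunc_segment[OF initial_measurable_M])
  have sp: "\<xi> \<omega> \<in> mspace (segment_space \<tau>)" if "\<omega> \<in> space M" for \<omega>
    using measurable_space[OF initial_measurable_M that] by simp
  show "prob_space \<rho>" unfolding \<rho>_def by (rule prob_space_distr[OF T])
  show "sets \<rho> = sets (borel_segment \<tau>)" by (simp add: \<rho>_def)
  show "AE X in \<rho>. X \<in> E.bounded_segments (trunc_radius f g \<Phi> \<nu> (\<tau> / real N))"
    unfolding \<rho>_def
  proof (subst AE_distr_iff[OF T])
    show "{X \<in> space (borel_segment \<tau>). X \<in> E.bounded_segments (trunc_radius f g \<Phi> \<nu> (\<tau> / real N))} \<in> sets (borel_segment \<tau>)"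
      using sets.Int[OF sets.top E.sets_bounded_segments[OF E.r_nonneg]] by (simp add: Int_def)
    show "AE \<omega> in M. E.trunc_segment (\<xi> \<omega>) \<in> E.bounded_segments (trunc_radius f g \<Phi> \<nu> (\<tau> / real N))"
      using sp E.trunc_segment_bounded by (intro AE_I2) auto
  qed
  assume R: "0 \<le> R"
  note B = E.sets_bounded_segments[OF R]
  have meas: "{\<omega> \<in> space M. \<xi> \<omega> \<notin> E.bounded_segments R} \<in> events"
  proof -
    have "\<xi> -` (space (borel_segment \<tau>) - E.bounded_segments R) \<inter> space M \<in> events"
      by (rule measurable_sets[OF initial_measurable_M sets.compl_sets[OF B]])
    also have "\<xi> -` (space (borel_segment \<tau>) - E.bounded_segments R) \<inter> space M = {\<omega> \<in> space M. \<xi> \<omega> \<notin> E.bounded_segments R}"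
      using sp by auto
    finally show ?thesis .
  qed
  have "measure \<rho> (space (borel_segment \<tau>) - E.bounded_segments R)
      = prob ((\<lambda>\<omega>. E.trunc_segment (\<xi> \<omega>)) -` (space (borel_segment \<tau>) - E.bounded_segments R) \<inter> space M)"
    unfolding \<rho>_def by (rule measure_distr[OF T sets.compl_sets[OF B]])
  also have "\<dots> \<le> prob {\<omega> \<in> space M. \<xi> \<omega> \<notin> E.bounded_segments R}"
  proof (rule finite_measure_mono[OF _ meas], safe)
    fix \<omega> assume \<omega>: "\<omega> \<in> space M" "E.trunc_segment (\<xi> \<omega>) \<notin> E.bounded_segments R" "\<xi> \<omega> \<in> E.bounded_segments R"
    have "norm (E.trunc_segment (\<xi> \<omega>) \<theta>) \<le> R" if "\<theta> \<in> {-\<tau>..0}" for \<theta>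
      using E.norm_trunc_segment_le[OF that, of "\<xi> \<omega>"] E.bounded_segments_D(2)[OF \<omega>(3) that] by linarith
    then have "E.trunc_segment (\<xi> \<omega>) \<in> E.bounded_segments R"
      using E.trunc_segment_mem[OF sp[OF \<omega>(1)]] by (simp add: E.bounded_segments_def)
    with \<omega>(2) show False by simp
  qed
  finally show "measure \<rho> (space (borel_segment \<tau>) - E.bounded_segments R)
       \<le> prob {\<omega> \<in> space M. \<xi> \<omega> \<notin> E.bounded_segments R}" .
qed

end

text \<open>The kernel in \<open>em_invariant\<close> truncates its starting segment, so it agrees
  with the kernel of \<open>step\<close> only after \<open>trunc_segment\<close>; on the r-ball the
  two coincide.\<close>

lemma emeasure_em_law_const:
  assumes X: "X \<in> mspace (segment_space \<tau>)" and A: "A \<in> sets (borel_segment \<tau>)"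
  shows "emeasure (em_law M W f g \<Phi> \<nu> \<tau> N (\<lambda>_. X) k) A = E.expect k (indicator A) (E.trunc_segment X)"
proof -
  have c: "(\<lambda>_. X) \<in> F 0 \<rightarrow>\<^sub>M borel_segment \<tau>" using X by simp
  have T: "(\<lambda>\<omega>. E.trunc_segment X) \<in> M \<rightarrow>\<^sub>M borel_segment \<tau>"
    by (rule E.measurable_trunc_segment[OF initial_measurable_M[OF c]])
  let ?\<rho> = "distr M (borel_segment \<tau>) (\<lambda>\<omega>. E.trunc_segment X)"
  have "emeasure (em_law M W f g \<Phi> \<nu> \<tau> N (\<lambda>_. X) k) A = (\<integral>\<^sup>+Y. indicator A Y \<partial>E.push k ?\<rho>)"
    using A by (simp add: em_law_eq_push[OF c])
  also have "\<dots> = (\<integral>\<^sup>+Y. E.expect k (indicator A) Y \<partial>?\<rho>)"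
    using A by (intro E.nn_integral_push) auto
  also have "\<dots> = (\<integral>\<^sup>+\<omega>. E.expect k (indicator A) (E.trunc_segment X) \<partial>M)"
    using A by (intro nn_integral_distr[OF T]) (simp add: E.measurable_expect)
  finally show ?thesis by (simp add: emeasure_space_1)
qed

end

end

section \<open>Convergence to the invariant measure, uniformly in the step size\<close>

text \<open>As K \<ge> \<Phi> 1 and \<Delta> < 1, the value K \<Delta>^(-\<nu>) is at least \<Phi>
  1, and \<Phi> is unbounded, so the intermediate value theorem puts it in the range. The second
  claim lets P = K \<Delta>^(-\<nu>) bound the increments of f on the truncation ball.\<close>

lemma trunc_radius:
  assumes tf: "truncation_function f g \<Phi>" and \<Delta>: "0 < \<Delta>" "\<Delta> < 1" and \<nu>: "0 < \<nu>"
  shows "1 \<le> trunc_radius f g \<Phi> \<nu> \<Delta>"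
    and "\<Phi> (trunc_radius f g \<Phi> \<nu> \<Delta>) = trunc_const f g \<Phi> * \<Delta> powr (-\<nu>)"
proof -
  let ?y = "trunc_const f g \<Phi> * \<Delta> powr (-\<nu>)"
  have cont: "continuous_on {1..} \<Phi>" and mono: "strict_mono_on {1..} \<Phi>" and lim: "filterlim \<Phi> at_top at_top"
    using tf by (auto simp: truncation_function_def)
  have "\<Delta> powr 0 \<le> \<Delta> powr (-\<nu>)"
    using \<Delta> \<nu> by (intro powr_mono') auto
  then have p: "1 \<le> \<Delta> powr (-\<nu>)" using \<Delta> by simp
  have K: "\<Phi> 1 \<le> trunc_const f g \<Phi>" "0 \<le> trunc_const f g \<Phi>"
    by (auto simp: trunc_const_def)
  have y: "\<Phi> 1 \<le> ?y"
    using mult_left_mono[OF p K(2)] K(1) by simp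
  have "eventually (\<lambda>x. 1 \<le> x \<and> ?y \<le> \<Phi> x) at_top"
    using eventually_ge_at_top[of 1] lim[unfolded filterlim_at_top, rule_format, of ?y]
    by eventually_elim simp
  then obtain R where R: "1 \<le> R" "?y \<le> \<Phi> R"
    using eventually_happens'[OF trivial_limit_at_top_linorder] by fast
  obtain x where x: "1 \<le> x" "\<Phi> x = ?y"
    using IVT'[of \<Phi> 1 ?y R] y R continuous_on_subset[OF cont, of "{1..R}"] by auto
  have inj: "inj_on \<Phi> {1..}"
    using mono by (rule strict_mono_on_imp_inj_on)
  have im: "?y \<in> \<Phi> ` {1..}"
    using x by (intro image_eqI[of _ _ x]) auto
  show "1 \<le> trunc_radius f g \<Phi> \<nu> \<Delta>"
    using the_inv_into_into[OF inj im order_refl] by (simp add: trunc_radius_def)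
  show "\<Phi> (trunc_radius f g \<Phi> \<nu> \<Delta>) = ?y"
    unfolding trunc_radius_def by (rule f_the_inv_into_f[OF inj im])
qed

text \<open>The quotient condition is silent when the denominator vanishes, but then both points
  coincide and the left side is 0.\<close>

lemma truncation_function_bound:
  assumes tf: "truncation_function f g \<Phi>" and R: "1 \<le> R"
    and xy: "norm x \<le> R" "norm y \<le> R" "norm x' \<le> R" "norm y' \<le> R"
  shows "norm (f (x, y) - f (x', y')) \<le> \<Phi> R * (norm (x - x') + min 1 (norm (y - y')))"
proof -
  define D where "D = norm (x - x') + min 1 (norm (y - y'))"
  have D0: "0 \<le> D" by (simp add: D_def)
  show ?thesis
  proof (cases "D = 0")
    case True
    have "norm (x - x') = 0" "min 1 (norm (y - y')) = 0"
      using True D0 by (auto simp: D_def add_nonneg_eq_0_iff)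
    then have "x = x'" "y = y'"
      by (auto simp: min_def split: if_splits)
    then show ?thesis by simp
  next
    case False
    then have D: "0 < D" using D0 by simp
    have "norm (f (x, y) - f (x', y')) / D + (norm (g (x, y) - g (x', y')))\<^sup>2 / D\<^sup>2 \<le> \<Phi> R"
      using tf R xy False unfolding truncation_function_def D_def by blast
    moreover have "0 \<le> (norm (g (x, y) - g (x', y')))\<^sup>2 / D\<^sup>2"
      by simp
    ultimately have "norm (f (x, y) - f (x', y')) / D \<le> \<Phi> R" by linarith
    then show ?thesis
      using D by (simp add: pos_divide_le_eq D_def)
  qed
qed

lemma (in segment_interval) FM_dist_le:
  assumes "\<And>\<Psi>. \<Psi> \<in> FM_functions \<tau> \<Longrightarrow> \<bar>(\<integral>X. \<Psi> X \<partial>P) - (\<integral>X. \<Psi> X \<partial>Q)\<bar> \<le> c"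
  shows "FM_dist \<tau> P Q \<le> c"
  unfolding FM_dist_def
proof (rule cSUP_least)
  have "(\<lambda>_. 0) \<in> FM_functions \<tau>" by (simp add: FM_functions_def)
  then show "FM_functions \<tau> \<noteq> {}" by blast
qed (rule assms)

text \<open>A real supremum says something only for a set bounded above; here the integrals of a
  test function differ by at most 2.\<close>

lemma (in segment_interval) FM_dist_nonneg:
  assumes "P \<in> segment_prob \<tau>" "Q \<in> segment_prob \<tau>"
  shows "0 \<le> FM_dist \<tau> P Q"
  unfolding FM_dist_def
proof (rule cSUP_upper2[where x="\<lambda>_. 0"])
  have "\<bar>\<integral>X. \<Psi> X \<partial>P\<bar> \<le> 1" if P: "P \<in> segment_prob \<tau>" and \<Psi>: "\<Psi> \<in> FM_functions \<tau>"
    for P :: "(real \<Rightarrow> 'a) measure" and \<Psi>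
  proof -
    interpret P: prob_space P using P by (simp add: segment_prob_def)
    have sets: "sets P = sets (borel_segment \<tau>)" using P by (simp add: segment_prob_def)
    have sp: "space P = mspace (segment_space \<tau>)" using sets_eq_imp_space_eq[OF sets] by simp
    have m: "\<Psi> \<in> borel_measurable P"
      using FM_functions_D(3)[OF \<Psi>] by (simp only: measurable_cong_sets[OF sets refl])
    have "\<bar>\<integral>X. \<Psi> X \<partial>P\<bar> \<le> (\<integral>X. \<bar>\<Psi> X\<bar> \<partial>P)" by (rule integral_abs_bound)
    also have "\<dots> \<le> (\<integral>X. 1 \<partial>P)"
      using m FM_functions_D(1)[OF \<Psi>] sp by (intro integral_mono P.integrable_const_bound[of _ 1]) auto
    finally show ?thesis by (simp add: P.prob_space)
  qed
  from this[OF assms(1)] this[OF assms(2)]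
  have "\<bar>(\<integral>X. \<Psi> X \<partial>P) - (\<integral>X. \<Psi> X \<partial>Q)\<bar> \<le> 2" if "\<Psi> \<in> FM_functions \<tau>" for \<Psi>
    using that by (smt (verit))
  then show "bdd_above ((\<lambda>\<Psi>. \<bar>(\<integral>X. \<Psi> X \<partial>P) - (\<integral>X. \<Psi> X \<partial>Q)\<bar>) ` FM_functions \<tau>)"
    by (rule bdd_aboveI2)
qed (auto simp: FM_functions_def)

text \<open>q bounds K^2 \<Delta>^(1-2\<nu>) for all admissible steps at once, so that a single set
  of constants serves them all.\<close>

locale sdde_scheme = brownian M F W
  for M :: "'w measure" and F :: "real \<Rightarrow> 'w measure" and W :: "real \<Rightarrow> 'w \<Rightarrow> real^'m" +
  fixes f :: "(real^'d) \<times> (real^'d) \<Rightarrow> real^'d"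
    and g :: "(real^'d) \<times> (real^'d) \<Rightarrow> real^'m^'d"
    and V :: "(real^'d) \<times> (real^'d) \<Rightarrow> real"
    and \<Phi> :: "real \<Rightarrow> real"
    and \<tau> \<nu> \<alpha> a1 a2 a3 b1 b2 b3 b4 \<Delta>h q :: real
  assumes tau: "0 < \<tau>"
    and f_borel: "f \<in> borel_measurable borel" and g_borel: "g \<in> borel_measurable borel"
    and local_Lipschitz:
      "\<And>R. R > 0 \<Longrightarrow> \<exists>l>0. \<forall>x x' y y'.
         norm x \<le> R \<and> norm x' \<le> R \<and> norm y \<le> R \<and> norm y' \<le> R \<longrightarrow>
         max (norm (f (x, y) - f (x', y'))) (norm (g (x, y) - g (x', y')))
           \<le> l * (norm (x - x') + norm (y - y'))"
    and alpha: "2 \<le> \<alpha>" and a_nonneg: "0 \<le> a1" "0 \<le> a3"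
    and Khasminskii:
      "\<And>x y. 2 * (x \<bullet> f (x, y)) + (norm (g (x, y)))\<^sup>2
         \<le> a1 - a2 * norm x powr \<alpha> + a3 * norm y powr \<alpha>"
    and b_nonneg: "0 \<le> b2" "0 \<le> b4"
    and V_cont: "continuous_on UNIV V" and V_nonneg: "\<And>z. 0 \<le> V z"
    and contraction:
      "\<And>x x' y y'.
         2 * ((x - x') \<bullet> (f (x, y) - f (x', y'))) + (norm (g (x, y) - g (x', y')))\<^sup>2
           \<le> - b1 * (norm (x - x'))\<^sup>2 + b2 * (norm (y - y'))\<^sup>2 - b3 * V (x, x') + b4 * V (y, y')"
    and trunc_fun: "truncation_function f g \<Phi>"
    and nu: "0 < \<nu>" "\<nu> \<le> 1/3"
    and Delta_h: "\<Delta>h < 1" and q: "(trunc_const f g \<Phi>)\<^sup>2 * \<Delta>h powr (1 - 2 * \<nu>) \<le> q"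
    and gap_a: "a3 < a2 - 2 * q" and gap_b: "b2 + 2 * q < b1 - 2 * q" "b4 < b3"
begin

sublocale segment_interval \<tau>
  using tau by unfold_locales

abbreviation "dt N \<equiv> \<tau> / real N"
abbreviation "radius N \<equiv> trunc_radius f g \<Phi> \<nu> (dt N)"

definition admissible :: "nat \<Rightarrow> bool" where
  "admissible N \<longleftrightarrow> \<tau> < real N \<and> dt N \<le> \<Delta>h"

lemma em_dissipation_admissible:
  assumes N: "admissible N"
  shows "\<exists>l. em_dissipation \<tau> (isotropic_gaussian (dt N) :: (real^'m) measure) (dt N) f g (radius N) N l V
    b1 b2 b3 b4 (trunc_const f g \<Phi> * dt N powr (-\<nu>)) q \<alpha> a1 a2 a3"
proof -
  let ?\<Delta> = "dt N" and ?K = "trunc_const f g \<Phi>"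
  let ?P = "?K * ?\<Delta> powr (-\<nu>)"
  have N0: "0 < N" using N tau by (cases N) (auto simp: admissible_def)
  have \<Delta>: "0 < ?\<Delta>" "?\<Delta> \<le> \<Delta>h" "?\<Delta> < 1" "real N * ?\<Delta> = \<tau>"
    using N N0 tau Delta_h by (auto simp: admissible_def)
  note r = trunc_radius[OF trunc_fun \<Delta>(1,3) nu(1)]
  obtain l where l: "0 < l" "\<And>x x' y y'. norm x \<le> radius N \<Longrightarrow> norm x' \<le> radius N \<Longrightarrow> norm y \<le> radius N \<Longrightarrow> norm y' \<le> radius N \<Longrightarrow>
     max (norm (f (x, y) - f (x', y'))) (norm (g (x, y) - g (x', y'))) \<le> l * (norm (x - x') + norm (y - y'))"
    using local_Lipschitz[of "radius N"] r(1) by auto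
  have K1: "1 \<le> ?K" "norm (f (0, 0)) \<le> ?K"
    by (auto simp: trunc_const_def)
  have p1: "1 \<le> ?\<Delta> powr (-\<nu>)"
  proof -
    have "1 \<le> x powr (-\<nu>)" if "0 < x" "x < 1" for x :: real
      using powr_mono'[of "-\<nu>" 0 x] that nu by simp
    from this[OF \<Delta>(1,3)] show ?thesis .
  qed
  have KP: "?K \<le> ?P"
    using mult_left_mono[OF p1, of ?K] K1 by simp
  \<comment> \<open>P^2 \<Delta> equals K^2 \<Delta>^(1-2\<nu>), and 1 - 2\<nu> is positive because
    \<nu> \<le> 1/3; the largest admissible step is therefore the worst.\<close>
  have PP: "?P\<^sup>2 * ?\<Delta> \<le> q"
  proof -
    have "(?\<Delta> powr (-\<nu>))\<^sup>2 * ?\<Delta> = ?\<Delta> powr (1 - 2 * \<nu>)"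
    proof -
      have "(?\<Delta> powr (-\<nu>))\<^sup>2 * ?\<Delta> = ?\<Delta> powr (-\<nu>) * ?\<Delta> powr (-\<nu>) * ?\<Delta> powr 1"
        using \<Delta> tau by (simp add: power2_eq_square)
      also have "\<dots> = ?\<Delta> powr (-\<nu> + -\<nu> + 1)"
        by (simp only: powr_add)
      finally show ?thesis by (simp add: algebra_simps)
    qed
    then have "?P\<^sup>2 * ?\<Delta> = ?K\<^sup>2 * ?\<Delta> powr (1 - 2 * \<nu>)"
      by (simp only: power_mult_distrib mult.assoc)
    also have "\<dots> \<le> ?K\<^sup>2 * \<Delta>h powr (1 - 2 * \<nu>)"
      using \<Delta> nu by (intro mult_left_mono powr_mono2) auto
    finally show ?thesis using q by linarith
  qed
  have "em_dissipation \<tau> (isotropic_gaussian ?\<Delta> :: (real^'m) measure) ?\<Delta> f g (radius N) N l V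
    b1 b2 b3 b4 ?P q \<alpha> a1 a2 a3"
  proof (intro em_dissipation.intro em_contraction.intro em_map.intro)
    show "segment_interval \<tau>" by (rule segment_interval_axioms)
    show "isotropic_noise (isotropic_gaussian ?\<Delta> :: (real^'m) measure) ?\<Delta>"
      by (rule isotropic_noise_gaussian[OF \<Delta>(1)])
    show "em_map_axioms \<tau> ?\<Delta> f g (radius N) N l"
    proof
      fix x y x' y' :: "real^'d"
      assume "norm x \<le> radius N" "norm y \<le> radius N" "norm x' \<le> radius N" "norm y' \<le> radius N"
      from l(2)[OF this(1,3,2,4)]
      show "norm (f (x, y) - f (x', y')) \<le> l * (norm (x - x') + norm (y - y')) \<and>
        norm (g (x, y) - g (x', y')) \<le> l * (norm (x - x') + norm (y - y'))"
        by simp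
    qed (use f_borel g_borel r(1) \<Delta> l(1) in auto)
    show "em_contraction_axioms ?\<Delta> f g (radius N) V b1 b2 b3 b4 ?P q"
    proof
      show "V \<in> borel_measurable borel"
        by (rule borel_measurable_continuous_onI[OF V_cont])
      show "norm (f (x, y) - f (x', y')) \<le> ?P * (norm (x - x') + min 1 (norm (y - y')))"
        if "norm x \<le> radius N" "norm y \<le> radius N" "norm x' \<le> radius N" "norm y' \<le> radius N" for x y x' y'
        using truncation_function_bound[OF trunc_fun r(1) that] unfolding r(2) .
      show "0 \<le> ?P" using K1 by simp
    qed (rule V_nonneg b_nonneg contraction PP gap_b)+
    show "em_dissipation_axioms f g V ?P q \<alpha> a1 a2 a3"
    proof
      show "norm (f (0, 0)) \<le> ?P" using K1(2) KP by linarith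
    qed (rule alpha a_nonneg Khasminskii gap_a V_cont)+
  qed
  then show ?thesis ..
qed

definition "escape R \<xi> = {\<omega> \<in> space M. \<not> (\<forall>\<theta>\<in>{-\<tau>..0}. norm (\<xi> \<omega> \<theta> :: real^'d) \<le> R)}"

text \<open>These repeat the constants of \<open>em_dissipation\<close> outside that locale, where
  no N is fixed, so that the rate can be stated for all steps together.\<close>

definition "\<beta>q = b2 + 2 * q"
definition "\<kappa>q = min (b1 - 2 * q - \<beta>q) (b3 - b4)"
definition "Cq R v = (1 + \<tau> * max \<beta>q b4) * (4 * R\<^sup>2 + \<tau> * (\<beta>q * (4 * R\<^sup>2) + b4 * v)) / \<kappa>q"
definition "Eq = 1 + (1 + \<tau> * a3) * ((a1 + 10 * q) / (a2 - 2 * q - a3)) + \<tau> * (a1 + 10 * q)"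

text \<open>N enters the bound only through the elapsed time. R, v and c are left free, to be chosen
  from the target accuracy and the tails of the initial data before N is known.\<close>

definition "attracts N \<pi> \<longleftrightarrow>
     (\<forall>\<xi> R v c n. \<xi> \<in> F 0 \<rightarrow>\<^sub>M borel_segment \<tau> \<and> 0 < R \<and>
        (\<forall>x y. norm x \<le> R \<longrightarrow> norm y \<le> R \<longrightarrow> V (x, y) \<le> v) \<and> 0 < c \<and> N < n \<longrightarrow>
        FM_dist \<tau> (em_law M W f g \<Phi> \<nu> \<tau> N \<xi> (n + N)) \<pi>
          \<le> 2 * (c + Cq R v / (real (n - N) * dt N * c\<^sup>2)) + 2 * prob (escape R \<xi>) + 2 * (Eq / R\<^sup>2))"

lemma invariant_measure_admissible:
  assumes N: "admissible N"
  shows "\<exists>\<pi>. em_invariant M W f g \<Phi> \<nu> \<tau> N \<pi> \<and>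
    (\<forall>\<pi>'. em_invariant M W f g \<Phi> \<nu> \<tau> N \<pi>' \<longrightarrow> \<pi>' = \<pi>) \<and>
    (\<forall>\<xi>\<in>F 0 \<rightarrow>\<^sub>M borel_segment \<tau>. \<forall>k. em_law M W f g \<Phi> \<nu> \<tau> N \<xi> k \<in> segment_prob \<tau>) \<and>
    attracts N \<pi>"
proof -
  obtain l where l: "em_dissipation \<tau> (isotropic_gaussian (dt N) :: (real^'m) measure) (dt N) f g (radius N) N l V
    b1 b2 b3 b4 (trunc_const f g \<Phi> * dt N powr (-\<nu>)) q \<alpha> a1 a2 a3"
    using em_dissipation_admissible[OF N] by blast
  interpret D: em_dissipation \<tau> "isotropic_gaussian (dt N) :: (real^'m) measure" "dt N" f g "radius N" N l V
    b1 b2 b3 b4 "trunc_const f g \<Phi> * dt N powr (-\<nu>)" q \<alpha> a1 a2 a3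
    by (rule l)
  note em = D.em_map_axioms
  obtain \<pi> where \<pi>: "D.invariant_law \<pi>"
    using D.invariant_law_exists by blast
  note \<pi>D = D.invariant_lawD[OF \<pi>]
  have sp: "space \<pi> = mspace (segment_space \<tau>)"
    using sets_eq_imp_space_eq[OF \<pi>D(2)] by simp
  have \<pi>_prob: "\<pi> \<in> segment_prob \<tau>"
    using \<pi>D(1,2) by (simp add: segment_prob_def)
  have inv: "em_invariant M W f g \<Phi> \<nu> \<tau> N \<pi>"
    unfolding em_invariant_def
  proof (intro conjI allI ballI \<pi>_prob)
    fix k and A :: "(real \<Rightarrow> real^'d) set" assume A: "A \<in> sets (borel_segment \<tau>)"
    have "(\<integral>\<^sup>+X. emeasure (em_law M W f g \<Phi> \<nu> \<tau> N (\<lambda>_. X) k) A \<partial>\<pi>) = (\<integral>\<^sup>+X. D.expect k (indicator A) X \<partial>\<pi>)"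
      using \<pi>D(3)
    proof (intro nn_integral_cong_AE, eventually_elim)
      fix X assume X: "X \<in> D.bounded_segments (radius N)"
      show "emeasure (em_law M W f g \<Phi> \<nu> \<tau> N (\<lambda>_. X) k) A = D.expect k (indicator A) X"
        unfolding emeasure_em_law_const[OF em D.bounded_segments_D(1)[OF X] A] D.trunc_segment_id[OF X] ..
    qed
    also have "\<dots> = (\<integral>\<^sup>+X. indicator A X \<partial>\<pi>)"
      using A by (intro \<pi>D(4)) simp
    also have "\<dots> = emeasure \<pi> A"
      using A \<pi>D(2) by simp
    finally show "(\<integral>\<^sup>+X. emeasure (em_law M W f g \<Phi> \<nu> \<tau> N (\<lambda>_. X) k) A \<partial>\<pi>) = emeasure \<pi> A" .
  qed
  have uniq: "\<pi>' = \<pi>" if \<pi>': "em_invariant M W f g \<Phi> \<nu> \<tau> N \<pi>'" for \<pi>'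
  proof (rule FM_functions_eqI[OF _ \<pi>_prob])
    show \<pi>'_prob: "\<pi>' \<in> segment_prob \<tau>" using \<pi>' by (simp add: em_invariant_def)
    then have ps: "prob_space \<pi>'" and sets': "sets \<pi>' = sets (borel_segment \<tau>)"
      by (auto simp: segment_prob_def)
    interpret P': prob_space \<pi>' by (rule ps)
    have sp': "space \<pi>' = mspace (segment_space \<tau>)"
      using sets_eq_imp_space_eq[OF sets'] by simp
    have T: "D.trunc_segment \<in> \<pi>' \<rightarrow>\<^sub>M borel_segment \<tau>"
      using D.measurable_trunc_segment[of "\<lambda>X. X" \<pi>'] sets' by (simp add: measurable_ident_sets)
    define \<rho> where "\<rho> = distr \<pi>' (borel_segment \<tau>) D.trunc_segment"
    have \<rho>: "prob_space \<rho>" "sets \<rho> = sets (borel_segment \<tau>)"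
      unfolding \<rho>_def by (auto intro: P'.prob_space_distr[OF T])
    have \<rho>_AE: "AE X in \<rho>. X \<in> D.bounded_segments (radius N)"
      unfolding \<rho>_def
    proof (subst AE_distr_iff[OF T])
      show "{X \<in> space (borel_segment \<tau>). X \<in> D.bounded_segments (radius N)} \<in> sets (borel_segment \<tau>)"
        using sets.Int[OF sets.top D.sets_bounded_segments[OF D.r_nonneg]] by (simp add: Int_def)
      show "AE X in \<pi>'. D.trunc_segment X \<in> D.bounded_segments (radius N)"
        using D.trunc_segment_bounded sp' by (intro AE_I2) auto
    qed
    \<comment> \<open>The kernels truncate first, so \<pi>' is, for every k, the k-step law of its
      own truncation \<rho>. Now \<rho> and \<pi> are both carried by the r-ball, and coalescence at
      this fixed step identifies \<pi>' with \<pi>.\<close>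
    have push: "\<pi>' = D.push k \<rho>" for k
    proof (rule D.push_unique[OF \<rho>(2) sets'])
      fix A :: "(real \<Rightarrow> real^'d) set" assume A: "A \<in> sets (borel_segment \<tau>)"
      have "emeasure \<pi>' A = (\<integral>\<^sup>+X. emeasure (em_law M W f g \<Phi> \<nu> \<tau> N (\<lambda>_. X) k) A \<partial>\<pi>')"
        using \<pi>' A by (simp add: em_invariant_def)
      also have "\<dots> = (\<integral>\<^sup>+X. D.expect k (indicator A) (D.trunc_segment X) \<partial>\<pi>')"
        using sp' by (intro nn_integral_cong emeasure_em_law_const[OF em _ A]) simp
      also have "\<dots> = (\<integral>\<^sup>+X. D.expect k (indicator A) X \<partial>\<rho>)"
        unfolding \<rho>_def using A by (intro nn_integral_distr[OF T, symmetric]) (simp add: D.measurable_expect)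
      finally show "emeasure \<pi>' A = (\<integral>\<^sup>+X. D.expect k (indicator A) X \<partial>\<rho>)" .
    qed
    fix \<Psi> :: "(real \<Rightarrow> real^'d) \<Rightarrow> real" assume \<Psi>: "\<Psi> \<in> FM_functions \<tau>"
    obtain e :: "nat \<Rightarrow> real" where e: "e \<longlonglongrightarrow> 0"
      "\<And>n P Q \<Psi>. prob_space P \<Longrightarrow> sets P = sets (borel_segment \<tau>) \<Longrightarrow> (AE X in P. X \<in> D.bounded_segments (radius N)) \<Longrightarrow>
       prob_space Q \<Longrightarrow> sets Q = sets (borel_segment \<tau>) \<Longrightarrow> (AE X in Q. X \<in> D.bounded_segments (radius N)) \<Longrightarrow>
       \<Psi> \<in> FM_functions \<tau> \<Longrightarrow> \<bar>(\<integral>Y. \<Psi> Y \<partial>D.push n P) - (\<integral>Y. \<Psi> Y \<partial>D.push n Q)\<bar> \<le> e n"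
      by (rule D.FM_fixed_step) (rule that)
    have "\<bar>(\<integral>X. \<Psi> X \<partial>\<pi>') - (\<integral>X. \<Psi> X \<partial>\<pi>)\<bar> \<le> e n" for n
      using e(2)[OF \<rho> \<rho>_AE \<pi>D(1-3) \<Psi>, of n] unfolding push[symmetric] D.invariant_push[OF \<pi>] .
    then have "\<bar>(\<integral>X. \<Psi> X \<partial>\<pi>') - (\<integral>X. \<Psi> X \<partial>\<pi>)\<bar> \<le> 0"
      by (intro LIMSEQ_le_const[OF e(1)]) blast
    then show "(\<integral>X. \<Psi> X \<partial>\<pi>') = (\<integral>X. \<Psi> X \<partial>\<pi>)" by simp
  qed
  have law: "em_law M W f g \<Phi> \<nu> \<tau> N \<xi> k \<in> segment_prob \<tau>" if \<xi>: "\<xi> \<in> F 0 \<rightarrow>\<^sub>M borel_segment \<tau>" for \<xi> k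
    using D.prob_space_push[OF initial_trunc_law(1,2)[OF em \<xi>], of k]
    unfolding em_law_eq_push[OF em \<xi>] segment_prob_def by simp
  have rate: "FM_dist \<tau> (em_law M W f g \<Phi> \<nu> \<tau> N \<xi> (n + N)) \<pi>
          \<le> 2 * (c + Cq R v / (real (n - N) * dt N * c\<^sup>2)) + 2 * prob (escape R \<xi>) + 2 * (Eq / R\<^sup>2)"
    if \<xi>: "\<xi> \<in> F 0 \<rightarrow>\<^sub>M borel_segment \<tau>" and R: "0 < R" and v: "\<And>x y. norm x \<le> R \<Longrightarrow> norm y \<le> R \<Longrightarrow> V (x, y) \<le> v"
      and c: "0 < c" and n: "N < n" for \<xi> R v c n
  proof (rule FM_dist_le)
    fix \<Psi> :: "(real \<Rightarrow> real^'d) \<Rightarrow> real" assume \<Psi>: "\<Psi> \<in> FM_functions \<tau>"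
    note \<rho> = initial_trunc_law[OF em \<xi>]
    let ?\<rho> = "distr M (borel_segment \<tau>) (\<lambda>\<omega>. D.trunc_segment (\<xi> \<omega>))"
    have out: "{\<omega> \<in> space M. \<xi> \<omega> \<notin> D.bounded_segments R} = escape R \<xi>"
      using measurable_space[OF initial_measurable_M[OF em \<xi>]]
      by (auto simp: escape_def D.bounded_segments_def)
    have tail: "measure ?\<rho> (space (borel_segment \<tau>) - D.bounded_segments R) \<le> prob (escape R \<xi>)"
      using \<rho>(4)[of R] R unfolding out by simp
    have Cq: "(1 + \<tau> * D.Ch) * (4 * R\<^sup>2 + \<tau> * (D.\<beta> * (4 * R\<^sup>2) + b4 * v)) / (D.\<kappa> * (real (n - N) * dt N) * c\<^sup>2)
      = Cq R v / (real (n - N) * dt N * c\<^sup>2)"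
      unfolding Cq_def D.Ch_def D.\<beta>_def D.\<kappa>_def \<kappa>q_def \<beta>q_def by (simp only: divide_divide_eq_left mult.assoc)
    have Eq: "D.energy_bound = Eq"
      unfolding Eq_def D.energy_bound_def D.A1_def D.a_gap_def ..
    show "\<bar>(\<integral>X. \<Psi> X \<partial>em_law M W f g \<Phi> \<nu> \<tau> N \<xi> (n + N)) - (\<integral>X. \<Psi> X \<partial>\<pi>)\<bar>
        \<le> 2 * (c + Cq R v / (real (n - N) * dt N * c\<^sup>2)) + 2 * prob (escape R \<xi>) + 2 * (Eq / R\<^sup>2)"
      using D.FM_uniform[OF \<pi> \<rho>(1-3) R v c n \<Psi>] tail
      unfolding em_law_eq_push[OF em \<xi>] Cq Eq by linarith
  qed
  show ?thesis
    unfolding attracts_def using inv uniq law rate by (intro exI[of _ \<pi>]) blast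
qed

end

section \<open>Tails of the initial data and the choice of parameters\<close>

context sdde_scheme
begin

lemma escape_eq:
  assumes \<xi>: "\<xi> \<in> F 0 \<rightarrow>\<^sub>M borel_segment \<tau>" and R: "0 \<le> R"
  shows "escape R \<xi> = {\<omega> \<in> space M. R < mdist (segment_space \<tau>) (\<xi> \<omega>) (\<lambda>\<theta>\<in>{-\<tau>..0}. 0)}"
    and "escape R \<xi> \<in> events"
proof -
  have \<xi>M: "\<xi> \<in> M \<rightarrow>\<^sub>M borel_segment \<tau>"
    by (rule measurable_from_subalg[OF subalgebra_F[OF order_refl] \<xi>])
  have 0: "(\<lambda>\<theta>\<in>{-\<tau>..0}. 0 :: real^'d) \<in> mspace (segment_space \<tau>)"
    unfolding restrict_mem_mspace_iff by simp
  have "mdist (segment_space \<tau>) (\<xi> \<omega>) (\<lambda>\<theta>\<in>{-\<tau>..0}. 0) \<le> R \<longleftrightarrow> (\<forall>\<theta>\<in>{-\<tau>..0}. norm (\<xi> \<omega> \<theta>) \<le> R)"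
    if "\<omega> \<in> space M" for \<omega>
    using mdist_segment_le_iff[OF _ 0, of "\<xi> \<omega>" R] measurable_space[OF \<xi>M that] by auto
  then show *: "escape R \<xi> = {\<omega> \<in> space M. R < mdist (segment_space \<tau>) (\<xi> \<omega>) (\<lambda>\<theta>\<in>{-\<tau>..0}. 0)}"
    unfolding escape_def by force
  have "(\<lambda>\<omega>. mdist (segment_space \<tau>) (\<xi> \<omega>) (\<lambda>\<theta>\<in>{-\<tau>..0}. 0)) \<in> borel_measurable M"
    using \<xi>M 0 by (intro measurable_mdist_segment measurable_const) auto
  then show "escape R \<xi> \<in> events"
    unfolding * by measurable
qed

lemma escape_mono: "R \<le> R' \<Longrightarrow> escape R' \<xi> \<subseteq> escape R \<xi>"
  unfolding escape_def by force

lemma escape_tail: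
  assumes \<xi>: "\<xi> \<in> F 0 \<rightarrow>\<^sub>M borel_segment \<tau>" and e: "0 < e"
  shows "\<exists>R0. \<forall>R\<ge>R0. prob (escape R \<xi>) \<le> e"
proof -
  let ?Z = "\<lambda>\<omega>. mdist (segment_space \<tau>) (\<xi> \<omega>) (\<lambda>\<theta>\<in>{-\<tau>..0}. 0)"
  have ev: "escape (real n) \<xi> \<in> events" for n
    using escape_eq(2)[OF \<xi>] by simp
  have "(\<lambda>n. prob (escape (real n) \<xi>)) \<longlonglongrightarrow> prob (\<Inter>n. escape (real n) \<xi>)"
    using ev by (intro finite_Lim_measure_decseq) (auto intro!: decseq_SucI escape_mono)
  moreover have "(\<Inter>n. escape (real n) \<xi>) = {}"
  proof -
    have "\<omega> \<notin> (\<Inter>n. escape (real n) \<xi>)" for \<omega>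
    proof -
      obtain n where "?Z \<omega> < real n" using reals_Archimedean2 by blast
      then have "\<omega> \<notin> escape (real n) \<xi>" by (simp add: escape_eq(1)[OF \<xi>])
      then show ?thesis by blast
    qed
    then show ?thesis by blast
  qed
  ultimately have "(\<lambda>n. prob (escape (real n) \<xi>)) \<longlonglongrightarrow> 0" by simp
  then have "\<forall>\<^sub>F n in sequentially. prob (escape (real n) \<xi>) < e"
    using e by (rule order_tendstoD)
  then obtain n where n: "prob (escape (real n) \<xi>) < e"
    by (auto simp: eventually_sequentially)
  have "prob (escape R \<xi>) \<le> e" if "real n \<le> R" for R
    using finite_measure_mono[OF escape_mono[OF that] ev] n by linarith
  then show ?thesis by blast
qed

text \<open>Markov's inequality for the first moment of the segment norm; the estimate is the same
  for all members of the ball.\<close>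

lemma escape_ball:
  assumes \<xi>: "\<xi> \<in> initial_ball M F \<tau> B \<alpha>" and B0: "0 \<le> B" and R: "0 < R"
  shows "prob (escape R \<xi>) \<le> B / R"
proof -
  have \<xi>0: "\<xi> \<in> F 0 \<rightarrow>\<^sub>M borel_segment \<tau>" and B: "(\<integral>\<^sup>+\<omega>. ennreal (segment_norm \<tau> (\<xi> \<omega>)) \<partial>M) \<le> ennreal B"
    using \<xi> by (auto simp: initial_ball_def initial_data_def)
  have \<xi>M: "\<xi> \<in> M \<rightarrow>\<^sub>M borel_segment \<tau>"
    by (rule measurable_from_subalg[OF subalgebra_F[OF order_refl] \<xi>0])
  note ev = escape_eq(2)[OF \<xi>0 less_imp_le[OF R]]
  have "ennreal R * indicator (escape R \<xi>) \<omega> \<le> ennreal (segment_norm \<tau> (\<xi> \<omega>))" if \<omega>: "\<omega> \<in> space M" for \<omega>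
  proof (cases "\<omega> \<in> escape R \<xi>")
    case True
    then obtain \<theta> where \<theta>: "\<theta> \<in> {-\<tau>..0}" "R < norm (\<xi> \<omega> \<theta>)"
      by (auto simp: escape_def not_le)
    have "continuous_on {-\<tau>..0} (\<xi> \<omega>)"
      using measurable_space[OF \<xi>M \<omega>] by (simp add: mspace_segment_iff)
    then have "bdd_above ((\<lambda>\<theta>. norm (\<xi> \<omega> \<theta>)) ` {-\<tau>..0})"
      by (intro bounded_imp_bdd_above compact_imp_bounded compact_continuous_image continuous_on_norm) auto
    from cSUP_upper[OF \<theta>(1) this] have "R \<le> segment_norm \<tau> (\<xi> \<omega>)"
      using \<theta>(2) by (simp add: segment_norm_def)
    then show ?thesis using True by (simp add: ennreal_leI)
  qed simp
  then have "(\<integral>\<^sup>+\<omega>. ennreal R * indicator (escape R \<xi>) \<omega> \<partial>M) \<le> (\<integral>\<^sup>+\<omega>. ennreal (segment_norm \<tau> (\<xi> \<omega>)) \<partial>M)"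
    by (rule nn_integral_mono)
  with B have "(\<integral>\<^sup>+\<omega>. ennreal R * indicator (escape R \<xi>) \<omega> \<partial>M) \<le> ennreal B" by (rule order_trans[rotated])
  then have "ennreal R * ennreal (prob (escape R \<xi>)) \<le> ennreal B"
    using ev by (simp add: nn_integral_cmult_indicator emeasure_eq_measure)
  then have *: "ennreal (R * prob (escape R \<xi>)) \<le> ennreal B"
    using R by (simp add: ennreal_mult)
  have "R * prob (escape R \<xi>) \<le> B"
    using * B0 by simp
  then show ?thesis using R by (simp add: pos_le_divide_eq mult.commute)
qed

text \<open>\<open>S\<close> is a single initial datum or a ball of them: both claims require
  nothing of the initial data beyond uniformly small tails.\<close>

lemma uniform_convergence:
  fixes \<pi> :: "nat \<Rightarrow> (real \<Rightarrow> real^'d) measure"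
  assumes S: "\<And>\<xi>. \<xi> \<in> S \<Longrightarrow> \<xi> \<in> F 0 \<rightarrow>\<^sub>M borel_segment \<tau>"
    and tail: "\<And>e. 0 < e \<Longrightarrow> \<exists>R0. \<forall>R\<ge>R0. \<forall>\<xi>\<in>S. prob (escape R \<xi>) \<le> e"
    and rate: "\<And>N. admissible N \<Longrightarrow> attracts N (\<pi> N)"
    and eps: "0 < \<epsilon>"
  shows "\<exists>T>0. \<forall>\<xi>\<in>S. \<forall>N k. admissible N \<and> T \<le> real k * dt N \<longrightarrow>
    FM_dist \<tau> (em_law M W f g \<Phi> \<nu> \<tau> N \<xi> k) (\<pi> N) < \<epsilon>"
proof -
  \<comment> \<open>Four errors of at most 2c each will occur: the level c, the coalescence rate,
    the escape of \<xi> and the tail of the invariant law. Together they give 8c =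
    \<epsilon>/2.\<close>
  define c where "c = \<epsilon> / 16"
  have c: "0 < c" using eps by (simp add: c_def)
  obtain R0 where R0: "\<And>R \<xi>. R0 \<le> R \<Longrightarrow> \<xi> \<in> S \<Longrightarrow> prob (escape R \<xi>) \<le> c"
    using tail[OF c] by blast
  define R where "R = max R0 (max 1 (\<bar>Eq\<bar> / c))"
  have R: "1 \<le> R" "R0 \<le> R" "\<bar>Eq\<bar> / c \<le> R" by (auto simp: R_def)
  have ER: "Eq / R\<^sup>2 \<le> c"
  proof -
    have "Eq \<le> c * R"
      using R(3) c by (simp add: pos_divide_le_eq mult.commute)
    also have "c * R \<le> c * R\<^sup>2"
      using mult_left_mono[OF self_le_power[OF R(1), of 2], of c] c by simp
    finally show ?thesis using R(1) by (simp add: pos_divide_le_eq)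
  qed
  obtain v where v: "\<forall>x y. norm x \<le> R \<longrightarrow> norm y \<le> R \<longrightarrow> V (x, y) \<le> v"
    using continuous_bounded_on_balls[OF V_cont, of R] by blast
  \<comment> \<open>After time L the rate satisfies \<open>Cq R v\<close> / (time * c^2) \<le> c.
    The final T adds 2\<tau>: one delay for the averaging and one for the maximal
    inequality.\<close>
  define L where "L = max 1 (\<bar>Cq R v\<bar> / c ^ 3)"
  have L: "1 \<le> L" "\<bar>Cq R v\<bar> / c ^ 3 \<le> L" by (auto simp: L_def)
  have "FM_dist \<tau> (em_law M W f g \<Phi> \<nu> \<tau> N \<xi> k) (\<pi> N) < \<epsilon>"
    if \<xi>: "\<xi> \<in> S" and N: "admissible N" and k: "2 * \<tau> + L \<le> real k * dt N" for \<xi> N k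
  proof -
    have N0: "0 < N" using N tau by (cases N) (auto simp: admissible_def)
    have dt: "0 < dt N" "real N * dt N = \<tau>" using N0 tau by auto
    have "2 * real N * dt N < real k * dt N"
      using k dt(2) L(1) by (simp only: mult.assoc)
    then have "2 * real N < real k" using dt(1) by (simp only: mult_less_cancel_right_pos)
    then have kN: "2 * N < k" by linarith
    have len: "real (k - N - N) * dt N = real k * dt N - 2 * \<tau>"
    proof -
      have "real (k - N - N) = real k - real N - real N" using kN by simp
      then show ?thesis using dt(2) by (simp only: left_diff_distrib)
    qed
    have "Cq R v / (real (k - N - N) * dt N * c\<^sup>2) \<le> c"
    proof -
      have "\<bar>Cq R v\<bar> \<le> L * c ^ 3" using L(2) c by (simp add: pos_divide_le_eq)
      then have "Cq R v \<le> L * c ^ 3" by linarith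
      also have "L * c ^ 3 \<le> (real (k - N - N) * dt N) * c ^ 3"
        using k c unfolding len by (intro mult_right_mono) auto
      finally have "Cq R v \<le> c * (real (k - N - N) * dt N * c\<^sup>2)"
        by (simp only: power3_eq_cube power2_eq_square mult_ac)
      moreover have "0 < real (k - N - N) * dt N * c\<^sup>2"
        using k c L(1) unfolding len by (intro mult_pos_pos) auto
      ultimately show ?thesis by (simp only: pos_divide_le_eq)
    qed
    moreover have "FM_dist \<tau> (em_law M W f g \<Phi> \<nu> \<tau> N \<xi> (k - N + N)) (\<pi> N)
        \<le> 2 * (c + Cq R v / (real (k - N - N) * dt N * c\<^sup>2)) + 2 * prob (escape R \<xi>) + 2 * (Eq / R\<^sup>2)"
      by (rule rate[OF N, unfolded attracts_def, THEN spec, THEN spec, THEN spec, THEN spec, THEN spec, THEN mp])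
        (use S[OF \<xi>] R(1) v c kN in auto)
    moreover have "k - N + N = k" using kN by simp
    moreover have "8 * c < \<epsilon>" using eps by (simp add: c_def)
    ultimately show ?thesis using R0[OF R(2) \<xi>] ER by (smt (verit))
  qed
  moreover have "0 < 2 * \<tau> + L" using tau L(1) by simp
  ultimately show ?thesis by blast
qed

theorem truncated_em_stability:
  "\<exists>\<pi> :: nat \<Rightarrow> (real \<Rightarrow> real^'d) measure.
     (\<forall>N. real N > \<tau> \<and> \<tau> / real N \<le> \<Delta>h \<longrightarrow>
        em_asymp_stable M F W f g \<Phi> \<nu> \<tau> \<alpha> N \<and>
        em_invariant M W f g \<Phi> \<nu> \<tau> N (\<pi> N) \<and>
        (\<forall>\<pi>'. em_invariant M W f g \<Phi> \<nu> \<tau> N \<pi>' \<longrightarrow> \<pi>' = \<pi> N)) \<and>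
     (\<forall>\<xi>\<in>initial_data M F \<tau> \<alpha>. \<forall>\<epsilon>>0. \<exists>T>0. \<forall>N k.
        real N > \<tau> \<and> \<tau> / real N \<le> \<Delta>h \<and> real k * (\<tau> / real N) \<ge> T \<longrightarrow>
        FM_dist \<tau> (em_law M W f g \<Phi> \<nu> \<tau> N \<xi> k) (\<pi> N) < \<epsilon>) \<and>
     (\<forall>B>0. \<forall>\<epsilon>>0. \<exists>T>0. \<forall>\<xi>\<in>initial_ball M F \<tau> B \<alpha>. \<forall>N k.
        real N > \<tau> \<and> \<tau> / real N \<le> \<Delta>h \<and> real k * (\<tau> / real N) \<ge> T \<longrightarrow>
        FM_dist \<tau> (em_law M W f g \<Phi> \<nu> \<tau> N \<xi> k) (\<pi> N) < \<epsilon>)"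
proof -
  have "\<exists>\<pi>. \<forall>N. admissible N \<longrightarrow> em_invariant M W f g \<Phi> \<nu> \<tau> N (\<pi> N) \<and>
    (\<forall>\<pi>'. em_invariant M W f g \<Phi> \<nu> \<tau> N \<pi>' \<longrightarrow> \<pi>' = \<pi> N) \<and>
    (\<forall>\<xi>\<in>F 0 \<rightarrow>\<^sub>M borel_segment \<tau>. \<forall>k. em_law M W f g \<Phi> \<nu> \<tau> N \<xi> k \<in> segment_prob \<tau>) \<and>
    attracts N (\<pi> N)"
  proof (intro choice allI)
    fix N
    from invariant_measure_admissible[of N] show "\<exists>\<pi>. admissible N \<longrightarrow> em_invariant M W f g \<Phi> \<nu> \<tau> N \<pi> \<and>
    (\<forall>\<pi>'. em_invariant M W f g \<Phi> \<nu> \<tau> N \<pi>' \<longrightarrow> \<pi>' = \<pi>) \<and>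
    (\<forall>\<xi>\<in>F 0 \<rightarrow>\<^sub>M borel_segment \<tau>. \<forall>k. em_law M W f g \<Phi> \<nu> \<tau> N \<xi> k \<in> segment_prob \<tau>) \<and>
    attracts N \<pi>"
      by (cases "admissible N") simp_all
  qed
  then obtain \<pi> where "\<forall>N. admissible N \<longrightarrow> em_invariant M W f g \<Phi> \<nu> \<tau> N (\<pi> N) \<and>
    (\<forall>\<pi>'. em_invariant M W f g \<Phi> \<nu> \<tau> N \<pi>' \<longrightarrow> \<pi>' = \<pi> N) \<and>
    (\<forall>\<xi>\<in>F 0 \<rightarrow>\<^sub>M borel_segment \<tau>. \<forall>k. em_law M W f g \<Phi> \<nu> \<tau> N \<xi> k \<in> segment_prob \<tau>) \<and>
    attracts N (\<pi> N)" ..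
  then have inv: "admissible N \<Longrightarrow> em_invariant M W f g \<Phi> \<nu> \<tau> N (\<pi> N)"
    and uniq: "admissible N \<Longrightarrow> em_invariant M W f g \<Phi> \<nu> \<tau> N \<pi>' \<Longrightarrow> \<pi>' = \<pi> N"
    and law: "admissible N \<Longrightarrow> \<xi> \<in> F 0 \<rightarrow>\<^sub>M borel_segment \<tau> \<Longrightarrow> em_law M W f g \<Phi> \<nu> \<tau> N \<xi> k \<in> segment_prob \<tau>"
    and rate: "admissible N \<Longrightarrow> attracts N (\<pi> N)"
    for N \<pi>' \<xi> k
    by simp_all
  have data: "\<xi> \<in> F 0 \<rightarrow>\<^sub>M borel_segment \<tau>" if "\<xi> \<in> initial_data M F \<tau> \<alpha>" for \<xi> :: "'w \<Rightarrow> real \<Rightarrow> real^'d"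
    using that by (simp add: initial_data_def)
  have single: "\<exists>T>0. \<forall>N k. admissible N \<and> T \<le> real k * dt N \<longrightarrow>
      FM_dist \<tau> (em_law M W f g \<Phi> \<nu> \<tau> N \<xi> k) (\<pi> N) < \<epsilon>"
    if \<xi>: "\<xi> \<in> initial_data M F \<tau> \<alpha>" and \<epsilon>: "0 < \<epsilon>" for \<xi> \<epsilon>
  proof -
    have "\<exists>T>0. \<forall>\<xi>'\<in>{\<xi>}. \<forall>N k. admissible N \<and> T \<le> real k * dt N \<longrightarrow>
      FM_dist \<tau> (em_law M W f g \<Phi> \<nu> \<tau> N \<xi>' k) (\<pi> N) < \<epsilon>"
    proof (rule uniform_convergence[OF _ _ rate \<epsilon>])
      show "\<exists>R0. \<forall>R\<ge>R0. \<forall>\<xi>'\<in>{\<xi>}. prob (escape R \<xi>') \<le> e" if "0 < e" for e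
        using escape_tail[OF data[OF \<xi>] that] by simp
    qed (use data[OF \<xi>] in auto)
    then show ?thesis by simp
  qed
  have ball: "\<exists>T>0. \<forall>\<xi>\<in>initial_ball M F \<tau> B \<alpha>. \<forall>N k. admissible N \<and> T \<le> real k * dt N \<longrightarrow>
      FM_dist \<tau> (em_law M W f g \<Phi> \<nu> \<tau> N \<xi> k) (\<pi> N) < \<epsilon>"
    if B: "0 < B" and \<epsilon>: "0 < \<epsilon>" for B \<epsilon>
  proof (rule uniform_convergence[OF _ _ rate \<epsilon>])
    show "\<xi> \<in> F 0 \<rightarrow>\<^sub>M borel_segment \<tau>" if "\<xi> \<in> initial_ball M F \<tau> B \<alpha>" for \<xi> :: "'w \<Rightarrow> real \<Rightarrow> real^'d"
      using that data by (simp add: initial_ball_def)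
    show "\<exists>R0. \<forall>R\<ge>R0. \<forall>\<xi>\<in>initial_ball M F \<tau> B \<alpha>. prob (escape R \<xi>) \<le> e" if e: "0 < e" for e
    proof (intro exI[of _ "B / e"] allI impI ballI)
      fix R and \<xi> :: "'w \<Rightarrow> real \<Rightarrow> real^'d"
      assume R: "B / e \<le> R" and \<xi>: "\<xi> \<in> initial_ball M F \<tau> B \<alpha>"
      have "0 < B / e" using B e by simp
      with R have R0: "0 < R" by linarith
      have "B / R \<le> e" using R R0 e by (simp add: pos_divide_le_eq mult.commute)
      with escape_ball[OF \<xi> less_imp_le[OF B] R0] show "prob (escape R \<xi>) \<le> e" by linarith
    qed
  qed auto
  have stable: "em_asymp_stable M F W f g \<Phi> \<nu> \<tau> \<alpha> N" if N: "admissible N" for N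
    unfolding em_asymp_stable_def
  proof (intro bexI[of _ "\<pi> N"] ballI LIMSEQ_I)
    show \<pi>: "\<pi> N \<in> segment_prob \<tau>" using inv[OF N] by (simp add: em_invariant_def)
    have dt: "0 < dt N" using N tau by (auto simp: admissible_def)
    fix \<xi> :: "'w \<Rightarrow> real \<Rightarrow> real^'d" and \<epsilon> :: real
    assume \<xi>: "\<xi> \<in> initial_data M F \<tau> \<alpha>" and \<epsilon>: "0 < \<epsilon>"
    obtain T where T: "\<And>k. T \<le> real k * dt N \<Longrightarrow> FM_dist \<tau> (em_law M W f g \<Phi> \<nu> \<tau> N \<xi> k) (\<pi> N) < \<epsilon>"
      using single[OF \<xi> \<epsilon>] N by blast
    obtain k0 :: nat where k0: "T / dt N \<le> real k0" using real_arch_simple by blast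
    have "norm (FM_dist \<tau> (em_law M W f g \<Phi> \<nu> \<tau> N \<xi> k) (\<pi> N) - 0) < \<epsilon>" if "k0 \<le> k" for k
    proof -
      have "T / dt N \<le> real k" using k0 that by linarith
      then have "T \<le> real k * dt N" using dt by (simp only: pos_divide_le_eq)
      from T[OF this] FM_dist_nonneg[OF law[OF N data[OF \<xi>], of k] \<pi>] show ?thesis
        by simp
    qed
    then show "\<exists>k0. \<forall>k\<ge>k0. norm (FM_dist \<tau> (em_law M W f g \<Phi> \<nu> \<tau> N \<xi> k) (\<pi> N) - 0) < \<epsilon>" by blast
  qed
  have adm: "real N > \<tau> \<and> \<tau> / real N \<le> \<Delta>h \<longleftrightarrow> admissible N"
    "real N > \<tau> \<and> \<tau> / real N \<le> \<Delta>h \<and> A \<longleftrightarrow> admissible N \<and> A" for N A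
    by (auto simp: admissible_def)
  show ?thesis
    unfolding adm
  proof (intro exI[of _ \<pi>] conjI allI impI ballI)
    show "\<pi>' = \<pi> N" if "admissible N" "em_invariant M W f g \<Phi> \<nu> \<tau> N \<pi>'" for N \<pi>'
      by (rule uniq[OF that])
  qed (rule stable inv single ball; assumption)+
qed

end

theorem theorem1:
  fixes f :: "(real^'d) \<times> (real^'d) \<Rightarrow> real^'d"
    and g :: "(real^'d) \<times> (real^'d) \<Rightarrow> real^'m^'d"
    and V :: "(real^'d) \<times> (real^'d) \<Rightarrow> real"
    and M :: "'w measure" and F :: "real \<Rightarrow> 'w measure" and W :: "real \<Rightarrow> 'w \<Rightarrow> real^'m"
    and \<Phi> :: "real \<Rightarrow> real"
    and \<tau> \<nu> \<alpha> a\<^sub>1 a\<^sub>2 a\<^sub>3 b\<^sub>1 b\<^sub>2 b\<^sub>3 b\<^sub>4 K \<Delta>\<^sub>1 \<Delta>\<^sub>2 \<Delta>h :: real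
  assumes "prob_space M" and "usual_filtration M F" and "brownian_motion M F W"
    and "\<tau> > 0"
    and "f \<in> borel_measurable borel" and "g \<in> borel_measurable borel"
    and local_Lipschitz:
      "\<And>R. R > 0 \<Longrightarrow> \<exists>l>0. \<forall>x x' y y'.
         norm x \<le> R \<and> norm x' \<le> R \<and> norm y \<le> R \<and> norm y' \<le> R \<longrightarrow>
         max (norm (f (x, y) - f (x', y'))) (norm (g (x, y) - g (x', y')))
           \<le> l * (norm (x - x') + norm (y - y'))"
    and "\<alpha> \<ge> 2" and "a\<^sub>1 \<ge> 0" and "a\<^sub>2 \<ge> 0" and "a\<^sub>3 \<ge> 0" and "a\<^sub>2 > a\<^sub>3"
    and Khasminskii:
      "\<And>x y. 2 * (x \<bullet> f (x, y)) + (norm (g (x, y)))\<^sup>2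
         \<le> a\<^sub>1 - a\<^sub>2 * norm x powr \<alpha> + a\<^sub>3 * norm y powr \<alpha>"
    and "b\<^sub>1 \<ge> 0" and "b\<^sub>2 \<ge> 0" and "b\<^sub>3 \<ge> 0" and "b\<^sub>4 \<ge> 0" and "b\<^sub>1 > b\<^sub>2" and "b\<^sub>3 > b\<^sub>4"
    and "continuous_on UNIV V" and "\<And>z. V z \<ge> 0" and "\<And>x. V (x, x) = 0"
    and contraction:
      "\<And>x x' y y'.
         2 * ((x - x') \<bullet> (f (x, y) - f (x', y'))) + (norm (g (x, y) - g (x', y')))\<^sup>2
           \<le> - b\<^sub>1 * (norm (x - x'))\<^sup>2 + b\<^sub>2 * (norm (y - y'))\<^sup>2 - b\<^sub>3 * V (x, x') + b\<^sub>4 * V (y, y')"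
    and "truncation_function f g \<Phi>"
    and "0 < \<nu>" and "\<nu> \<le> 1/3"
    and K: "K = trunc_const f g \<Phi>"
    and "0 < \<Delta>\<^sub>1" and "\<Delta>\<^sub>1 < 1" and "a\<^sub>2 - 6 * K\<^sup>2 * \<Delta>\<^sub>1 powr (1 - 2 * \<nu>) > a\<^sub>3"
    and "0 < \<Delta>\<^sub>2" and "\<Delta>\<^sub>2 < 1" and "b\<^sub>1 - 4 * K\<^sup>2 * \<Delta>\<^sub>2 powr (1 - 2 * \<nu>) > b\<^sub>2"
    and "\<Delta>h = min \<Delta>\<^sub>1 \<Delta>\<^sub>2"
  shows "\<exists>\<pi> :: nat \<Rightarrow> (real \<Rightarrow> real^'d) measure.
     (\<forall>N. real N > \<tau> \<and> \<tau> / real N \<le> \<Delta>h \<longrightarrow>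
        em_asymp_stable M F W f g \<Phi> \<nu> \<tau> \<alpha> N \<and>
        em_invariant M W f g \<Phi> \<nu> \<tau> N (\<pi> N) \<and>
        (\<forall>\<pi>'. em_invariant M W f g \<Phi> \<nu> \<tau> N \<pi>' \<longrightarrow> \<pi>' = \<pi> N)) \<and>
     (\<forall>\<xi>\<in>initial_data M F \<tau> \<alpha>. \<forall>\<epsilon>>0. \<exists>T>0. \<forall>N k.
        real N > \<tau> \<and> \<tau> / real N \<le> \<Delta>h \<and> real k * (\<tau> / real N) \<ge> T \<longrightarrow>
        FM_dist \<tau> (em_law M W f g \<Phi> \<nu> \<tau> N \<xi> k) (\<pi> N) < \<epsilon>) \<and>
     (\<forall>B>0. \<forall>\<epsilon>>0. \<exists>T>0. \<forall>\<xi>\<in>initial_ball M F \<tau> B \<alpha>. \<forall>N k.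
        real N > \<tau> \<and> \<tau> / real N \<le> \<Delta>h \<and> real k * (\<tau> / real N) \<ge> T \<longrightarrow>
        FM_dist \<tau> (em_law M W f g \<Phi> \<nu> \<tau> N \<xi> k) (\<pi> N) < \<epsilon>)"
proof -
  \<comment> \<open>Taken at the smaller of the two step bounds, q is below the corresponding powers
    at both. The condition on \<Delta>2 then reads b2 + 2q < b1 - 2q after rearranging, and the
    margin 6 K^2 in the condition on \<Delta>1 covers the 2q that the energy estimate takes from
    a2.\<close>
  let ?q = "K\<^sup>2 * \<Delta>h powr (1 - 2 * \<nu>)"
  have le: "?q \<le> K\<^sup>2 * \<Delta> powr (1 - 2 * \<nu>)" if "\<Delta>h \<le> \<Delta>" for \<Delta>
    using that assms by (intro mult_left_mono powr_mono2) auto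
  have q0: "0 \<le> ?q" by simp
  have Delta_le: "\<Delta>h \<le> \<Delta>\<^sub>1" "\<Delta>h \<le> \<Delta>\<^sub>2" "\<Delta>h < 1"
    using assms by auto
  have gap_a: "a\<^sub>3 < a\<^sub>2 - 2 * ?q"
    using le[OF Delta_le(1)] q0 \<open>a\<^sub>2 - 6 * K\<^sup>2 * \<Delta>\<^sub>1 powr (1 - 2 * \<nu>) > a\<^sub>3\<close> by linarith
  have gap_b: "b\<^sub>2 + 2 * ?q < b\<^sub>1 - 2 * ?q"
    using le[OF Delta_le(2)] \<open>b\<^sub>1 - 4 * K\<^sup>2 * \<Delta>\<^sub>2 powr (1 - 2 * \<nu>) > b\<^sub>2\<close> by linarith
  have q: "(trunc_const f g \<Phi>)\<^sup>2 * \<Delta>h powr (1 - 2 * \<nu>) \<le> ?q"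
    by (simp add: K)
  interpret sdde_scheme M F W f g V \<Phi> \<tau> \<nu> \<alpha> a\<^sub>1 a\<^sub>2 a\<^sub>3 b\<^sub>1 b\<^sub>2 b\<^sub>3 b\<^sub>4 \<Delta>h ?q
    by (intro sdde_scheme.intro brownian.intro sdde_scheme_axioms.intro brownian_axioms.intro)
      (rule assms gap_a gap_b q Delta_le(3) | assumption)+
  show ?thesis
    by (rule truncated_em_stability)
qed

end
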